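(* Consider triples $(\mathbb A,B,C)$ with the Poisson brackets of type (ii): $$\{\overset{1}{\mathbb A},\overset{2}{\mathbb A}\}=r_{12}\overset{1}{\mathbb A}\overset{2}{\mathbb A}-\overset{1}{\mathbb A}\overset{2}{\mathbb A}r_{12}+\overset{1}{\mathbb A}r_{12}^{t_1}\overset{2}{\mathbb A}-\overset{2}{\mathbb A}r_{12}^{t_1}\overset{1}{\mathbb A},$$ $$\{\overset{1}{B},\overset{2}{B}\}=r_{12}\overset{1}{B}\overset{2}{B}-\overset{1}{B}\overset{2}{B}r_{12},\quad \{\overset{1}{C},\overset{2}{C}\}=r_{12}\overset{1}{C}\overset{2}{C}-\overset{1}{C}\overset{2}{C}r_{12},\quad \{\overset{1}{C},\overset{2}{B}\}=r_{12}\overset{1}{C}\overset{2}{B}-\overset{1}{C}\overset{2}{B}r_{12},$$ $$\{\overset{1}{B},\overset{2}{\mathbb A}\}=-\overset{1}{B}r_{12}^{t_2}\overset{2}{\mathbb A}-\overset{1}{B}\overset{2}{\mathbb A}r_{12},\qquad \{\overset{1}{C},\overset{2}{\mathbb A}\}=-\overset{1}{C}r_{12}^{t_2}\overset{2}{\mathbb A}-\overset{1}{C}\overset{2}{\mathbb A}r_{12}.$$ The following are $2\left[\frac N2\right]+N$ algebraically independent Casimir functions of these brackets: $\bullet$ the $\left[\frac N2\right]$ coefficients $Y_p$ of the $\lambda$-expansion $$\frac{\det(\lambda\mathbb A+\lambda^{-1}\mathbb A^{\mathrm T})}{\det\mathbb A}=(\lambda^N+\lambda^{-N})+\sum_{p=1}^{[N/2]}(\lambda^{N-2p}+\lambda^{2p-N})Y_p;$$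 $\bullet$ the $\left[\frac N2\right]$ functions $$X_p:=\frac{M_S^pM_S^{N-p}}{M_C^{N-p}M_C^p}\cdot\frac{\det B\det C}{\det\mathbb A},\qquad p=1,\dots,[N/2],$$ where $M_S^q$ are the $(q\times q)$ principal minors (situated at the upper-left corner) of the matrix $S=\mathbb A^{\mathrm T}B^{-1}$ and $M_C^q$ are the $(q\times q)$-minors of $C$ situated at the upper-right corner; $\bullet$ the $N$ coefficients $Z_p$ of the $\lambda$-expansion $$\det(B+\lambda C)/\det B=1+\sum_{p=1}^N\lambda^pZ_p.$$
   Context: $\mathbb A$ is an $N\times N$ complex matrix (generic, in particular $\det\mathbb A\neq0$), $B,C\in GL_N(\mathbb C)$. $E_{i,j}$ are the $N\times N$ matrix units. For an $N\times N$ matrix $X$ write $\overset{1}{X}=X\otimes I$, $\overset{2}{X}=I\otimes X$. For $T\in \mathrm{Mat}_N\otimes\mathrm{Mat}_N$, $T^{t_1}$ and $T^{t_2}$ denote transposition in the first, respectively second, tensor factor. $\{\overset{1}{X},\overset{2}{Y}\}=\sum_{i,j,k,l}\{x_{i,j},y_{k,l}\}E_{i,j}\otimes E_{k,l}$. The classical $r$-matrix is $r_{12}=\sum_i E_{i,i}\otimes E_{i,i}+2\sum_{i>j}E_{i,j}\otimes E_{j,i}$. $[x]$ is the integer part of $x$. Casimir functions are (rational) functions that Poisson commute with all entries of $\mathbb A$, $B$ and $C$. The upper-right $(q\times q)$-minor uses rows $1,\dots,q$ and columns $N-q+1,\dots,N$. *)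

theory Defs
  imports
    "HOL-Analysis.Analysis"
    "HOL-Library.FuncSet"
    "Jordan_Normal_Form.Determinant"
    "Jordan_Normal_Form.Gauss_Jordan_Elimination"
    "HOL-Library.Poly_Mapping"
begin

hide_const (open) Determinants.det Finite_Cartesian_Product.mat Finite_Cartesian_Product.vec

text \<open>Matrix rows and columns are numbered from 0, as in \<open>Jordan_Normal_Form\<close>.\<close>

section \<open>Triples of matrices, polynomial and rational functions of their entries\<close>

type_synonym triple = "complex mat \<times> complex mat \<times> complex mat"

datatype block = Block_A | Block_B | Block_C

type_synonym coordinate = "block \<times> nat \<times> nat"

fun component :: "block \<Rightarrow> triple \<Rightarrow> complex mat" where
  "component Block_A (A, B, C) = A"
| "component Block_B (A, B, C) = B"
| "component Block_C (A, B, C) = C"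

fun map_component :: "block \<Rightarrow> (complex mat \<Rightarrow> complex mat) \<Rightarrow> triple \<Rightarrow> triple" where
  "map_component Block_A f (A, B, C) = (f A, B, C)"
| "map_component Block_B f (A, B, C) = (A, f B, C)"
| "map_component Block_C f (A, B, C) = (A, B, f C)"

definition coordinates :: "nat \<Rightarrow> coordinate set" where
  "coordinates N = UNIV \<times> {..<N} \<times> {..<N}"

fun entry :: "coordinate \<Rightarrow> triple \<Rightarrow> complex" where
  "entry (s, i, j) x = component s x $$ (i, j)"

definition phase_space :: "nat \<Rightarrow> triple set" where
  "phase_space N = {(A, B, C). A \<in> carrier_mat N N \<and> B \<in> carrier_mat N N \<and> C \<in> carrier_mat N N
      \<and> det A \<noteq> 0 \<and> det B \<noteq> 0 \<and> det C \<noteq> 0}"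

text \<open>Polynomials in variables indexed by \<open>'v\<close> are finitely supported maps from monomials
  (finitely supported exponent functions) to coefficients.\<close>

type_synonym 'v polynomial = "('v \<Rightarrow>\<^sub>0 nat) \<Rightarrow>\<^sub>0 complex"

definition poly_vars :: "'v polynomial \<Rightarrow> 'v set" where
  "poly_vars P = (\<Union>m\<in>Poly_Mapping.keys P. Poly_Mapping.keys m)"

definition poly_eval :: "'v polynomial \<Rightarrow> ('v \<Rightarrow> complex) \<Rightarrow> complex" where
  "poly_eval P a = (\<Sum>m\<in>Poly_Mapping.keys P. Poly_Mapping.lookup P m * (\<Prod>v\<in>Poly_Mapping.keys m. a v ^ Poly_Mapping.lookup m v))"

text \<open>A rational function of the entries, given as a function regular at all points of \<open>D\<close>.
  It is only used for sets \<open>D\<close> that are complements of hypersurfaces in the space of triples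
  (hence open and dense), so that identities of rational functions may be tested on \<open>D\<close>.\<close>

definition rational_on :: "nat \<Rightarrow> triple set \<Rightarrow> (triple \<Rightarrow> complex) \<Rightarrow> bool" where
  "rational_on N D f \<longleftrightarrow> (\<exists>P Q. poly_vars P \<subseteq> coordinates N \<and> poly_vars Q \<subseteq> coordinates N
      \<and> (\<forall>x\<in>D. poly_eval Q (\<lambda>v. entry v x) \<noteq> 0
            \<and> f x = poly_eval P (\<lambda>v. entry v x) / poly_eval Q (\<lambda>v. entry v x)))"

definition algebraically_independent_on ::
    "triple set \<Rightarrow> (triple \<Rightarrow> complex) list \<Rightarrow> bool" where
  "algebraically_independent_on D fs \<longleftrightarrow>
     (\<forall>P :: nat polynomial. poly_vars P \<subseteq> {..<length fs}
        \<and> (\<forall>x\<in>D. poly_eval P (\<lambda>i. (fs ! i) x) = 0) \<longrightarrow> P = 0)"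

section \<open>The Poisson brackets\<close>

text \<open>An element of \<open>Mat\<^sub>N \<otimes> Mat\<^sub>N\<close> is represented by its coefficients: \<open>T i j k l\<close>
  is the coefficient of \<open>E\<^sub>i\<^sub>,\<^sub>j \<otimes> E\<^sub>k\<^sub>,\<^sub>l\<close> for indices below \<open>N\<close>.\<close>

type_synonym tensor = "nat \<Rightarrow> nat \<Rightarrow> nat \<Rightarrow> nat \<Rightarrow> complex"

definition transpose_1 :: "tensor \<Rightarrow> tensor" where
  "transpose_1 T = (\<lambda>i j k l. T j i k l)"

definition transpose_2 :: "tensor \<Rightarrow> tensor" where
  "transpose_2 T = (\<lambda>i j k l. T i j l k)"

definition tensor_prod :: "complex mat \<Rightarrow> complex mat \<Rightarrow> tensor" where
  "tensor_prod X Y = (\<lambda>i j k l. X $$ (i, j) * Y $$ (k, l))"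

context
  fixes N :: nat
begin

definition matrix_unit :: "nat \<Rightarrow> nat \<Rightarrow> complex mat" where
  "matrix_unit i j = mat N N (\<lambda>(a, b). if a = i \<and> b = j then 1 else 0)"

definition tensor_mult :: "tensor \<Rightarrow> tensor \<Rightarrow> tensor" (infixl \<open>\<star>\<close> 70) where
  "S \<star> T = (\<lambda>i j k l. \<Sum>a<N. \<Sum>b<N. S i a k b * T a j b l)"

definition on_first :: "complex mat \<Rightarrow> tensor" where
  "on_first X = tensor_prod X (1\<^sub>m N)"

definition on_second :: "complex mat \<Rightarrow> tensor" where
  "on_second X = tensor_prod (1\<^sub>m N) X"

definition r_matrix :: tensor where
  "r_matrix = (\<lambda>a b c d.
     (\<Sum>i<N. tensor_prod (matrix_unit i i) (matrix_unit i i) a b c d)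
     + 2 * (\<Sum>i<N. \<Sum>j<i. tensor_prod (matrix_unit i j) (matrix_unit j i) a b c d))"

definition bracket_AA :: "complex mat \<Rightarrow> tensor" where
  "bracket_AA A = (\<lambda>i j k l.
       (r_matrix \<star> on_first A \<star> on_second A) i j k l
     - (on_first A \<star> on_second A \<star> r_matrix) i j k l
     + (on_first A \<star> transpose_1 r_matrix \<star> on_second A) i j k l
     - (on_second A \<star> transpose_1 r_matrix \<star> on_first A) i j k l)"

definition bracket_group :: "complex mat \<Rightarrow> complex mat \<Rightarrow> tensor" where
  "bracket_group X Y = (\<lambda>i j k l.
       (r_matrix \<star> on_first X \<star> on_second Y) i j k l
     - (on_first X \<star> on_second Y \<star> r_matrix) i j k l)"

definition bracket_mixed :: "complex mat \<Rightarrow> complex mat \<Rightarrow> tensor" where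
  "bracket_mixed X A = (\<lambda>i j k l.
     - (on_first X \<star> transpose_2 r_matrix \<star> on_second A) i j k l
     - (on_first X \<star> on_second A \<star> r_matrix) i j k l)"

text \<open>The coefficient of \<open>E\<^sub>i\<^sub>,\<^sub>j \<otimes> E\<^sub>k\<^sub>,\<^sub>l\<close> is the bracket \<open>{x\<^sub>i\<^sub>,\<^sub>j, y\<^sub>k\<^sub>,\<^sub>l}\<close>. The brackets of \<open>B\<close> with \<open>C\<close>
  and of \<open>A\<close> with \<open>B\<close>, \<open>C\<close> are obtained from the given ones by antisymmetry.\<close>

fun structure_tensor :: "block \<Rightarrow> block \<Rightarrow> triple \<Rightarrow> tensor" where
  "structure_tensor Block_A Block_A (A, B, C) = bracket_AA A"
| "structure_tensor Block_B Block_B (A, B, C) = bracket_group B B"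
| "structure_tensor Block_C Block_C (A, B, C) = bracket_group C C"
| "structure_tensor Block_C Block_B (A, B, C) = bracket_group C B"
| "structure_tensor Block_B Block_A (A, B, C) = bracket_mixed B A"
| "structure_tensor Block_C Block_A (A, B, C) = bracket_mixed C A"
| "structure_tensor Block_B Block_C (A, B, C) = (\<lambda>i j k l. - bracket_group C B k l i j)"
| "structure_tensor Block_A Block_B (A, B, C) = (\<lambda>i j k l. - bracket_mixed B A k l i j)"
| "structure_tensor Block_A Block_C (A, B, C) = (\<lambda>i j k l. - bracket_mixed C A k l i j)"

fun coordinate_bracket :: "coordinate \<Rightarrow> coordinate \<Rightarrow> triple \<Rightarrow> complex" where
  "coordinate_bracket (s, i, j) (t, k, l) x = structure_tensor s t x i j k l"

fun partial_deriv :: "coordinate \<Rightarrow> (triple \<Rightarrow> complex) \<Rightarrow> triple \<Rightarrow> complex" where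
  "partial_deriv (s, i, j) f x =
     deriv (\<lambda>h. f (map_component s (\<lambda>X. X + h \<cdot>\<^sub>m matrix_unit i j) x)) 0"

definition poisson_bracket ::
    "(triple \<Rightarrow> complex) \<Rightarrow> (triple \<Rightarrow> complex) \<Rightarrow> triple \<Rightarrow> complex" where
  "poisson_bracket f g x = (\<Sum>u\<in>coordinates N. \<Sum>v\<in>coordinates N.
     partial_deriv u f x * partial_deriv v g x * coordinate_bracket u v x)"

definition casimir_on :: "triple set \<Rightarrow> (triple \<Rightarrow> complex) \<Rightarrow> bool" where
  "casimir_on D f \<longleftrightarrow> rational_on N D f
     \<and> (\<forall>v\<in>coordinates N. \<forall>x\<in>D. poisson_bracket f (entry v) x = 0)"

section \<open>The functions $Y_p$, $X_p$, $Z_p$\<close>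

definition Y_expansion :: "complex mat \<Rightarrow> (nat \<Rightarrow> complex) \<Rightarrow> bool" where
  "Y_expansion A y \<longleftrightarrow> (\<forall>\<mu>. \<mu> \<noteq> 0 \<longrightarrow>
     det (\<mu> \<cdot>\<^sub>m A + inverse \<mu> \<cdot>\<^sub>m transpose_mat A) / det A =
       (\<mu> powi (int N) + \<mu> powi (- int N))
       + (\<Sum>p = 1..N div 2.
            (\<mu> powi (int N - 2 * int p) + \<mu> powi (2 * int p - int N)) * y p))"

definition Z_expansion :: "complex mat \<Rightarrow> complex mat \<Rightarrow> (nat \<Rightarrow> complex) \<Rightarrow> bool" where
  "Z_expansion B C z \<longleftrightarrow>
     (\<forall>\<mu>. det (B + \<mu> \<cdot>\<^sub>m C) / det B = 1 + (\<Sum>p = 1..N. \<mu> ^ p * z p))"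

text \<open>The variable of the expansions is called \<open>\<mu>\<close>, since \<open>\<lambda>\<close> is reserved. The coefficients
  are determined by the expansion; \<open>extensional\<close> only fixes the values outside the index
  range. The definitions do not presuppose that the expansions exist.\<close>

definition Y_coeffs :: "complex mat \<Rightarrow> nat \<Rightarrow> complex" where
  "Y_coeffs A = (THE y. y \<in> extensional {1..N div 2} \<and> Y_expansion A y)"

definition Z_coeffs :: "complex mat \<Rightarrow> complex mat \<Rightarrow> nat \<Rightarrow> complex" where
  "Z_coeffs B C = (THE z. z \<in> extensional {1..N} \<and> Z_expansion B C z)"

fun Y_fun :: "nat \<Rightarrow> triple \<Rightarrow> complex" where
  "Y_fun p (A, B, C) = Y_coeffs A p"

fun Z_fun :: "nat \<Rightarrow> triple \<Rightarrow> complex" where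
  "Z_fun p (A, B, C) = Z_coeffs B C p"

definition upper_left_minor :: "nat \<Rightarrow> complex mat \<Rightarrow> complex" where
  "upper_left_minor q X = det (mat q q (\<lambda>(i, j). X $$ (i, j)))"

definition upper_right_minor :: "nat \<Rightarrow> complex mat \<Rightarrow> complex" where
  "upper_right_minor q X = det (mat q q (\<lambda>(i, j). X $$ (i, N - q + j)))"

fun X_fun :: "nat \<Rightarrow> triple \<Rightarrow> complex" where
  "X_fun p (A, B, C) =
     (let S = transpose_mat A * the (mat_inverse B) in
        (upper_left_minor p S * upper_left_minor (N - p) S)
        / (upper_right_minor (N - p) C * upper_right_minor p C)
        * (det B * det C / det A))"

definition X_domain :: "nat \<Rightarrow> triple set" where
  "X_domain p = {(A, B, C) \<in> phase_space N.
     upper_right_minor (N - p) C \<noteq> 0 \<and> upper_right_minor p C \<noteq> 0}"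

definition common_domain :: "triple set" where
  "common_domain = phase_space N \<inter> (\<Inter>p\<in>{1..N div 2}. X_domain p)"

definition casimir_list :: "(triple \<Rightarrow> complex) list" where
  "casimir_list = map Y_fun [1..<Suc (N div 2)] @ map X_fun [1..<Suc (N div 2)]
     @ map Z_fun [1..<Suc N]"

end

end

theory Submission
  imports Defs "Jordan_Normal_Form.Char_Poly"
begin

text \<open>The bracket with an entry \<open>v\<close> of the triple is differentiation along a direction
  \<open>(A', B', C')\<close>, and every such direction is tangent to a group action: it has the forms
  \<open>A' = Q\<^sup>T A + A Q\<close>, as well as \<open>B' = U B + B W\<close> and \<open>C' = U C + C W\<close>, which makes the \<open>Y\<^sub>p\<close> and \<open>Z\<^sub>p\<close>
  constant. Since \<open>r\<^sub>1\<^sub>2 + r\<^sub>2\<^sub>1\<close> is twice the permutation operator, the same directions can be rewritten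
  with triangular multipliers, \<open>S' = L S - S K\<close> and \<open>C' = K' C + C R'\<close>, so that every minor occurring in
  \<open>X\<^sub>p\<close> is an eigenvector, and the eigenvalues cancel.

  For the algebraic independence, triples of antidiagonal matrices already realise all values with
  \<open>X\<^sub>p \<noteq> 0\<close> and \<open>Z\<^sub>N \<noteq> 0\<close>: there the expansions factor completely, so \<open>Y\<close> and \<open>Z\<close> are prescribed by
  the fundamental theorem of algebra, and rescaling \<open>B\<close> and \<open>C\<close> simultaneously on the left moves the \<open>X\<^sub>p\<close>
  freely. A polynomial vanishing on all points with nonzero coordinates is zero.\<close>

section \<open>Evaluation of polynomials and rational functions\<close>

text \<open>The bracket of \<open>C\<close> with \<open>B\<close> fixes which triangular shapes
  occur: an entry of \<open>B\<close> moves \<open>C\<close> by a lower triangular left multiplier,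
  an entry of \<open>C\<close> moves \<open>B\<close> by an upper triangular one. Within a single
  block either shape is available, because the two terms with constant weight 2 produced by
  reversing the weights cancel. Hence upper-left minors of \<open>S\<close> go together with
  upper-right minors of \<open>C\<close>. The pairing of \<open>p\<close> with \<open>N - p\<close>
  has a similar source: the last \<open>q\<close> columns of \<open>C\<close> contribute a trace
  over the last \<open>q\<close> indices, which is complementary to the first \<open>N - q\<close>
  rows of \<open>S\<close>.

  \<open>Y\<^sub>p\<close> and \<open>Z\<^sub>p\<close> are given only through \<open>THE\<close>.
  They are therefore first shown to be rational, hence differentiable along lines; then the whole
  generating function is differentiated at fixed \<mu> and its coefficients are separated.

  The independence argument has to work on a torus rather than on affine space:
  \<open>Z\<^sub>N = det C / det B\<close> never vanishes on \<open>phase_space\<close>, so not all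
  values are attained.\<close>

abbreviation monomial_value :: "('v \<Rightarrow> complex) \<Rightarrow> ('v \<Rightarrow>\<^sub>0 nat) \<Rightarrow> complex" where
  "monomial_value a m \<equiv> (\<Prod>v\<in>Poly_Mapping.keys m. a v ^ Poly_Mapping.lookup m v)"

lemma monomial_value_superset:
  assumes "finite V" "Poly_Mapping.keys m \<subseteq> V"
  shows "monomial_value a m = (\<Prod>v\<in>V. a v ^ Poly_Mapping.lookup m v)"
  using assms by (intro prod.mono_neutral_left) (auto simp: in_keys_iff)

lemma monomial_value_add: "monomial_value a (m + m') = monomial_value a m * monomial_value a m'"
proof -
  let ?V = "Poly_Mapping.keys m \<union> Poly_Mapping.keys m'"
  have "monomial_value a (m + m') = (\<Prod>v\<in>?V. a v ^ Poly_Mapping.lookup (m + m') v)"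
    by (rule monomial_value_superset) (auto simp: keys_add)
  moreover have "monomial_value a m = (\<Prod>v\<in>?V. a v ^ Poly_Mapping.lookup m v)"
      "monomial_value a m' = (\<Prod>v\<in>?V. a v ^ Poly_Mapping.lookup m' v)"
    by (auto intro!: monomial_value_superset)
  ultimately show ?thesis
    by (simp add: lookup_add power_add prod.distrib)
qed

lemma poly_eval_superset:
  assumes "finite K" "Poly_Mapping.keys P \<subseteq> K"
  shows "poly_eval P a = (\<Sum>m\<in>K. Poly_Mapping.lookup P m * monomial_value a m)"
  unfolding poly_eval_def
  using assms by (intro sum.mono_neutral_left) (auto simp: in_keys_iff)

lemma poly_eval_add: "poly_eval (P + Q) a = poly_eval P a + poly_eval Q a"
proof -
  let ?K = "Poly_Mapping.keys P \<union> Poly_Mapping.keys Q"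
  have "Poly_Mapping.keys (P + Q) \<subseteq> ?K" by (rule keys_add)
  then show ?thesis
    by (simp add: poly_eval_superset[of ?K] lookup_add algebra_simps sum.distrib)
qed

lemma poly_eval_0 [simp]: "poly_eval 0 a = 0"
  by (simp add: poly_eval_def)

lemma poly_eval_sum: "poly_eval (sum P I) a = (\<Sum>i\<in>I. poly_eval (P i) a)"
  by (induction I rule: infinite_finite_induct) (auto simp: poly_eval_add)

lemma poly_eval_single: "poly_eval (Poly_Mapping.single m c) a = c * monomial_value a m"
  by (cases "c = 0") (auto simp: poly_eval_def)

lemma poly_eval_1 [simp]: "poly_eval 1 a = 1"
  using poly_eval_single[of 0 1 a] by simp

lemma poly_eval_mult: "poly_eval (P * Q) a = poly_eval P a * poly_eval Q a"
proof -
  let ?p = "\<lambda>P m. Poly_Mapping.single m (Poly_Mapping.lookup P m)"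
  have *: "P = (\<Sum>m\<in>Poly_Mapping.keys P. ?p P m)" for P :: "'a polynomial"
    by (rule poly_mapping_eqI) (auto simp: lookup_sum lookup_single when_def in_keys_iff)
  have "P * Q = (\<Sum>m\<in>Poly_Mapping.keys P. \<Sum>m'\<in>Poly_Mapping.keys Q. ?p P m * ?p Q m')"
    by (subst (1) *[of P], subst (1) *[of Q]) (simp add: sum_product)
  then have "poly_eval (P * Q) a =
      (\<Sum>m\<in>Poly_Mapping.keys P. \<Sum>m'\<in>Poly_Mapping.keys Q. poly_eval (?p P m) a * poly_eval (?p Q m') a)"
    by (simp add: poly_eval_sum mult_single poly_eval_single monomial_value_add mult_ac)
  then show ?thesis
    by (subst (1) *[of P], subst (1) *[of Q]) (simp add: poly_eval_sum sum_product)
qed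

lemma poly_vars_add: "poly_vars (P + Q) \<subseteq> poly_vars P \<union> poly_vars Q"
  using keys_add[of P Q] by (auto simp: poly_vars_def)

lemma poly_vars_mult: "poly_vars (P * Q) \<subseteq> poly_vars P \<union> poly_vars Q"
proof
  fix v assume "v \<in> poly_vars (P * Q)"
  then obtain m where "m \<in> Poly_Mapping.keys (P * Q)" "v \<in> Poly_Mapping.keys m"
    by (auto simp: poly_vars_def)
  with keys_mult[of P Q] obtain k l where "k \<in> Poly_Mapping.keys P" "l \<in> Poly_Mapping.keys Q" "m = k + l"
    by blast
  with \<open>v \<in> Poly_Mapping.keys m\<close> keys_add[of k l] show "v \<in> poly_vars P \<union> poly_vars Q"
    by (auto simp: poly_vars_def)
qed

section \<open>Closure properties of rational functions of the entries\<close>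

lemma rational_onI:
  assumes "poly_vars P \<subseteq> coordinates N" "poly_vars Q \<subseteq> coordinates N"
    and "\<And>x. x \<in> D \<Longrightarrow> poly_eval Q (\<lambda>v. entry v x) \<noteq> 0"
    and "\<And>x. x \<in> D \<Longrightarrow> f x = poly_eval P (\<lambda>v. entry v x) / poly_eval Q (\<lambda>v. entry v x)"
  shows "rational_on N D f"
  using assms unfolding rational_on_def by blast

lemma rational_onE:
  assumes "rational_on N D f"
  obtains P Q where "poly_vars P \<subseteq> coordinates N" "poly_vars Q \<subseteq> coordinates N"
    and "\<And>x. x \<in> D \<Longrightarrow> poly_eval Q (\<lambda>v. entry v x) \<noteq> 0"
    and "\<And>x. x \<in> D \<Longrightarrow> f x = poly_eval P (\<lambda>v. entry v x) / poly_eval Q (\<lambda>v. entry v x)"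
  using assms unfolding rational_on_def by blast

lemma rational_on_cong:
  assumes "rational_on N D f" "\<And>x. x \<in> D \<Longrightarrow> g x = f x"
  shows "rational_on N D g"
  using assms unfolding rational_on_def by auto

lemma rational_on_subset: "rational_on N D f \<Longrightarrow> D' \<subseteq> D \<Longrightarrow> rational_on N D' f"
  unfolding rational_on_def by blast

lemma rational_on_const: "rational_on N D (\<lambda>x. c)"
  by (rule rational_onI[of "Poly_Mapping.single 0 c" _ "Poly_Mapping.single 0 1"])
    (auto simp: poly_vars_def poly_eval_single)

lemma rational_on_entry: "v \<in> coordinates N \<Longrightarrow> rational_on N D (entry v)"
  by (rule rational_onI[of "Poly_Mapping.single (Poly_Mapping.single v 1) 1" _ "Poly_Mapping.single 0 1"])
    (auto simp: poly_vars_def poly_eval_single)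

lemma rational_on_add:
  assumes "rational_on N D f" "rational_on N D g"
  shows "rational_on N D (\<lambda>x. f x + g x)"
proof -
  obtain P Q where 1: "poly_vars P \<subseteq> coordinates N" "poly_vars Q \<subseteq> coordinates N"
    "\<And>x. x \<in> D \<Longrightarrow> poly_eval Q (\<lambda>v. entry v x) \<noteq> 0"
    "\<And>x. x \<in> D \<Longrightarrow> f x = poly_eval P (\<lambda>v. entry v x) / poly_eval Q (\<lambda>v. entry v x)"
    using rational_onE[OF assms(1)] by metis
  obtain P' Q' where 2: "poly_vars P' \<subseteq> coordinates N" "poly_vars Q' \<subseteq> coordinates N"
    "\<And>x. x \<in> D \<Longrightarrow> poly_eval Q' (\<lambda>v. entry v x) \<noteq> 0"
    "\<And>x. x \<in> D \<Longrightarrow> g x = poly_eval P' (\<lambda>v. entry v x) / poly_eval Q' (\<lambda>v. entry v x)"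
    using rational_onE[OF assms(2)] by metis
  show ?thesis
  proof (rule rational_onI[of "P * Q' + P' * Q" _ "Q * Q'"])
    show "poly_vars (P * Q' + P' * Q) \<subseteq> coordinates N"
      using 1(1,2) 2(1,2) poly_vars_add[of "P * Q'" "P' * Q"] poly_vars_mult[of P Q'] poly_vars_mult[of P' Q]
      by blast
    show "poly_vars (Q * Q') \<subseteq> coordinates N"
      using 1(2) 2(2) poly_vars_mult[of Q Q'] by blast
  qed (simp_all add: 1(3,4) 2(3,4) poly_eval_add poly_eval_mult add_frac_eq)
qed

lemma rational_on_mult:
  assumes "rational_on N D f" "rational_on N D g"
  shows "rational_on N D (\<lambda>x. f x * g x)"
proof -
  obtain P Q where 1: "poly_vars P \<subseteq> coordinates N" "poly_vars Q \<subseteq> coordinates N"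
    "\<And>x. x \<in> D \<Longrightarrow> poly_eval Q (\<lambda>v. entry v x) \<noteq> 0"
    "\<And>x. x \<in> D \<Longrightarrow> f x = poly_eval P (\<lambda>v. entry v x) / poly_eval Q (\<lambda>v. entry v x)"
    using rational_onE[OF assms(1)] by metis
  obtain P' Q' where 2: "poly_vars P' \<subseteq> coordinates N" "poly_vars Q' \<subseteq> coordinates N"
    "\<And>x. x \<in> D \<Longrightarrow> poly_eval Q' (\<lambda>v. entry v x) \<noteq> 0"
    "\<And>x. x \<in> D \<Longrightarrow> g x = poly_eval P' (\<lambda>v. entry v x) / poly_eval Q' (\<lambda>v. entry v x)"
    using rational_onE[OF assms(2)] by metis
  show ?thesis
  proof (rule rational_onI[of "P * P'" _ "Q * Q'"])
    show "poly_vars (P * P') \<subseteq> coordinates N" "poly_vars (Q * Q') \<subseteq> coordinates N"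
      using 1(1,2) 2(1,2) poly_vars_mult[of Q Q'] poly_vars_mult[of P P'] by blast+
  qed (use 1(3,4) 2(3,4) in \<open>auto simp: poly_eval_mult\<close>)
qed

lemma rational_on_inverse:
  assumes "rational_on N D f" "\<And>x. x \<in> D \<Longrightarrow> f x \<noteq> 0"
  shows "rational_on N D (\<lambda>x. inverse (f x))"
proof -
  obtain P Q where 1: "poly_vars P \<subseteq> coordinates N" "poly_vars Q \<subseteq> coordinates N"
    "\<And>x. x \<in> D \<Longrightarrow> poly_eval Q (\<lambda>v. entry v x) \<noteq> 0"
    "\<And>x. x \<in> D \<Longrightarrow> f x = poly_eval P (\<lambda>v. entry v x) / poly_eval Q (\<lambda>v. entry v x)"
    using rational_onE[OF assms(1)] by metis
  show ?thesis
    by (rule rational_onI[of Q _ P]) (use 1 assms(2) in auto)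
qed

lemma rational_on_divide:
  assumes "rational_on N D f" "rational_on N D g" "\<And>x. x \<in> D \<Longrightarrow> g x \<noteq> 0"
  shows "rational_on N D (\<lambda>x. f x / g x)"
  using rational_on_mult[OF assms(1) rational_on_inverse[OF assms(2,3)]] by (simp add: divide_inverse)

lemma rational_on_sum:
  "(\<And>i. i \<in> I \<Longrightarrow> rational_on N D (f i)) \<Longrightarrow> rational_on N D (\<lambda>x. \<Sum>i\<in>I. f i x)"
  by (induction I rule: infinite_finite_induct) (auto intro: rational_on_const rational_on_add)

lemma rational_on_prod:
  "(\<And>i. i \<in> I \<Longrightarrow> rational_on N D (f i)) \<Longrightarrow> rational_on N D (\<lambda>x. \<Prod>i\<in>I. f i x)"
  by (induction I rule: infinite_finite_induct) (auto intro: rational_on_const rational_on_mult)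

lemma rational_on_det:
  assumes "\<And>i j. i < n \<Longrightarrow> j < n \<Longrightarrow> rational_on N D (\<lambda>x. M x $$ (i, j))"
    and "\<And>x. x \<in> D \<Longrightarrow> M x \<in> carrier_mat n n"
  shows "rational_on N D (\<lambda>x. det (M x))"
proof -
  have "rational_on N D (\<lambda>x. \<Sum>p\<in>{p. p permutes {0..<n}}. signof p * (\<Prod>i = 0..<n. M x $$ (i, p i)))"
    by (intro rational_on_sum rational_on_mult rational_on_const rational_on_prod assms(1))
      (auto simp: permutes_in_image dest: permutes_in_image)
  then show ?thesis
    by (rule rational_on_cong) (simp add: det_def'[OF assms(2)])
qed

section \<open>Directional derivatives of polynomials and their quotients\<close>

text \<open>Weaker than differentiability, since the derivatives are taken along lines only; it suffices for
  Poisson brackets.\<close>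

definition has_gradient :: "'v set \<Rightarrow> (('v \<Rightarrow> complex) \<Rightarrow> complex) \<Rightarrow> ('v \<Rightarrow> complex) \<Rightarrow> bool" where
  "has_gradient V F a \<longleftrightarrow> (\<exists>g. \<forall>w.
     ((\<lambda>h. F (\<lambda>v. a v + h * w v)) has_field_derivative (\<Sum>v\<in>V. g v * w v)) (at 0))"

lemma has_gradient_const: "has_gradient V (\<lambda>_. c) a"
  unfolding has_gradient_def by (intro exI[of _ "\<lambda>_. 0"]) auto

lemma has_gradient_var:
  assumes "finite V" "v \<in> V"
  shows "has_gradient V (\<lambda>b. b v) a"
  unfolding has_gradient_def
proof (intro exI[of _ "\<lambda>u. if u = v then 1 else 0"] allI)
  fix w :: "'a \<Rightarrow> complex"
  have "(\<Sum>u\<in>V. (if u = v then 1 else 0) * w u) = w v"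
    using assms by (simp add: if_distrib[of "\<lambda>x. x * _"] cong: if_cong)
  then show "((\<lambda>h. a v + h * w v) has_field_derivative (\<Sum>u\<in>V. (if u = v then 1 else 0) * w u)) (at 0)"
    by (auto intro!: derivative_eq_intros)
qed

lemma has_gradient_add:
  assumes "has_gradient V F a" "has_gradient V G a"
  shows "has_gradient V (\<lambda>b. F b + G b) a"
proof -
  obtain f g where
    "\<And>w. ((\<lambda>h. F (\<lambda>v. a v + h * w v)) has_field_derivative (\<Sum>v\<in>V. f v * w v)) (at 0)"
    "\<And>w. ((\<lambda>h. G (\<lambda>v. a v + h * w v)) has_field_derivative (\<Sum>v\<in>V. g v * w v)) (at 0)"
    using assms unfolding has_gradient_def by blast
  from DERIV_add[OF this] show ?thesis
    unfolding has_gradient_def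
    by (intro exI[of _ "\<lambda>v. f v + g v"]) (simp add: algebra_simps sum.distrib)
qed

lemma has_gradient_mult:
  assumes "has_gradient V F a" "has_gradient V G a"
  shows "has_gradient V (\<lambda>b. F b * G b) a"
proof -
  obtain f g where
    f: "\<And>w. ((\<lambda>h. F (\<lambda>v. a v + h * w v)) has_field_derivative (\<Sum>v\<in>V. f v * w v)) (at 0)"
    and g: "\<And>w. ((\<lambda>h. G (\<lambda>v. a v + h * w v)) has_field_derivative (\<Sum>v\<in>V. g v * w v)) (at 0)"
    using assms unfolding has_gradient_def by blast
  have "((\<lambda>h. F (\<lambda>v. a v + h * w v) * G (\<lambda>v. a v + h * w v)) has_field_derivative
      (\<Sum>v\<in>V. (f v * G a + g v * F a) * w v)) (at 0)" for w
    using DERIV_mult[OF f[of w] g[of w]]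
    by (simp add: algebra_simps sum.distrib sum_distrib_left)
  then show ?thesis
    unfolding has_gradient_def by (intro exI[of _ "\<lambda>v. f v * G a + g v * F a"]) blast
qed

lemma has_gradient_inverse:
  assumes "has_gradient V F a" "F a \<noteq> 0"
  shows "has_gradient V (\<lambda>b. inverse (F b)) a"
proof -
  obtain f where
    f: "\<And>w. ((\<lambda>h. F (\<lambda>v. a v + h * w v)) has_field_derivative (\<Sum>v\<in>V. f v * w v)) (at 0)"
    using assms unfolding has_gradient_def by blast
  have "((\<lambda>h. inverse (F (\<lambda>v. a v + h * w v))) has_field_derivative
      (\<Sum>v\<in>V. - (inverse (F a) * f v * inverse (F a)) * w v)) (at 0)" for w
    using DERIV_inverse'[OF f[of w]] assms(2)
    by (simp add: sum_distrib_left sum_distrib_right sum_negf mult_ac)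
  then show ?thesis
    unfolding has_gradient_def by (intro exI[of _ "\<lambda>v. - (inverse (F a) * f v * inverse (F a))"]) blast
qed

lemma has_gradient_power: "has_gradient V F a \<Longrightarrow> has_gradient V (\<lambda>b. F b ^ n) a"
  by (induction n) (auto intro: has_gradient_const has_gradient_mult)

lemma has_gradient_poly_eval:
  assumes "finite V" "poly_vars P \<subseteq> V"
  shows "has_gradient V (poly_eval P) a"
proof -
  have sums: "has_gradient V (\<lambda>b. \<Sum>i\<in>I. F i b) a"
    if "\<And>i. i \<in> I \<Longrightarrow> has_gradient V (F i) a" for I and F :: "('a \<Rightarrow>\<^sub>0 nat) \<Rightarrow> _"
    using that
    by (induction I rule: infinite_finite_induct) (auto intro: has_gradient_const has_gradient_add)
  have prods: "has_gradient V (\<lambda>b. \<Prod>i\<in>I. F i b) a"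
    if "\<And>i. i \<in> I \<Longrightarrow> has_gradient V (F i) a" for I and F :: "'a \<Rightarrow> _"
    using that
    by (induction I rule: infinite_finite_induct) (auto intro: has_gradient_const has_gradient_mult)
  show ?thesis
    unfolding poly_eval_def
    by (intro sums has_gradient_mult has_gradient_const prods has_gradient_power has_gradient_var)
      (use assms in \<open>auto simp: poly_vars_def\<close>)
qed

section \<open>Poisson brackets as derivatives along lines\<close>

definition triple_carrier :: "nat \<Rightarrow> triple set" where
  "triple_carrier N = carrier_mat N N \<times> carrier_mat N N \<times> carrier_mat N N"

fun line :: "triple \<Rightarrow> triple \<Rightarrow> complex \<Rightarrow> triple" where
  "line (A, B, C) (A', B', C') h = (A + h \<cdot>\<^sub>m A', B + h \<cdot>\<^sub>m B', C + h \<cdot>\<^sub>m C')"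

lemma UNIV_block: "(UNIV :: block set) = {Block_A, Block_B, Block_C}"
  by (auto intro: block.exhaust)

lemma finite_coordinates [simp]: "finite (coordinates N)"
  by (simp add: coordinates_def UNIV_block)

lemma phase_space_subset_carrier: "phase_space N \<subseteq> triple_carrier N"
  by (auto simp: phase_space_def triple_carrier_def)

lemma line_0: "x \<in> triple_carrier N \<Longrightarrow> w \<in> triple_carrier N \<Longrightarrow> line x w 0 = x"
  by (cases x; cases w) (auto simp: triple_carrier_def intro!: eq_matI)

lemma line_in_carrier: "x \<in> triple_carrier N \<Longrightarrow> w \<in> triple_carrier N \<Longrightarrow> line x w h \<in> triple_carrier N"
  by (cases x; cases w) (auto simp: triple_carrier_def)

lemma entry_line:
  "x \<in> triple_carrier N \<Longrightarrow> w \<in> triple_carrier N \<Longrightarrow> v \<in> coordinates N \<Longrightarrow>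
   entry v (line x w h) = entry v x + h * entry v w"
  by (cases x; cases w; cases v; cases "fst v") (auto simp: triple_carrier_def coordinates_def)

fun unit_direction :: "nat \<Rightarrow> coordinate \<Rightarrow> triple" where
  "unit_direction N (s, i, j) = map_component s (\<lambda>_. matrix_unit N i j) (0\<^sub>m N N, 0\<^sub>m N N, 0\<^sub>m N N)"

lemma unit_direction_in_carrier: "unit_direction N v \<in> triple_carrier N"
  by (cases v; cases "fst v") (auto simp: triple_carrier_def matrix_unit_def)

lemma entry_unit_direction:
  "u \<in> coordinates N \<Longrightarrow> v \<in> coordinates N \<Longrightarrow> entry u (unit_direction N v) = (if u = v then 1 else 0)"
  by (cases u; cases v; cases "fst u"; cases "fst v") (auto simp: coordinates_def matrix_unit_def)

lemma map_component_eq_line: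
  "x \<in> triple_carrier N \<Longrightarrow>
   map_component s (\<lambda>X. X + h \<cdot>\<^sub>m matrix_unit N i j) x = line x (unit_direction N (s, i, j)) h"
  by (cases x; cases s) (auto simp: triple_carrier_def intro!: eq_matI)

lemma poly_eval_entries_cong:
  assumes "poly_vars P \<subseteq> V" "\<And>v. v \<in> V \<Longrightarrow> a v = b v"
  shows "poly_eval P a = poly_eval P b"
  unfolding poly_eval_def
  using assms by (intro sum.cong prod.cong arg_cong2[where f = "(*)"] arg_cong2[where f = "(^)"] refl)
    (auto simp: poly_vars_def)

text \<open>One vector \<open>g\<close> serves all directions \<open>w\<close>: this linearity is
  the chain rule that lets partial derivatives be combined into a derivative along an arbitrary
  line. The function is only known to be \<open>P / Q\<close> on \<open>D\<close>, so the line has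
  to stay in \<open>D\<close> for small \<open>h\<close>.\<close>

lemma rational_on_gradient:
  assumes f: "rational_on N D f" and x: "x \<in> D" "x \<in> triple_carrier N"
    and D: "\<And>w. w \<in> triple_carrier N \<Longrightarrow> \<forall>\<^sub>F h in nhds 0. line x w h \<in> D"
  obtains g where "\<And>w. w \<in> triple_carrier N \<Longrightarrow>
    ((\<lambda>h. f (line x w h)) has_field_derivative (\<Sum>v\<in>coordinates N. g v * entry v w)) (at 0)"
proof -
  obtain P Q where PQ: "poly_vars P \<subseteq> coordinates N" "poly_vars Q \<subseteq> coordinates N"
    "\<And>x. x \<in> D \<Longrightarrow> poly_eval Q (\<lambda>v. entry v x) \<noteq> 0"
    "\<And>x. x \<in> D \<Longrightarrow> f x = poly_eval P (\<lambda>v. entry v x) / poly_eval Q (\<lambda>v. entry v x)"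
    using rational_onE[OF f] by metis
  define F where "F = (\<lambda>a. poly_eval P a * inverse (poly_eval Q a))"
  have "has_gradient (coordinates N) F (\<lambda>v. entry v x)"
    unfolding F_def
    by (intro has_gradient_mult has_gradient_inverse has_gradient_poly_eval PQ x finite_coordinates)
  then obtain g where g: "\<And>w. ((\<lambda>h. F (\<lambda>v. entry v x + h * w v)) has_field_derivative
      (\<Sum>v\<in>coordinates N. g v * w v)) (at 0)"
    unfolding has_gradient_def by blast
  show thesis
  proof (rule that)
    fix w assume w: "w \<in> triple_carrier N"
    show "((\<lambda>h. f (line x w h)) has_field_derivative (\<Sum>v\<in>coordinates N. g v * entry v w)) (at 0)"
    proof (rule DERIV_cong_ev[THEN iffD1, OF refl _ refl g])
      show "\<forall>\<^sub>F h in nhds 0. F (\<lambda>v. entry v x + h * entry v w) = f (line x w h)"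
        using D[OF w]
      proof eventually_elim
        case (elim h)
        then have "f (line x w h) = F (\<lambda>v. entry v (line x w h))"
          by (simp add: PQ(4) F_def divide_inverse)
        also have "\<dots> = F (\<lambda>v. entry v x + h * entry v w)"
          unfolding F_def using PQ(1,2) x(2) w
          by (intro arg_cong2[where f = "(*)"] arg_cong[where f = inverse]
              poly_eval_entries_cong[where V = "coordinates N"]) (auto simp: entry_line)
        finally show ?case ..
      qed
    qed
  qed
qed

text \<open>Makes complements of hypersurfaces open along lines. Regularity on the whole carrier,
  which every line respects, gives differentiability and hence continuity at 0 without any prior
  knowledge of the smaller domain.\<close>

lemma eventually_line_nonzero:
  assumes f: "rational_on N (triple_carrier N) f" and x: "x \<in> triple_carrier N" "f x \<noteq> 0"
    and w: "w \<in> triple_carrier N"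
  shows "\<forall>\<^sub>F h in nhds 0. f (line x w h) \<noteq> 0"
proof -
  obtain g where "\<And>w. w \<in> triple_carrier N \<Longrightarrow>
    ((\<lambda>h. f (line x w h)) has_field_derivative (\<Sum>v\<in>coordinates N. g v * entry v w)) (at 0)"
    using rational_on_gradient[OF f x(1) x(1)] x by (auto simp: line_in_carrier)
  from this[OF w] have "isCont (\<lambda>h. f (line x w h)) 0"
    by (rule DERIV_isCont)
  then have "((\<lambda>h. f (line x w h)) \<longlongrightarrow> f (line x w 0)) (nhds 0)"
    by (simp add: isCont_def tendsto_nhds_iff)
  then show ?thesis
    by (rule tendsto_imp_eventually_ne) (use x w in \<open>simp add: line_0\<close>)
qed

text \<open>The value at \<open>x\<close> of the Hamiltonian vector field of the coordinate
  \<open>v\<close>, with \<open>v\<close> in the second slot of the bracket.\<close>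

definition hamiltonian_direction :: "nat \<Rightarrow> coordinate \<Rightarrow> triple \<Rightarrow> triple" where
  "hamiltonian_direction N v x =
     (mat N N (\<lambda>(i, j). coordinate_bracket N (Block_A, i, j) v x),
      mat N N (\<lambda>(i, j). coordinate_bracket N (Block_B, i, j) v x),
      mat N N (\<lambda>(i, j). coordinate_bracket N (Block_C, i, j) v x))"

lemma hamiltonian_direction_in_carrier: "hamiltonian_direction N v x \<in> triple_carrier N"
  by (auto simp: hamiltonian_direction_def triple_carrier_def)

lemma entry_hamiltonian_direction:
  "u \<in> coordinates N \<Longrightarrow> entry u (hamiltonian_direction N v x) = coordinate_bracket N u v x"
  by (cases u; cases "fst u") (auto simp: hamiltonian_direction_def coordinates_def)

text \<open>The partial derivatives of \<open>entry v\<close> are Kronecker deltas, so the double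
  sum collapses to the gradient of \<open>f\<close> paired with the Hamiltonian vector
  field.\<close>

lemma poisson_bracket_entry:
  assumes f: "rational_on N D f" and x: "x \<in> D" "x \<in> triple_carrier N"
    and D: "\<And>w. w \<in> triple_carrier N \<Longrightarrow> \<forall>\<^sub>F h in nhds 0. line x w h \<in> D"
    and v: "v \<in> coordinates N"
  shows "((\<lambda>h. f (line x (hamiltonian_direction N v x) h)) has_field_derivative
           poisson_bracket N f (entry v) x) (at 0)"
proof -
  obtain g where g: "\<And>w. w \<in> triple_carrier N \<Longrightarrow>
    ((\<lambda>h. f (line x w h)) has_field_derivative (\<Sum>v\<in>coordinates N. g v * entry v w)) (at 0)"
    using rational_on_gradient[OF f x D] by blast
  have pd: "partial_deriv N u f x = g u" if "u \<in> coordinates N" for u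
  proof -
    obtain s i j where u: "u = (s, i, j)" by (cases u)
    have "((\<lambda>h. f (line x (unit_direction N u) h)) has_field_derivative g u) (at 0)"
      using g[OF unit_direction_in_carrier, of u] that
      by (simp add: entry_unit_direction if_distrib[of "\<lambda>x. _ * x"] cong: if_cong)
    then show ?thesis
      unfolding u using x by (simp add: map_component_eq_line DERIV_imp_deriv)
  qed
  have pe: "partial_deriv N u (entry v) x = (if u = v then 1 else 0)" if "u \<in> coordinates N" for u
  proof -
    obtain s i j where u: "u = (s, i, j)" by (cases u)
    have "((\<lambda>h. entry v (line x (unit_direction N u) h)) has_field_derivative (if v = u then 1 else 0)) (at 0)"
      using x(2) v that
      by (auto simp: entry_line unit_direction_in_carrier entry_unit_direction intro!: derivative_eq_intros)
    then show ?thesis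
      unfolding u using x by (auto simp: map_component_eq_line DERIV_imp_deriv)
  qed
  have "poisson_bracket N f (entry v) x = (\<Sum>u\<in>coordinates N. g u * coordinate_bracket N u v x)"
    unfolding poisson_bracket_def
  proof (rule sum.cong[OF refl])
    fix u assume u: "u \<in> coordinates N"
    have "(\<Sum>v'\<in>coordinates N. partial_deriv N u f x * partial_deriv N v' (entry v) x * coordinate_bracket N u v' x)
        = (\<Sum>v'\<in>coordinates N. if v' = v then g u * coordinate_bracket N u v' x else 0)"
      by (rule sum.cong) (auto simp: pd u pe)
    then show "(\<Sum>v'\<in>coordinates N. partial_deriv N u f x * partial_deriv N v' (entry v) x * coordinate_bracket N u v' x)
        = g u * coordinate_bracket N u v x"
      using v by simp
  qed
  also have "\<dots> = (\<Sum>u\<in>coordinates N. g u * entry u (hamiltonian_direction N v x))"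
    by (simp add: entry_hamiltonian_direction)
  finally show ?thesis
    using g[OF hamiltonian_direction_in_carrier] by simp
qed

section \<open>The domains are open along lines\<close>

lemma rational_on_entries:
  "i < N \<Longrightarrow> j < N \<Longrightarrow> rational_on N D (\<lambda>x. component s x $$ (i, j))"
  by (rule rational_on_cong[OF rational_on_entry[of "(s, i, j)"]]) (simp_all add: coordinates_def)

lemma carrier_component: "x \<in> triple_carrier N \<Longrightarrow> component s x \<in> carrier_mat N N"
  by (cases x; cases s) (auto simp: triple_carrier_def)

lemma mem_phase_space_iff:
  "x \<in> phase_space N \<longleftrightarrow> x \<in> triple_carrier N \<and> det (component Block_A x) \<noteq> 0
     \<and> det (component Block_B x) \<noteq> 0 \<and> det (component Block_C x) \<noteq> 0"
  by (cases x) (auto simp: phase_space_def triple_carrier_def)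

lemma eventually_line_phase_space:
  assumes x: "x \<in> phase_space N" and w: "w \<in> triple_carrier N"
  shows "\<forall>\<^sub>F h in nhds 0. line x w h \<in> phase_space N"
proof -
  have x': "x \<in> triple_carrier N" using x phase_space_subset_carrier by blast
  have "\<forall>\<^sub>F h in nhds 0. det (component s (line x w h)) \<noteq> 0" for s
  proof (rule eventually_line_nonzero[OF _ x' _ w])
    show "rational_on N (triple_carrier N) (\<lambda>x. det (component s x))"
      by (intro rational_on_det[where n = N] rational_on_entries carrier_component)
    show "det (component s x) \<noteq> 0"
      using x by (cases s) (auto simp: mem_phase_space_iff)
  qed
  from this[of Block_A] this[of Block_B] this[of Block_C] show ?thesis
    by eventually_elim (use x' w in \<open>auto simp: mem_phase_space_iff line_in_carrier\<close>)
qed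

lemma rational_on_upper_right_minor:
  assumes "q \<le> N"
  shows "rational_on N D (\<lambda>x. upper_right_minor N q (component Block_C x))"
  unfolding upper_right_minor_def
  by (rule rational_on_det[where n = q]) (use assms in \<open>auto intro!: rational_on_entries simp del: component.simps\<close>)

lemma mem_X_domain_iff:
  "x \<in> X_domain N p \<longleftrightarrow> x \<in> phase_space N \<and> upper_right_minor N (N - p) (component Block_C x) \<noteq> 0
     \<and> upper_right_minor N p (component Block_C x) \<noteq> 0"
  by (cases x) (auto simp: X_domain_def)

lemma eventually_line_X_domain:
  assumes x: "x \<in> X_domain N p" and w: "w \<in> triple_carrier N" and p: "p \<le> N"
  shows "\<forall>\<^sub>F h in nhds 0. line x w h \<in> X_domain N p"
proof -
  have x': "x \<in> triple_carrier N" "x \<in> phase_space N"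
    using x phase_space_subset_carrier by (auto simp: mem_X_domain_iff)
  have *: "\<forall>\<^sub>F h in nhds 0. upper_right_minor N q (component Block_C (line x w h)) \<noteq> 0"
    if "q \<le> N" "upper_right_minor N q (component Block_C x) \<noteq> 0" for q
    by (rule eventually_line_nonzero[OF rational_on_upper_right_minor[OF that(1)] x'(1) that(2) w])
  have "\<forall>\<^sub>F h in nhds 0. upper_right_minor N p (component Block_C (line x w h)) \<noteq> 0"
    "\<forall>\<^sub>F h in nhds 0. upper_right_minor N (N - p) (component Block_C (line x w h)) \<noteq> 0"
    using x p by (auto intro!: * simp: mem_X_domain_iff)
  with eventually_line_phase_space[OF x'(2) w] show ?thesis
    by eventually_elim (simp add: mem_X_domain_iff)
qed

section \<open>The Hamiltonian directions\<close>

text \<open>The coefficient of \<open>matrix_unit i k\<close> tensor \<open>matrix_unit k i\<close>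
  in the classical r-matrix. All other coefficients vanish, so each contraction below retains a
  single weight.\<close>

definition r_weight :: "nat \<Rightarrow> nat \<Rightarrow> complex" where
  "r_weight i k = (if i = k then 1 else if k < i then 2 else 0)"

text \<open>The identity \<open>r\<^sub>1\<^sub>2 + r\<^sub>2\<^sub>1 = 2 P\<close>, with \<open>P\<close> the permutation operator, in terms of weights.\<close>

lemma r_weight_swap: "r_weight i k = 2 - r_weight k i"
  by (auto simp: r_weight_def)

lemma r_weight_same [simp]: "r_weight i i = 1"
  by (simp add: r_weight_def)

lemma r_weight_eq_0: "i < k \<Longrightarrow> r_weight i k = 0"
  by (simp add: r_weight_def)

lemma r_matrix_eq:
  assumes "a < N" "b < N" "c < N" "d < N"
  shows "r_matrix N a b c d = (if a = d \<and> b = c then r_weight a b else 0)"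
proof -
  have 1: "(\<Sum>i<N. tensor_prod (matrix_unit N i i) (matrix_unit N i i) a b c d)
      = (\<Sum>i<N. if i = a then (if b = a \<and> c = a \<and> d = a then 1 else 0) else 0)"
    using assms by (intro sum.cong) (auto simp: tensor_prod_def matrix_unit_def)
  have "(\<Sum>i<N. \<Sum>j<i. tensor_prod (matrix_unit N i j) (matrix_unit N j i) a b c d)
      = (\<Sum>i<N. if i = a then (\<Sum>j<a. if j = b then (if c = b \<and> d = a then 1 else 0) else 0) else 0)"
    using assms by (intro sum.cong refl) (auto simp: tensor_prod_def matrix_unit_def if_distrib[of "\<lambda>x. _ * x"] cong: if_cong)
  also have "\<dots> = (if b < a \<and> c = b \<and> d = a then 1 else 0)"
    using assms by (simp del: sum_constant)
  finally show ?thesis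
    using 1 assms by (auto simp: r_matrix_def r_weight_def)
qed

section \<open>Contractions with the r-matrix and the brackets in coordinates\<close>

lemma tensor_mult_on_first:
  "l < N \<Longrightarrow> j < N \<Longrightarrow> tensor_mult N S (on_first N X) i j k l = (\<Sum>a<N. S i a k l * X $$ (a, j))"
  by (simp add: tensor_mult_def on_first_def tensor_prod_def if_distrib[of "\<lambda>x. _ * x"] cong: if_cong)

lemma tensor_mult_on_second:
  assumes "l < N" "j < N"
  shows "tensor_mult N S (on_second N X) i j k l = (\<Sum>b<N. S i j k b * X $$ (b, l))"
proof -
  have "tensor_mult N S (on_second N X) i j k l
      = (\<Sum>a<N. if a = j then (\<Sum>b<N. S i j k b * X $$ (b, l)) else 0)"
    unfolding tensor_mult_def using assms
    by (intro sum.cong) (auto simp: on_second_def tensor_prod_def intro!: sum.cong sum.neutral)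
  then show ?thesis
    using assms by simp
qed

lemma on_first_tensor_mult:
  "i < N \<Longrightarrow> k < N \<Longrightarrow> tensor_mult N (on_first N X) T i j k l = (\<Sum>a<N. X $$ (i, a) * T a j k l)"
  by (simp add: tensor_mult_def on_first_def tensor_prod_def if_distrib[of "\<lambda>x. _ * x"]
      if_distrib[of "\<lambda>x. x * _"] cong: if_cong)

lemma on_second_tensor_mult:
  assumes "i < N" "k < N"
  shows "tensor_mult N (on_second N X) T i j k l = (\<Sum>b<N. X $$ (k, b) * T i j b l)"
proof -
  have "tensor_mult N (on_second N X) T i j k l
      = (\<Sum>a<N. if a = i then (\<Sum>b<N. X $$ (k, b) * T i j b l) else 0)"
    unfolding tensor_mult_def using assms
    by (intro sum.cong) (auto simp: on_second_def tensor_prod_def intro!: sum.cong sum.neutral)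
  then show ?thesis
    using assms by simp
qed

lemma on_first_on_second:
  "i < N \<Longrightarrow> j < N \<Longrightarrow> k < N \<Longrightarrow> l < N \<Longrightarrow>
   tensor_mult N (on_first N X) (on_second N Y) i j k l = X $$ (i, j) * Y $$ (k, l)"
  by (simp add: tensor_mult_on_second) (simp add: on_first_def tensor_prod_def if_distrib[of "\<lambda>x. _ * x"]
      if_distrib[of "\<lambda>x. x * _"] cong: if_cong)

lemma sum_sum_delta:
  fixes c :: complex and p q n :: nat
  assumes "p < n" "q < n"
    and "\<And>a b. a < n \<Longrightarrow> b < n \<Longrightarrow> f a b = (if a = p \<and> b = q then c else 0)"
  shows "(\<Sum>a<n. \<Sum>b<n. f a b) = c"
proof -
  have "(\<Sum>a<n. \<Sum>b<n. f a b) = (\<Sum>a<n. if a = p then (\<Sum>b<n. if b = q then c else 0) else 0)"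
  proof (rule sum.cong[OF refl])
    fix a assume "a \<in> {..<n}"
    then show "(\<Sum>b<n. f a b) = (if a = p then (\<Sum>b<n. if b = q then c else 0) else 0)"
      by (cases "a = p") (simp_all add: assms(3) cong: if_cong)
  qed
  then show ?thesis
    using assms(1,2) by simp
qed

context
  fixes N i j k l :: nat
  assumes idx: "i < N" "j < N" "k < N" "l < N"
begin

text \<open>Up to its weight the r-matrix is a permutation of indices: from the left it exchanges
  the rows \<open>i\<close> and \<open>k\<close>, from the right the columns \<open>j\<close> and
  \<open>l\<close>. The partially transposed versions below exchange a column of one factor with a
  row of the other, \<open>j\<close> with \<open>k\<close> or \<open>i\<close> with
  \<open>l\<close>.\<close>

lemma r_left_contraction:
  "tensor_mult N (tensor_mult N (r_matrix N) (on_first N X)) (on_second N Y) i j k l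
     = r_weight i k * X $$ (k, j) * Y $$ (i, l)"
proof -
  have "tensor_mult N (tensor_mult N (r_matrix N) (on_first N X)) (on_second N Y) i j k l
      = (\<Sum>b<N. (\<Sum>a<N. r_matrix N i a k b * X $$ (a, j)) * Y $$ (b, l))"
    using idx by (simp add: tensor_mult_on_second tensor_mult_on_first)
  then show ?thesis
    using idx by (simp only: sum_distrib_right) (rule sum_sum_delta[of i _ k], auto simp: r_matrix_eq)
qed

lemma r_right_contraction:
  "tensor_mult N (tensor_mult N (on_first N X) (on_second N Y)) (r_matrix N) i j k l
     = r_weight l j * X $$ (i, l) * Y $$ (k, j)"
proof -
  have "tensor_mult N (tensor_mult N (on_first N X) (on_second N Y)) (r_matrix N) i j k l
      = (\<Sum>a<N. \<Sum>b<N. X $$ (i, a) * Y $$ (k, b) * r_matrix N a j b l)"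
    unfolding tensor_mult_def[of _ _ "r_matrix N"] using idx by (simp add: on_first_on_second)
  then show ?thesis
    using idx by (simp only: sum_distrib_right) (rule sum_sum_delta[of l _ j], auto simp: r_matrix_eq)
qed

lemma r_transpose_1_contraction:
  "tensor_mult N (tensor_mult N (on_first N X) (transpose_1 (r_matrix N))) (on_second N Y) i j k l
     = r_weight j k * X $$ (i, k) * Y $$ (j, l)"
proof -
  have "tensor_mult N (tensor_mult N (on_first N X) (transpose_1 (r_matrix N))) (on_second N Y) i j k l
      = (\<Sum>b<N. (\<Sum>a<N. X $$ (i, a) * r_matrix N j a k b) * Y $$ (b, l))"
    using idx by (simp add: tensor_mult_on_second on_first_tensor_mult transpose_1_def)
  then show ?thesis
    using idx by (simp only: sum_distrib_right) (rule sum_sum_delta[of j _ k], auto simp: r_matrix_eq)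
qed

lemma r_transpose_1_contraction':
  "tensor_mult N (tensor_mult N (on_second N Y) (transpose_1 (r_matrix N))) (on_first N X) i j k l
     = r_weight l i * Y $$ (k, i) * X $$ (l, j)"
proof -
  have "tensor_mult N (tensor_mult N (on_second N Y) (transpose_1 (r_matrix N))) (on_first N X) i j k l
      = (\<Sum>a<N. (\<Sum>b<N. Y $$ (k, b) * r_matrix N a i b l) * X $$ (a, j))"
    using idx by (simp add: tensor_mult_on_first on_second_tensor_mult transpose_1_def)
  then show ?thesis
    using idx by (simp only: sum_distrib_right) (rule sum_sum_delta[of l _ i], auto simp: r_matrix_eq)
qed

lemma r_transpose_2_contraction:
  "tensor_mult N (tensor_mult N (on_first N X) (transpose_2 (r_matrix N))) (on_second N Y) i j k l
     = r_weight k j * X $$ (i, k) * Y $$ (j, l)"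
proof -
  have "tensor_mult N (tensor_mult N (on_first N X) (transpose_2 (r_matrix N))) (on_second N Y) i j k l
      = (\<Sum>b<N. (\<Sum>a<N. X $$ (i, a) * r_matrix N a j b k) * Y $$ (b, l))"
    using idx by (simp add: tensor_mult_on_second on_first_tensor_mult transpose_2_def)
  then show ?thesis
    using idx by (simp only: sum_distrib_right) (rule sum_sum_delta[of j _ k], auto simp: r_matrix_eq)
qed

lemma bracket_AA_eq:
  "bracket_AA N A i j k l = r_weight i k * A $$ (k, j) * A $$ (i, l) - r_weight l j * A $$ (i, l) * A $$ (k, j)
     + r_weight j k * A $$ (i, k) * A $$ (j, l) - r_weight l i * A $$ (k, i) * A $$ (l, j)"
  by (simp add: bracket_AA_def r_left_contraction r_right_contraction r_transpose_1_contraction r_transpose_1_contraction')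

lemma bracket_group_eq:
  "bracket_group N X Y i j k l = r_weight i k * X $$ (k, j) * Y $$ (i, l) - r_weight l j * X $$ (i, l) * Y $$ (k, j)"
  by (simp add: bracket_group_def r_left_contraction r_right_contraction)

lemma bracket_mixed_eq:
  "bracket_mixed N X A i j k l = - (r_weight k j * X $$ (i, k) * A $$ (j, l)) - r_weight l j * X $$ (i, l) * A $$ (k, j)"
  by (simp add: bracket_mixed_def r_right_contraction r_transpose_2_contraction)

end

text \<open>The same \<open>Q\<close>, up to transposition, acts on both sides, so \<open>A\<close>
  and its transpose undergo one and the same infinitesimal congruence. For an entry of
  \<open>A\<close>, the first and third terms of the bracket make up row \<open>k\<close> of
  \<open>Q\<close>, the second and fourth make up row \<open>l\<close>. For an entry of
  \<open>B\<close> or \<open>C\<close> only row \<open>l\<close> occurs.\<close>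

lemma hamiltonian_direction_congruence:
  assumes v: "v \<in> coordinates N"
    and ham: "hamiltonian_direction N v (A, B, C) = (A', B', C')"
  obtains Q :: "nat \<Rightarrow> nat \<Rightarrow> complex" where
    "\<And>i j. i < N \<Longrightarrow> j < N \<Longrightarrow>
       A' $$ (i, j) = (\<Sum>a<N. Q a i * A $$ (a, j)) + (\<Sum>a<N. A $$ (i, a) * Q a j)"
proof -
  obtain t k l where vtkl: "v = (t, k, l)" and kl: "k < N" "l < N"
    using v by (cases v) (auto simp: coordinates_def)
  have A': "A' $$ (i, j) = coordinate_bracket N (Block_A, i, j) v (A, B, C)" if "i < N" "j < N" for i j
    using ham that by (auto simp: hamiltonian_direction_def)
  show thesis
  proof (cases "t = Block_A")
    case True
    show thesis
      by (rule that[of "\<lambda>a j. (if a = k then r_weight j k * A $$ (j, l) else 0)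
            - (if a = l then r_weight l j * A $$ (k, j) else 0)"])
        (use kl in \<open>simp add: A' vtkl True bracket_AA_eq algebra_simps sum.distrib sum_subtractf
          if_distrib[of "\<lambda>x. _ * x"] cong: if_cong\<close>)
  next
    case False
    let ?Y = "component t (A, B, C)"
    show thesis
      by (rule that[of "\<lambda>a j. if a = l then r_weight j l * ?Y $$ (k, j) else 0"])
        (use kl False in \<open>cases t; simp add: A' vtkl bracket_mixed_eq algebra_simps
          if_distrib[of "\<lambda>x. _ * x"] cong: if_cong\<close>)
  qed
qed

text \<open>The point is that \<open>U\<close> and \<open>W\<close> are common to \<open>B\<close>
  and \<open>C\<close>, so that every member of the pencil \<open>B + \<mu> C\<close> is moved by
  the same multipliers.\<close>

lemma hamiltonian_direction_pencil:
  assumes v: "v \<in> coordinates N"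
    and ham: "hamiltonian_direction N v (A, B, C) = (A', B', C')"
  obtains U W :: "nat \<Rightarrow> nat \<Rightarrow> complex" where
    "\<And>i j. i < N \<Longrightarrow> j < N \<Longrightarrow>
       B' $$ (i, j) = (\<Sum>a<N. U i a * B $$ (a, j)) + (\<Sum>a<N. B $$ (i, a) * W a j)"
    "\<And>i j. i < N \<Longrightarrow> j < N \<Longrightarrow>
       C' $$ (i, j) = (\<Sum>a<N. U i a * C $$ (a, j)) + (\<Sum>a<N. C $$ (i, a) * W a j)"
proof -
  obtain t k l where vtkl: "v = (t, k, l)" and kl: "k < N" "l < N"
    using v by (cases v) (auto simp: coordinates_def)
  have BC: "B' $$ (i, j) = coordinate_bracket N (Block_B, i, j) v (A, B, C)"
    "C' $$ (i, j) = coordinate_bracket N (Block_C, i, j) v (A, B, C)" if "i < N" "j < N" for i j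
    using ham that by (auto simp: hamiltonian_direction_def)
  show thesis
  proof (cases t)
    case Block_A
    show thesis
      by (rule that[of "\<lambda>i a. 0" "\<lambda>a j. (if a = k then - r_weight k j * A $$ (j, l) else 0)
            - (if a = l then r_weight l j * A $$ (k, j) else 0)"])
        (use kl in \<open>simp_all add: BC vtkl Block_A bracket_mixed_eq algebra_simps sum.distrib sum_subtractf
          if_distrib[of "\<lambda>x. _ * x"] cong: if_cong\<close>)
  next
    case Block_B
    show thesis
      by (rule that[of "\<lambda>i a. if a = k then r_weight i k * B $$ (i, l) else 0"
            "\<lambda>a j. if a = l then - r_weight l j * B $$ (k, j) else 0"])
        (use kl in \<open>simp_all add: BC vtkl Block_B bracket_group_eq algebra_simps
          if_distrib[of "\<lambda>x. _ * x"] cong: if_cong\<close>)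
  next
    case Block_C
    \<comment> \<open>Here \<open>B'\<close> comes from the bracket of \<open>C\<close> with
      \<open>B\<close> by antisymmetry and carries reversed weights. \<open>C'\<close> is brought to
      the same form by reversing both of its weights; the two terms with constant 2 cancel, since
      both factors are entries of \<open>C\<close>.\<close>
    show thesis
      by (rule that[of "\<lambda>i a. if a = k then - r_weight k i * C $$ (i, l) else 0"
            "\<lambda>a j. if a = l then r_weight j l * C $$ (k, j) else 0"])
        (use kl in \<open>simp_all add: BC vtkl Block_C bracket_group_eq algebra_simps
          r_weight_swap[of k] r_weight_swap[of _ l]
          if_distrib[of "\<lambda>x. _ * x"] cong: if_cong\<close>)
  qed
qed

text \<open>The first two identities say that the derivative of \<open>S = A\<^sup>T B\<^sup>-\<^sup>1\<close> is \<open>L S - S K\<close>, without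
  mentioning the inverse.\<close>

lemma hamiltonian_direction_triangular:
  assumes v: "v \<in> coordinates N"
    and ham: "hamiltonian_direction N v (A, B, C) = (A', B', C')"
  obtains L K R K' R' :: "nat \<Rightarrow> nat \<Rightarrow> complex" where
    "\<And>i j. i < N \<Longrightarrow> j < N \<Longrightarrow>
       B' $$ (i, j) = (\<Sum>a<N. K i a * B $$ (a, j)) + (\<Sum>a<N. B $$ (i, a) * R a j)"
    "\<And>i j. i < N \<Longrightarrow> j < N \<Longrightarrow>
       A' $$ (j, i) = (\<Sum>a<N. L i a * A $$ (j, a)) + (\<Sum>a<N. A $$ (a, i) * R a j)"
    "\<And>i j. i < N \<Longrightarrow> j < N \<Longrightarrow>
       C' $$ (i, j) = (\<Sum>a<N. K' i a * C $$ (a, j)) + (\<Sum>a<N. C $$ (i, a) * R' a j)"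
    "\<And>i j. i < j \<Longrightarrow> L i j = 0" "\<And>i j. i < j \<Longrightarrow> K j i = 0"
    "\<And>i j. i < j \<Longrightarrow> K' i j = 0" "\<And>i j. i < j \<Longrightarrow> R' i j = 0"
    "\<And>i. K' i i = - K i i" "\<And>i. R' i i = - L i i"
proof -
  obtain t k l where vtkl: "v = (t, k, l)" and kl: "k < N" "l < N"
    using v by (cases v) (auto simp: coordinates_def)
  have ABC: "A' $$ (i, j) = coordinate_bracket N (Block_A, i, j) v (A, B, C)"
    "B' $$ (i, j) = coordinate_bracket N (Block_B, i, j) v (A, B, C)"
    "C' $$ (i, j) = coordinate_bracket N (Block_C, i, j) v (A, B, C)" if "i < N" "j < N" for i j
    using ham that by (auto simp: hamiltonian_direction_def)
  show thesis
  proof (cases "t = Block_A")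
    case True
    \<comment> \<open>\<open>?R\<close> is dictated by \<open>B' = B R\<close>; it also serves as
      \<open>R'\<close>, because \<open>C\<close> obeys the same bracket with \<open>A\<close>. The
      first two terms of the bracket of \<open>A\<close> with itself have their weights reversed
      (again the constants 2 cancel); what \<open>?R\<close> does not account for is then a lower
      triangular \<open>L\<close>.\<close>
    let ?R = "\<lambda>a j. - (if a = k then r_weight k j * A $$ (j, l) else 0)
            - (if a = l then r_weight l j * A $$ (k, j) else 0)"
    have A: "A' $$ (j, i) = (\<Sum>a<N. ((if a = k then r_weight i k * A $$ (i, l) else 0)
        + (if a = l then r_weight i l * A $$ (k, i) else 0)) * A $$ (j, a)) + (\<Sum>a<N. A $$ (a, i) * ?R a j)"
      if "i < N" "j < N" for i j
      using kl that
      by (simp add: ABC vtkl True bracket_AA_eq algebra_simps sum.distrib sum_subtractf sum_negf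
          r_weight_swap[of l] r_weight_swap[of k] if_distrib[of "\<lambda>x. _ * x"] cong: if_cong)
    show thesis
      by (rule that[OF _ A, of "\<lambda>_ _. 0" "\<lambda>_ _. 0" ?R])
        (use kl in \<open>auto simp: ABC vtkl True bracket_mixed_eq algebra_simps sum.distrib sum_subtractf sum_negf
          r_weight_eq_0 if_distrib[of "\<lambda>x. _ * x"] cong: if_cong\<close>)
  next
    case False
    let ?Y = "component t (A, B, C)"
    \<comment> \<open>\<open>?K\<close> is upper and \<open>?K'\<close> lower triangular. For the
      block different from \<open>t\<close> this shape is imposed by the bracket of \<open>C\<close>
      with \<open>B\<close>; for the block equal to \<open>t\<close> it is a choice, made possible
      by reversing weights. \<open>?Q\<close> transposed is the multiplier \<open>L\<close>.\<close>
    let ?Q = "\<lambda>a j. if a = l then r_weight j l * ?Y $$ (k, j) else 0"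
    let ?K = "\<lambda>i a. if a = k then - r_weight k i * ?Y $$ (i, l) else 0"
    let ?K' = "\<lambda>i a. if a = k then r_weight i k * ?Y $$ (i, l) else 0"
    let ?R' = "\<lambda>a j. if a = l then - r_weight l j * ?Y $$ (k, j) else 0"
    have B: "B' $$ (i, j) = (\<Sum>a<N. ?K i a * B $$ (a, j)) + (\<Sum>a<N. B $$ (i, a) * ?Q a j)"
      if "i < N" "j < N" for i j
      using kl that False
      by (cases t) (simp_all add: ABC vtkl bracket_group_eq algebra_simps
          r_weight_swap[of k] r_weight_swap[of _ l] if_distrib[of "\<lambda>x. _ * x"] cong: if_cong)
    have C: "C' $$ (i, j) = (\<Sum>a<N. ?K' i a * C $$ (a, j)) + (\<Sum>a<N. C $$ (i, a) * ?R' a j)"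
      if "i < N" "j < N" for i j
      using kl that False
      by (cases t) (simp_all add: ABC vtkl bracket_group_eq algebra_simps
          if_distrib[of "\<lambda>x. _ * x"] cong: if_cong)
    have A: "A' $$ (j, i) = (\<Sum>a<N. ?Q a i * A $$ (j, a)) + (\<Sum>a<N. A $$ (a, i) * ?Q a j)"
      if "i < N" "j < N" for i j
      using kl that False
      by (cases t) (simp_all add: ABC vtkl bracket_mixed_eq algebra_simps
          if_distrib[of "\<lambda>x. _ * x"] cong: if_cong)
    show thesis
      by (rule that[OF B A C]) (auto simp: r_weight_eq_0)
  qed
qed

section \<open>Derivatives of determinants\<close>

lemma cofactor_sum_row:
  fixes X :: "complex mat"
  assumes "X \<in> carrier_mat n n" "a < n" "i < n"
  shows "(\<Sum>j<n. X $$ (a, j) * cofactor X i j) = (if a = i then det X else 0)"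
proof -
  have "(X * adj_mat X) $$ (a, i) = (\<Sum>j<n. X $$ (a, j) * cofactor X i j)"
    using assms by (auto simp: adj_mat_def scalar_prod_def lessThan_atLeast0 intro!: sum.cong)
  then show ?thesis
    using assms by (cases "a = i") (simp_all add: adj_mat(2)[OF assms(1)])
qed

lemma cofactor_sum_col:
  fixes X :: "complex mat"
  assumes "X \<in> carrier_mat n n" "a < n" "j < n"
  shows "(\<Sum>i<n. X $$ (i, a) * cofactor X i j) = (if a = j then det X else 0)"
proof -
  have "(adj_mat X * X) $$ (j, a) = (\<Sum>i<n. cofactor X i j * X $$ (i, a))"
    using assms by (auto simp: adj_mat_def scalar_prod_def lessThan_atLeast0 intro!: sum.cong)
  then show ?thesis
    using assms by (cases "a = j") (simp_all add: adj_mat(3)[OF assms(1)] mult.commute)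
qed

text \<open>Jacobi's formula, by matching the product rule in the Leibniz sum with Laplace
  expansions.\<close>

lemma det_has_field_derivative:
  fixes M :: "complex \<Rightarrow> complex mat"
  assumes M: "\<And>h. M h \<in> carrier_mat n n"
    and deriv: "\<And>i j. i < n \<Longrightarrow> j < n \<Longrightarrow> ((\<lambda>h. M h $$ (i, j)) has_field_derivative M' i j) (at z)"
  shows "((\<lambda>h. det (M h)) has_field_derivative (\<Sum>i<n. \<Sum>j<n. M' i j * cofactor (M z) i j)) (at z)"
proof -
  let ?S = "{p. p permutes {0..<n}}"
  \<comment> \<open>\<open>R i\<close> has row \<open>i\<close> replaced by its derivative. Laplace
    expansion along that row gives the cofactor sum, the Leibniz formula gives the
    \<open>i\<close>-th summand of the product rule.\<close>
  define R where "R i = mat n n (\<lambda>(k, j). if k = i then M' i j else M z $$ (k, j))" for i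
  have R: "R i \<in> carrier_mat n n" for i
    by (simp add: R_def)
  have "((\<lambda>h. \<Sum>p\<in>?S. signof p * (\<Prod>i = 0..<n. M h $$ (i, p i))) has_field_derivative
      (\<Sum>p\<in>?S. signof p * (\<Sum>i = 0..<n. M' i (p i) * (\<Prod>k\<in>{0..<n} - {i}. M z $$ (k, p k))))) (at z)"
    by (intro DERIV_sum DERIV_cmult has_field_derivative_prod deriv) (auto dest: permutes_in_image)
  moreover have "(\<Sum>i<n. \<Sum>j<n. M' i j * cofactor (M z) i j)
      = (\<Sum>p\<in>?S. signof p * (\<Sum>i = 0..<n. M' i (p i) * (\<Prod>k\<in>{0..<n} - {i}. M z $$ (k, p k))))"
  proof -
    have "(\<Sum>j<n. M' i j * cofactor (M z) i j) = det (R i)" if i: "i < n" for i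
    proof -
      have "mat_delete (R i) i j = mat_delete (M z) i j" for j
        using M[of z] i by (intro eq_matI) (auto simp: mat_delete_def R_def)
      then show ?thesis
        using i by (simp add: laplace_expansion_row[OF R i] cofactor_def) (simp add: R_def)
    qed
    moreover have "det (R i) = (\<Sum>p\<in>?S. signof p * (M' i (p i) * (\<Prod>k\<in>{0..<n} - {i}. M z $$ (k, p k))))"
      if i: "i < n" for i
      unfolding det_def'[OF R]
    proof (rule sum.cong[OF refl])
      fix p assume p: "p \<in> ?S"
      have "(\<Prod>k = 0..<n. R i $$ (k, p k)) = R i $$ (i, p i) * (\<Prod>k\<in>{0..<n} - {i}. R i $$ (k, p k))"
        using i by (intro prod.remove) auto
      also have "\<dots> = M' i (p i) * (\<Prod>k\<in>{0..<n} - {i}. M z $$ (k, p k))"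
        using i p by (intro arg_cong2[where f = "(*)"] prod.cong)
          (auto simp: R_def dest: permutes_in_image)
      finally show "signof p * (\<Prod>k = 0..<n. R i $$ (k, p k))
          = signof p * (M' i (p i) * (\<Prod>k\<in>{0..<n} - {i}. M z $$ (k, p k)))"
        by simp
    qed
    ultimately have "(\<Sum>i<n. \<Sum>j<n. M' i j * cofactor (M z) i j)
      = (\<Sum>i<n. \<Sum>p\<in>?S. signof p * (M' i (p i) * (\<Prod>k\<in>{0..<n} - {i}. M z $$ (k, p k))))"
      by simp
    also have "\<dots> = (\<Sum>p\<in>?S. \<Sum>i<n. signof p * (M' i (p i) * (\<Prod>k\<in>{0..<n} - {i}. M z $$ (k, p k))))"
      by (rule sum.swap)
    finally show ?thesis
      by (simp add: sum_distrib_left lessThan_atLeast0)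
  qed
  ultimately show ?thesis
    by (simp add: det_def'[OF M])
qed

text \<open>Expanding a row or column against cofactors of a different one gives 0, so only the
  diagonals of \<open>U\<close> and \<open>W\<close> survive: the determinant is an eigenvector with
  eigenvalue \<open>tr U + tr W\<close>.\<close>

lemma det_has_field_derivative_sided:
  fixes M :: "complex \<Rightarrow> complex mat"
  assumes M: "\<And>h. M h \<in> carrier_mat n n"
    and deriv: "\<And>i j. i < n \<Longrightarrow> j < n \<Longrightarrow> ((\<lambda>h. M h $$ (i, j)) has_field_derivative
      (\<Sum>a<n. U i a * M z $$ (a, j)) + (\<Sum>a<n. M z $$ (i, a) * W a j)) (at z)"
  shows "((\<lambda>h. det (M h)) has_field_derivative ((\<Sum>i<n. U i i) + (\<Sum>i<n. W i i)) * det (M z)) (at z)"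
proof -
  have "(\<Sum>i<n. \<Sum>j<n. (\<Sum>a<n. U i a * M z $$ (a, j)) * cofactor (M z) i j)
      = (\<Sum>i<n. \<Sum>a<n. U i a * (\<Sum>j<n. M z $$ (a, j) * cofactor (M z) i j))"
    by (rule sum.cong[OF refl]) (simp add: sum_distrib_left sum_distrib_right mult.assoc, rule sum.swap)
  also have "\<dots> = (\<Sum>i<n. U i i) * det (M z)"
    by (simp add: cofactor_sum_row[OF M] sum_distrib_right if_distrib[of "\<lambda>x. _ * x"] cong: if_cong)
  finally have 1: "(\<Sum>i<n. \<Sum>j<n. (\<Sum>a<n. U i a * M z $$ (a, j)) * cofactor (M z) i j)
      = (\<Sum>i<n. U i i) * det (M z)" .
  have "(\<Sum>i<n. \<Sum>j<n. (\<Sum>a<n. M z $$ (i, a) * W a j) * cofactor (M z) i j)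
      = (\<Sum>j<n. \<Sum>i<n. \<Sum>a<n. W a j * (M z $$ (i, a) * cofactor (M z) i j))"
    by (subst sum.swap) (simp add: sum_distrib_left mult_ac)
  also have "\<dots> = (\<Sum>j<n. \<Sum>a<n. W a j * (\<Sum>i<n. M z $$ (i, a) * cofactor (M z) i j))"
    by (rule sum.cong[OF refl]) (simp add: sum_distrib_left, rule sum.swap)
  also have "\<dots> = (\<Sum>i<n. W i i) * det (M z)"
    by (simp add: cofactor_sum_col[OF M] sum_distrib_right if_distrib[of "\<lambda>x. _ * x"] cong: if_cong)
  finally have 2: "(\<Sum>i<n. \<Sum>j<n. (\<Sum>a<n. M z $$ (i, a) * W a j) * cofactor (M z) i j)
      = (\<Sum>i<n. W i i) * det (M z)" .
  show ?thesis
    using det_has_field_derivative[OF M deriv] 1 2 by (simp add: distrib_right sum.distrib)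
qed

section \<open>The expansions defining $Y_p$ and $Z_p$\<close>

definition pencil_poly :: "nat \<Rightarrow> complex mat \<Rightarrow> complex mat \<Rightarrow> complex poly" where
  "pencil_poly n X Y = det (mat n n (\<lambda>(i, j). [:X $$ (i, j), Y $$ (i, j):]))"

lemma poly_pencil_poly:
  assumes "X \<in> carrier_mat n n" "Y \<in> carrier_mat n n"
  shows "poly (pencil_poly n X Y) t = det (X + t \<cdot>\<^sub>m Y)"
  unfolding pencil_poly_def
  by (rule poly_det_cong[where n = n]) (use assms in auto)

lemma degree_pencil_poly: "degree (pencil_poly n X Y) \<le> n"
proof -
  have "degree (pencil_poly n X Y) \<le> 1 * n"
    unfolding pencil_poly_def by (rule degree_det_le) auto
  then show ?thesis by simp
qed

lemma pencil_expansion: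
  assumes "X \<in> carrier_mat n n" "Y \<in> carrier_mat n n"
  shows "det (X + t \<cdot>\<^sub>m Y) = (\<Sum>k\<le>n. coeff (pencil_poly n X Y) k * t ^ k)"
proof -
  have "(\<Sum>k\<le>n. coeff (pencil_poly n X Y) k * t ^ k)
      = (\<Sum>k\<le>degree (pencil_poly n X Y). coeff (pencil_poly n X Y) k * t ^ k)"
    by (rule sum.mono_neutral_right) (use degree_pencil_poly in \<open>auto simp: coeff_eq_0\<close>)
  then show ?thesis
    using poly_pencil_poly[OF assms] by (simp add: poly_altdef)
qed

lemma coeff_pencil_poly_0:
  assumes "X \<in> carrier_mat n n" "Y \<in> carrier_mat n n"
  shows "coeff (pencil_poly n X Y) 0 = det X"
proof -
  have "X + 0 \<cdot>\<^sub>m Y = X" using assms by (intro eq_matI) auto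
  then show ?thesis
    using poly_pencil_poly[OF assms, of 0] by (simp add: poly_0_coeff_0)
qed

lemma rational_on_coeff_pencil_poly:
  assumes X: "\<And>i j. i < n \<Longrightarrow> j < n \<Longrightarrow> rational_on N D (\<lambda>x. X x $$ (i, j))"
    and Y: "\<And>i j. i < n \<Longrightarrow> j < n \<Longrightarrow> rational_on N D (\<lambda>x. Y x $$ (i, j))"
  shows "rational_on N D (\<lambda>x. coeff (pencil_poly n (X x) (Y x)) k)"
proof -
  \<comment> \<open>Polynomial-valued functions all of whose coefficients are rational are closed
    under sums and products, so the Leibniz formula stays among them.\<close>
  define ratp where "ratp = (\<lambda>P :: triple \<Rightarrow> complex poly. \<forall>k. rational_on N D (\<lambda>x. coeff (P x) k))"
  have const: "ratp (\<lambda>x. c)" for c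
    by (simp add: ratp_def rational_on_const)
  have lin: "ratp (\<lambda>x. [:X x $$ (i, j), Y x $$ (i, j):])" if "i < n" "j < n" for i j
    unfolding ratp_def
  proof
    fix k :: nat
    consider "k = 0" | "k = 1" | k' where "k = Suc (Suc k')" by (metis One_nat_def not0_implies_Suc)
    then show "rational_on N D (\<lambda>x. coeff [:X x $$ (i, j), Y x $$ (i, j):] k)"
      by cases (use X[OF that] Y[OF that] in \<open>auto simp: rational_on_const\<close>)
  qed
  have mult: "ratp (\<lambda>x. P x * Q x)" if "ratp P" "ratp Q" for P Q
    using that unfolding ratp_def
    by (auto simp: coeff_mult intro!: rational_on_sum rational_on_mult)
  have prod: "ratp (\<lambda>x. \<Prod>i\<in>I. P i x)" if "\<And>i. i \<in> I \<Longrightarrow> ratp (P i)" for I :: "nat set" and P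
    using that by (induction I rule: infinite_finite_induct) (auto intro: const mult)
  have sum: "ratp (\<lambda>x. \<Sum>i\<in>I. P i x)" if "\<And>i. i \<in> I \<Longrightarrow> ratp (P i)" for I :: "(nat \<Rightarrow> nat) set" and P
    using that unfolding ratp_def by (auto simp: coeff_sum intro!: rational_on_sum)
  have "ratp (\<lambda>x. \<Sum>p\<in>{p. p permutes {0..<n}}. signof p * (\<Prod>i = 0..<n. [:X x $$ (i, p i), Y x $$ (i, p i):]))"
    by (intro sum mult const prod lin) (auto dest: permutes_in_image)
  also have "(\<lambda>x. \<Sum>p\<in>{p. p permutes {0..<n}}. signof p * (\<Prod>i = 0..<n. [:X x $$ (i, p i), Y x $$ (i, p i):]))
      = (\<lambda>x. pencil_poly n (X x) (Y x))"
    unfolding pencil_poly_def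
    by (rule ext, subst det_def'[where n = n])
      (auto intro!: sum.cong arg_cong2[where f = "(*)"] prod.cong dest: permutes_in_image)
  finally show ?thesis
    by (simp add: ratp_def)
qed

section \<open>Uniqueness of the expansion coefficients\<close>

lemma poly_eq_0_nonzero:
  fixes p :: "complex poly"
  assumes "\<And>t. t \<noteq> 0 \<Longrightarrow> poly p t = 0"
  shows "p = 0"
proof (rule ccontr)
  assume "p \<noteq> 0"
  then have "finite {t. poly p t = 0}" by (rule poly_roots_finite)
  then have "finite (insert 0 {t. poly p t = 0})" by simp
  moreover have "insert 0 {t. poly p t = 0} = UNIV" using assms by auto
  ultimately show False using infinite_UNIV_char_0[where 'a = complex] by simp
qed

lemma Z_combination_eq_0:
  fixes d :: "nat \<Rightarrow> complex"
  assumes "\<And>\<mu>. (\<Sum>p = 1..N. \<mu> ^ p * d p) = 0" "p \<in> {1..N}"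
  shows "d p = 0"
proof -
  let ?q = "\<Sum>p = 1..N. monom (d p) p"
  have "?q = 0"
    using assms(1) by (intro poly_eq_0_nonzero) (simp add: poly_sum poly_monom mult.commute)
  then have "coeff ?q p = 0" by simp
  then show ?thesis
    using assms(2) by (simp add: coeff_sum cong: if_cong)
qed

lemma Y_combination_eq_0:
  fixes d :: "nat \<Rightarrow> complex"
  assumes eq: "\<And>\<mu>. \<mu> \<noteq> 0 \<Longrightarrow>
      (\<Sum>p = 1..N div 2. (\<mu> powi (int N - 2 * int p) + \<mu> powi (2 * int p - int N)) * d p) = 0"
    and p: "p \<in> {1..N div 2}"
  shows "d p = 0"
proof -
  \<comment> \<open>Multiplication by \<open>\<mu> ^ N\<close> clears the negative exponents. Since
    \<open>2 * p \<le> N \<le> 2 * N - 2 * p\<close>, two exponents collide only for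
    \<open>2 * p = N\<close>, where the coefficient is doubled.\<close>
  let ?q = "\<Sum>p = 1..N div 2. monom (d p) (2 * N - 2 * p) + monom (d p) (2 * p)"
  have "?q = 0"
  proof (rule poly_eq_0_nonzero)
    fix \<mu> :: complex assume \<mu>: "\<mu> \<noteq> 0"
    have "poly ?q \<mu> = (\<Sum>p = 1..N div 2. \<mu> ^ N * ((\<mu> powi (int N - 2 * int p) + \<mu> powi (2 * int p - int N)) * d p))"
      unfolding poly_sum
    proof (rule sum.cong[OF refl])
      fix p assume "p \<in> {1..N div 2}"
      then have p: "2 * p \<le> N" by auto
      have "\<mu> ^ N * \<mu> powi (int N - 2 * int p) = \<mu> powi (int (2 * N - 2 * p))"
        using p \<mu> by (simp add: power_int_add[symmetric] of_nat_diff flip: power_int_of_nat)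
      moreover have "\<mu> ^ N * \<mu> powi (2 * int p - int N) = \<mu> powi (int (2 * p))"
        using p \<mu> by (simp add: power_int_add[symmetric] flip: power_int_of_nat)
      ultimately show "poly (monom (d p) (2 * N - 2 * p) + monom (d p) (2 * p)) \<mu>
          = \<mu> ^ N * ((\<mu> powi (int N - 2 * int p) + \<mu> powi (2 * int p - int N)) * d p)"
        unfolding power_int_of_nat by (simp add: poly_monom algebra_simps)
    qed
    also have "\<dots> = \<mu> ^ N * 0"
      unfolding sum_distrib_left[symmetric] eq[OF \<mu>] ..
    finally show "poly ?q \<mu> = 0" by simp
  qed
  then have "0 = coeff ?q (2 * p)" by simp
  also have "\<dots> = (\<Sum>p' = 1..N div 2. if p' = p then (if 2 * p = N then 2 * d p else d p) else 0)"
    unfolding coeff_sum using p by (intro sum.cong refl) auto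
  also have "\<dots> = (if 2 * p = N then 2 * d p else d p)"
    using p by simp
  finally show ?thesis by (auto split: if_splits)
qed

lemma Z_expansion_unique:
  assumes "Z_expansion N B C z" "Z_expansion N B C z'" "p \<in> {1..N}"
  shows "z p = z' p"
proof -
  have "(\<Sum>p = 1..N. \<mu> ^ p * (z p - z' p)) = 0" for \<mu>
    using assms(1,2) by (simp add: Z_expansion_def algebra_simps sum_subtractf)
  from Z_combination_eq_0[OF this assms(3)] show ?thesis by simp
qed

lemma Y_expansion_unique:
  assumes "Y_expansion N A y" "Y_expansion N A y'" "p \<in> {1..N div 2}"
  shows "y p = y' p"
proof -
  have "(\<Sum>p = 1..N div 2. (\<mu> powi (int N - 2 * int p) + \<mu> powi (2 * int p - int N)) * (y p - y' p)) = 0"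
    if "\<mu> \<noteq> 0" for \<mu>
    using assms(1,2) that by (simp add: Y_expansion_def right_diff_distrib sum_subtractf)
  from Y_combination_eq_0[OF this assms(3)] show ?thesis by simp
qed

lemma Z_coeffs_eqI:
  assumes "Z_expansion N B C z"
  shows "Z_expansion N B C (Z_coeffs N B C)" and "p \<in> {1..N} \<Longrightarrow> Z_coeffs N B C p = z p"
proof -
  let ?z = "restrict z {1..N}"
  have z: "Z_expansion N B C ?z"
  proof -
    have "(\<Sum>p = 1..N. \<mu> ^ p * ?z p) = (\<Sum>p = 1..N. \<mu> ^ p * z p)" for \<mu>
      by (rule sum.cong) auto
    then show ?thesis
      using assms by (simp add: Z_expansion_def del: restrict_apply)
  qed
  have eq: "Z_coeffs N B C = ?z"
    unfolding Z_coeffs_def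
  proof (rule the_equality)
    fix z' assume z': "z' \<in> extensional {1..N} \<and> Z_expansion N B C z'"
    show "z' = ?z"
      by (rule extensionalityI[of _ "{1..N}"]) (use z' Z_expansion_unique[OF _ z, of z'] in auto)
  qed (use z in simp)
  show "Z_expansion N B C (Z_coeffs N B C)" "p \<in> {1..N} \<Longrightarrow> Z_coeffs N B C p = z p"
    using z unfolding eq by auto
qed

lemma Y_coeffs_eqI:
  assumes "Y_expansion N A y"
  shows "Y_expansion N A (Y_coeffs N A)" and "p \<in> {1..N div 2} \<Longrightarrow> Y_coeffs N A p = y p"
proof -
  let ?y = "restrict y {1..N div 2}"
  have y: "Y_expansion N A ?y"
  proof -
    have "(\<Sum>p = 1..N div 2. (\<mu> powi (int N - 2 * int p) + \<mu> powi (2 * int p - int N)) * ?y p)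
        = (\<Sum>p = 1..N div 2. (\<mu> powi (int N - 2 * int p) + \<mu> powi (2 * int p - int N)) * y p)" for \<mu>
      by (rule sum.cong) auto
    then show ?thesis
      using assms unfolding Y_expansion_def by (simp only:)
  qed
  have eq: "Y_coeffs N A = ?y"
    unfolding Y_coeffs_def
  proof (rule the_equality)
    fix y' assume y': "y' \<in> extensional {1..N div 2} \<and> Y_expansion N A y'"
    show "y' = ?y"
      by (rule extensionalityI[of _ "{1..N div 2}"]) (use y' Y_expansion_unique[OF _ y, of y'] in auto)
  qed (use y in simp)
  show "Y_expansion N A (Y_coeffs N A)" "p \<in> {1..N div 2} \<Longrightarrow> Y_coeffs N A p = y p"
    using y unfolding eq by auto
qed

section \<open>Existence and rationality of the expansion coefficients\<close>

lemma Z_expansion_pencil_poly: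
  assumes "B \<in> carrier_mat N N" "C \<in> carrier_mat N N" "det B \<noteq> 0"
  shows "Z_expansion N B C (\<lambda>p. coeff (pencil_poly N B C) p / det B)"
  unfolding Z_expansion_def
proof
  fix \<mu>
  have "det (B + \<mu> \<cdot>\<^sub>m C) = det B + (\<Sum>p = 1..N. coeff (pencil_poly N B C) p * \<mu> ^ p)"
    by (simp add: pencil_expansion[OF assms(1,2)] coeff_pencil_poly_0[OF assms(1,2)]
        sum.atLeast1_atMost_eq sum.atMost_shift del: sum.lessThan_Suc)
  then show "det (B + \<mu> \<cdot>\<^sub>m C) / det B = 1 + (\<Sum>p = 1..N. \<mu> ^ p * (coeff (pencil_poly N B C) p / det B))"
    using assms(3) by (simp add: add_divide_distrib sum_divide_distrib mult.commute)
qed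

text \<open>\<open>A^T + t A\<close> is \<open>t\<close> times the transpose of
  \<open>A^T + t^-1 A\<close>, so the polynomial satisfies \<open>p(t) = t^N p(1/t)\<close> and is
  palindromic.\<close>

lemma coeff_pencil_poly_transpose:
  assumes A: "A \<in> carrier_mat N N" and k: "k \<le> N"
  shows "coeff (pencil_poly N (transpose_mat A) A) (N - k) = coeff (pencil_poly N (transpose_mat A) A) k"
proof -
  let ?p = "pencil_poly N (transpose_mat A) A"
  let ?r = "\<Sum>k\<le>N. monom (coeff ?p (N - k)) k"
  have AT: "transpose_mat A \<in> carrier_mat N N" using A by simp
  have "?r - ?p = 0"
  proof (rule poly_eq_0_nonzero)
    fix t :: complex assume t: "t \<noteq> 0"
    have "transpose_mat A + t \<cdot>\<^sub>m A = t \<cdot>\<^sub>m transpose_mat (transpose_mat A + inverse t \<cdot>\<^sub>m A)"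
      using A t by (intro eq_matI) (auto simp: algebra_simps)
    then have "poly ?p t = t ^ N * det (transpose_mat (transpose_mat A + inverse t \<cdot>\<^sub>m A))"
      using A by (simp add: poly_pencil_poly[OF AT A])
    also have "\<dots> = t ^ N * det (transpose_mat A + inverse t \<cdot>\<^sub>m A)"
      using A by (subst det_transpose[where n = N]) auto
    also have "\<dots> = (\<Sum>k\<le>N. coeff ?p k * (t ^ N * inverse t ^ k))"
      by (simp add: pencil_expansion[OF AT A] sum_distrib_left mult_ac)
    also have "\<dots> = (\<Sum>k\<le>N. coeff ?p k * t ^ (N - k))"
      using t by (intro sum.cong) (auto simp: power_diff divide_inverse power_inverse)
    also have "\<dots> = (\<Sum>k\<le>N. coeff ?p (N - k) * t ^ k)"
      by (rule sum.reindex_bij_witness[of _ "\<lambda>k. N - k" "\<lambda>k. N - k"]) auto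
    finally show "poly (?r - ?p) t = 0"
      by (simp add: poly_sum poly_monom)
  qed
  then have "coeff ?p k = coeff ?r k" by simp
  also have "\<dots> = coeff ?p (N - k)"
    using k by (simp add: coeff_sum cong: if_cong)
  finally show ?thesis ..
qed

text \<open>Folds \<open>k\<close> onto \<open>N - k\<close>. For even \<open>N\<close> the middle
  index is its own partner and gets half its coefficient; \<open>N \<ge> 1\<close> ensures that this
  does not happen to the index 0, which is split off.\<close>

lemma palindromic_sum:
  fixes c e :: "nat \<Rightarrow> complex"
  assumes N: "N \<ge> 1" and c: "\<And>k. k \<le> N \<Longrightarrow> c (N - k) = c k"
  shows "(\<Sum>k\<le>N. c k * e k) = c 0 * (e 0 + e N)
    + (\<Sum>p = 1..N div 2. (if 2 * p = N then c p / 2 else c p) * (e p + e (N - p)))"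
proof -
  let ?g = "\<lambda>k. c k * (e k + e (N - k))"
  let ?h = "\<lambda>k. if 2 * k = N then ?g k else 2 * ?g k"
  have "(\<Sum>k\<le>N. c k * e (N - k)) = (\<Sum>k\<le>N. c k * e k)"
    by (rule sum.reindex_bij_witness[of _ "\<lambda>k. N - k" "\<lambda>k. N - k"]) (auto simp: c)
  \<comment> \<open>Doubling symmetrises the summand, so the upper half of the range can be
    reflected onto the lower half for both parities of \<open>N\<close> at once.\<close>
  then have "2 * (\<Sum>k\<le>N. c k * e k) = (\<Sum>k\<le>N. ?g k)"
    by (simp add: algebra_simps sum.distrib)
  also have "\<dots> = (\<Sum>k\<in>{..N div 2} \<union> {N div 2<..N}. ?g k)"
    by (rule sum.cong) auto
  also have "\<dots> = (\<Sum>k\<le>N div 2. ?g k) + (\<Sum>k\<in>{N div 2<..N}. ?g k)"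
    by (rule sum.union_disjoint) auto
  also have "(\<Sum>k\<in>{N div 2<..N}. ?g k) = (\<Sum>k\<in>{k. 2 * k < N}. ?g k)"
    by (rule sum.reindex_bij_witness[of _ "\<lambda>k. N - k" "\<lambda>k. N - k"]) (auto simp: c)
  also have "\<dots> = (\<Sum>k\<le>N div 2. if 2 * k < N then ?g k else 0)"
  proof -
    have *: "{k. 2 * k < N} = {..N div 2} \<inter> {k. 2 * k < N}" by auto
    show ?thesis by (subst *, subst sum.inter_restrict) auto
  qed
  also have "(\<Sum>k\<le>N div 2. ?g k) + (\<Sum>k\<le>N div 2. if 2 * k < N then ?g k else 0) = (\<Sum>k\<le>N div 2. ?h k)"
    unfolding sum.distrib[symmetric] by (rule sum.cong) auto
  also have "\<dots> = ?h 0 + (\<Sum>k = 1..N div 2. ?h k)"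
    by (simp add: atMost_atLeast0 sum.atLeast_Suc_atMost)
  also have "\<dots> = 2 * (c 0 * (e 0 + e N))
      + 2 * (\<Sum>p = 1..N div 2. (if 2 * p = N then c p / 2 else c p) * (e p + e (N - p)))"
    using N unfolding sum_distrib_left by (intro arg_cong2[where f = "(+)"] sum.cong) auto
  finally show ?thesis
    unfolding distrib_left[symmetric] by (simp only: mult_cancel_left) simp
qed

text \<open>The halving at \<open>2 * p = N\<close> compensates for the defining expansion, where
  that term reads \<open>(\<mu>^0 + \<mu>^0) Y\<^sub>p\<close>.\<close>

definition Y_formula :: "nat \<Rightarrow> complex mat \<Rightarrow> nat \<Rightarrow> complex" where
  "Y_formula N A p = (if 2 * p = N then coeff (pencil_poly N (transpose_mat A) A) p / 2
     else coeff (pencil_poly N (transpose_mat A) A) p) / det A"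

lemma Y_expansion_formula:
  assumes A: "A \<in> carrier_mat N N" "det A \<noteq> 0" and N: "N \<ge> 1"
  shows "Y_expansion N A (Y_formula N A)"
  unfolding Y_expansion_def
proof (intro allI impI)
  fix \<mu> :: complex assume \<mu>: "\<mu> \<noteq> 0"
  let ?c = "coeff (pencil_poly N (transpose_mat A) A)"
  let ?e = "\<lambda>k. \<mu> powi (2 * int k - int N)"
  have AT: "transpose_mat A \<in> carrier_mat N N" using A by simp
  \<comment> \<open>Extracting \<open>inverse \<mu>\<close> leaves the pencil
    \<open>A^T + t A\<close> at \<open>t = \<mu>^2\<close>; the power \<open>t^k\<close> thus turns
    into \<open>\<mu>^(2k - N)\<close>.\<close>
  have "\<mu> \<cdot>\<^sub>m A + inverse \<mu> \<cdot>\<^sub>m transpose_mat A = inverse \<mu> \<cdot>\<^sub>m (transpose_mat A + \<mu>\<^sup>2 \<cdot>\<^sub>m A)"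
    using A \<mu> by (intro eq_matI) (auto simp: field_simps power2_eq_square)
  then have "det (\<mu> \<cdot>\<^sub>m A + inverse \<mu> \<cdot>\<^sub>m transpose_mat A) = inverse \<mu> ^ N * (\<Sum>k\<le>N. ?c k * (\<mu>\<^sup>2) ^ k)"
    using A by (simp add: pencil_expansion[OF AT A(1)])
  also have "\<dots> = (\<Sum>k\<le>N. ?c k * ?e k)"
    using \<mu> by (simp add: sum_distrib_left power_int_diff power_mult[symmetric] divide_inverse power_inverse mult_ac)
      (simp add: power_int_def nat_mult_distrib)
  also have "\<dots> = det A * (?e 0 + ?e N)
      + (\<Sum>p = 1..N div 2. (if 2 * p = N then ?c p / 2 else ?c p) * (?e p + ?e (N - p)))"
    using palindromic_sum[OF N, of ?c ?e] coeff_pencil_poly_transpose[OF A(1)]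
      coeff_pencil_poly_0[OF AT A(1)] det_transpose[OF A(1)] by simp
  also have "(\<Sum>p = 1..N div 2. (if 2 * p = N then ?c p / 2 else ?c p) * (?e p + ?e (N - p)))
      = det A * (\<Sum>p = 1..N div 2. (\<mu> powi (int N - 2 * int p) + \<mu> powi (2 * int p - int N)) * Y_formula N A p)"
    unfolding sum_distrib_left
  proof (rule sum.cong[OF refl])
    fix p assume "p \<in> {1..N div 2}"
    then have "p \<le> N" by auto
    then have "2 * int (N - p) - int N = int N - 2 * int p" by (simp add: of_nat_diff)
    then show "(if 2 * p = N then ?c p / 2 else ?c p) * (?e p + ?e (N - p))
        = det A * ((\<mu> powi (int N - 2 * int p) + \<mu> powi (2 * int p - int N)) * Y_formula N A p)"
      using A(2) by (simp add: Y_formula_def)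
  qed
  finally show "det (\<mu> \<cdot>\<^sub>m A + inverse \<mu> \<cdot>\<^sub>m transpose_mat A) / det A =
       (\<mu> powi (int N) + \<mu> powi (- int N))
       + (\<Sum>p = 1..N div 2. (\<mu> powi (int N - 2 * int p) + \<mu> powi (2 * int p - int N)) * Y_formula N A p)"
    using A(2) by (simp add: field_simps)
qed

lemma rational_on_Y_fun:
  assumes "N \<ge> 1" "p \<in> {1..N div 2}"
  shows "rational_on N (phase_space N) (Y_fun N p)"
proof -
  let ?c = "\<lambda>x. coeff (pencil_poly N (transpose_mat (component Block_A x)) (component Block_A x)) p"
  have c: "rational_on N (triple_carrier N) ?c"
  proof (rule rational_on_coeff_pencil_poly)
    fix i j assume ij: "i < N" "j < N"
    show "rational_on N (triple_carrier N) (\<lambda>x. transpose_mat (component Block_A x) $$ (i, j))"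
    proof (rule rational_on_cong[OF rational_on_entries[OF ij(2,1), of _ Block_A]])
      fix x assume "x \<in> triple_carrier N"
      from carrier_component[OF this, of Block_A] ij
      show "transpose_mat (component Block_A x) $$ (i, j) = component Block_A x $$ (j, i)" by simp
    qed
  qed (rule rational_on_entries)
  have det: "rational_on N (triple_carrier N) (\<lambda>x. det (component Block_A x))"
    by (intro rational_on_det[where n = N] rational_on_entries carrier_component)
  note c = rational_on_subset[OF c phase_space_subset_carrier]
  note det = rational_on_subset[OF det phase_space_subset_carrier]
  have "rational_on N (phase_space N) (\<lambda>x. (if 2 * p = N then 1 / 2 else 1) * ?c x / det (component Block_A x))"
    by (intro rational_on_divide[OF rational_on_mult[OF rational_on_const c] det]) (simp add: mem_phase_space_iff)
  then show ?thesis
  proof (rule rational_on_cong)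
    fix x assume x: "x \<in> phase_space N"
    obtain A B C where x_eq: "x = (A, B, C)" by (cases x)
    have "Y_coeffs N A p = Y_formula N A p"
      using x assms by (intro Y_coeffs_eqI(2)[OF Y_expansion_formula]) (auto simp: x_eq phase_space_def)
    then show "Y_fun N p x = (if 2 * p = N then 1 / 2 else 1) * ?c x / det (component Block_A x)"
      by (simp add: x_eq Y_formula_def)
  qed
qed

lemma rational_on_Z_fun:
  assumes "p \<in> {1..N}"
  shows "rational_on N (phase_space N) (Z_fun N p)"
proof -
  let ?c = "\<lambda>x. coeff (pencil_poly N (component Block_B x) (component Block_C x)) p"
  have c: "rational_on N (phase_space N) ?c"
    by (intro rational_on_coeff_pencil_poly rational_on_entries)
  have det: "rational_on N (triple_carrier N) (\<lambda>x. det (component Block_B x))"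
    by (intro rational_on_det[where n = N] rational_on_entries carrier_component)
  note det = rational_on_subset[OF det phase_space_subset_carrier]
  have "rational_on N (phase_space N) (\<lambda>x. ?c x / det (component Block_B x))"
    by (intro rational_on_divide[OF c det]) (simp add: mem_phase_space_iff)
  then show ?thesis
  proof (rule rational_on_cong)
    fix x assume x: "x \<in> phase_space N"
    obtain A B C where x_eq: "x = (A, B, C)" by (cases x)
    show "Z_fun N p x = ?c x / det (component Block_B x)"
      using x assms by (simp add: x_eq) (intro Z_coeffs_eqI(2)[OF Z_expansion_pencil_poly], auto simp: phase_space_def)
  qed
qed

section \<open>Casimir property of $Y_p$ and $Z_p$\<close>

lemma det_line_derivative:
  fixes X X' :: "complex mat"
  assumes X: "X \<in> carrier_mat n n" "X' \<in> carrier_mat n n"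
    and X': "\<And>i j. i < n \<Longrightarrow> j < n \<Longrightarrow>
      X' $$ (i, j) = (\<Sum>a<n. U i a * X $$ (a, j)) + (\<Sum>a<n. X $$ (i, a) * W a j)"
  shows "((\<lambda>h. det (X + h \<cdot>\<^sub>m X')) has_field_derivative ((\<Sum>i<n. U i i) + (\<Sum>i<n. W i i)) * det X) (at 0)"
proof -
  have [simp]: "X + 0 \<cdot>\<^sub>m X' = X" using X by (intro eq_matI) auto
  have "((\<lambda>h. (X + h \<cdot>\<^sub>m X') $$ (i, j)) has_field_derivative
      (\<Sum>a<n. U i a * (X + 0 \<cdot>\<^sub>m X') $$ (a, j)) + (\<Sum>a<n. (X + 0 \<cdot>\<^sub>m X') $$ (i, a) * W a j)) (at 0)"
    if "i < n" "j < n" for i j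
  proof -
    have "((\<lambda>h. X $$ (i, j) + h * X' $$ (i, j)) has_field_derivative X' $$ (i, j)) (at 0)"
      by (auto intro!: derivative_eq_intros)
    then show ?thesis
      using X that by (simp add: X'[OF that, symmetric])
  qed
  from det_has_field_derivative_sided[where M = "\<lambda>h. X + h \<cdot>\<^sub>m X'", OF _ this] X show ?thesis
    by simp
qed

lemma logarithmic_derivative_mult:
  fixes f g :: "complex \<Rightarrow> complex"
  assumes "(f has_field_derivative a * f z) (at z)" "(g has_field_derivative b * g z) (at z)"
  shows "((\<lambda>h. f h * g h) has_field_derivative (a + b) * (f z * g z)) (at z)"
  using DERIV_mult[OF assms] by (simp add: algebra_simps)

lemma logarithmic_derivative_divide:
  fixes f g :: "complex \<Rightarrow> complex"
  assumes "(f has_field_derivative a * f z) (at z)" "(g has_field_derivative b * g z) (at z)" "g z \<noteq> 0"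
  shows "((\<lambda>h. f h / g h) has_field_derivative (a - b) * (f z / g z)) (at z)"
proof -
  have "(a * f z * g z - f z * (b * g z)) / (g z * g z) = (a - b) * (f z / g z)"
    using assms(3) by (simp add: field_simps)
  with DERIV_divide[OF assms] show ?thesis
    by simp
qed

lemma casimir_onI:
  assumes "rational_on N D f" "D \<subseteq> triple_carrier N"
    and "\<And>x w. x \<in> D \<Longrightarrow> w \<in> triple_carrier N \<Longrightarrow> \<forall>\<^sub>F h in nhds 0. line x w h \<in> D"
    and "\<And>v x. v \<in> coordinates N \<Longrightarrow> x \<in> D \<Longrightarrow>
      ((\<lambda>h. f (line x (hamiltonian_direction N v x) h)) has_field_derivative 0) (at 0)"
  shows "casimir_on N D f"
  unfolding casimir_on_def
proof (intro conjI ballI)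
  fix v x assume "v \<in> coordinates N" "x \<in> D"
  then show "poisson_bracket N f (entry v) x = 0"
    using DERIV_unique[OF poisson_bracket_entry[OF assms(1), of x v] assms(4)] assms(2,3) by blast
qed (fact assms(1))

text \<open>Numerator and denominator of the generating function both have logarithmic derivative
  \<open>2 tr Q\<close>, so the quotient is stationary for every nonzero \<mu>. Rationality of each
  \<open>Y\<^sub>p\<close> allows termwise differentiation of the expansion, and independence of the
  powers of \<mu> makes each derivative vanish.\<close>

lemma casimir_on_Y_fun:
  assumes N: "N \<ge> 1" and p: "p \<in> {1..N div 2}"
  shows "casimir_on N (phase_space N) (Y_fun N p)"
proof (rule casimir_onI[OF rational_on_Y_fun[OF N p] phase_space_subset_carrier])
  show "\<forall>\<^sub>F h in nhds 0. line x w h \<in> phase_space N" if "x \<in> phase_space N" "w \<in> triple_carrier N" for x w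
    using that by (rule eventually_line_phase_space)
next
  fix v x assume v: "v \<in> coordinates N" and x: "x \<in> phase_space N"
  obtain A B C where x_eq: "x = (A, B, C)" by (cases x)
  obtain A' B' C' where ham: "hamiltonian_direction N v (A, B, C) = (A', B', C')"
    by (cases "hamiltonian_direction N v (A, B, C)")
  let ?w = "hamiltonian_direction N v x"
  let ?d = "\<lambda>p. poisson_bracket N (Y_fun N p) (entry v) x"
  have carrier: "A \<in> carrier_mat N N" "A' \<in> carrier_mat N N" "det A \<noteq> 0"
    using x hamiltonian_direction_in_carrier[of N v "(A, B, C)"]
    by (auto simp: x_eq phase_space_def ham triple_carrier_def)
  have ev: "\<forall>\<^sub>F h in nhds 0. line x ?w h \<in> phase_space N"
    using eventually_line_phase_space[OF x hamiltonian_direction_in_carrier] .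
  have dY: "((\<lambda>h. Y_fun N p (line x ?w h)) has_field_derivative ?d p) (at 0)" if "p \<in> {1..N div 2}" for p
    by (rule poisson_bracket_entry[OF rational_on_Y_fun[OF N that] x _ eventually_line_phase_space[OF x] v])
      (use x phase_space_subset_carrier in auto)
  obtain Q where Q: "\<And>i j. i < N \<Longrightarrow> j < N \<Longrightarrow>
      A' $$ (i, j) = (\<Sum>a<N. Q a i * A $$ (a, j)) + (\<Sum>a<N. A $$ (i, a) * Q a j)"
    using hamiltonian_direction_congruence[OF v ham] by blast
  have "(\<Sum>p = 1..N div 2. (\<mu> powi (int N - 2 * int p) + \<mu> powi (2 * int p - int N)) * ?d p) = 0"
    if \<mu>: "\<mu> \<noteq> 0" for \<mu>
  proof -
    let ?M = "\<lambda>A. \<mu> \<cdot>\<^sub>m A + inverse \<mu> \<cdot>\<^sub>m transpose_mat A"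
    have lin: "?M (A + h \<cdot>\<^sub>m A') = ?M A + h \<cdot>\<^sub>m ?M A'" for h
      using carrier by (intro eq_matI) (auto simp: algebra_simps)
    have "((\<lambda>h. det (?M A + h \<cdot>\<^sub>m ?M A')) has_field_derivative
        ((\<Sum>i<N. Q i i) + (\<Sum>i<N. Q i i)) * det (?M A)) (at 0)"
    proof (rule det_line_derivative[where U = "\<lambda>i a. Q a i" and W = Q])
      fix i j assume ij: "i < N" "j < N"
      have "?M A' $$ (i, j) = \<mu> * A' $$ (i, j) + inverse \<mu> * A' $$ (j, i)"
        using carrier ij by simp
      also have "\<dots> = (\<Sum>a<N. Q a i * (\<mu> * A $$ (a, j) + inverse \<mu> * A $$ (j, a)))
          + (\<Sum>a<N. (\<mu> * A $$ (i, a) + inverse \<mu> * A $$ (a, i)) * Q a j)"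
        by (simp add: Q ij algebra_simps sum.distrib sum_distrib_left)
      also have "\<dots> = (\<Sum>a<N. Q a i * ?M A $$ (a, j)) + (\<Sum>a<N. ?M A $$ (i, a) * Q a j)"
        using carrier ij by (intro arg_cong2[where f = "(+)"] sum.cong) auto
      finally show "?M A' $$ (i, j) = (\<Sum>a<N. Q a i * ?M A $$ (a, j)) + (\<Sum>a<N. ?M A $$ (i, a) * Q a j)" .
    qed (use carrier in auto)
    moreover have "((\<lambda>h. det (A + h \<cdot>\<^sub>m A')) has_field_derivative
        ((\<Sum>i<N. Q i i) + (\<Sum>i<N. Q i i)) * det A) (at 0)"
      using carrier(1,2) Q by (rule det_line_derivative)
    moreover have "A + 0 \<cdot>\<^sub>m A' = A" "?M A + 0 \<cdot>\<^sub>m ?M A' = ?M A"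
      using carrier by (auto intro!: eq_matI)
    ultimately have F0: "((\<lambda>h. det (?M (A + h \<cdot>\<^sub>m A')) / det (A + h \<cdot>\<^sub>m A')) has_field_derivative 0) (at 0)"
      using logarithmic_derivative_divide[of "\<lambda>h. det (?M A + h \<cdot>\<^sub>m ?M A')" "(\<Sum>i<N. Q i i) + (\<Sum>i<N. Q i i)" 0
          "\<lambda>h. det (A + h \<cdot>\<^sub>m A')" "(\<Sum>i<N. Q i i) + (\<Sum>i<N. Q i i)"] carrier(3)
      by (simp add: lin)
    have "((\<lambda>h. (\<mu> powi (int N) + \<mu> powi (- int N)) +
        (\<Sum>p = 1..N div 2. (\<mu> powi (int N - 2 * int p) + \<mu> powi (2 * int p - int N)) * Y_fun N p (line x ?w h)))
        has_field_derivative
        0 + (\<Sum>p = 1..N div 2. (\<mu> powi (int N - 2 * int p) + \<mu> powi (2 * int p - int N)) * ?d p)) (at 0)"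
      by (intro DERIV_add DERIV_const DERIV_sum DERIV_cmult dY)
    moreover have "\<forall>\<^sub>F h in nhds 0. (\<mu> powi (int N) + \<mu> powi (- int N)) +
        (\<Sum>p = 1..N div 2. (\<mu> powi (int N - 2 * int p) + \<mu> powi (2 * int p - int N)) * Y_fun N p (line x ?w h))
        = det (?M (A + h \<cdot>\<^sub>m A')) / det (A + h \<cdot>\<^sub>m A')"
      using ev
    proof eventually_elim
      case (elim h)
      then have "Y_expansion N (A + h \<cdot>\<^sub>m A') (Y_coeffs N (A + h \<cdot>\<^sub>m A'))"
        using carrier N by (intro Y_coeffs_eqI(1)[OF Y_expansion_formula]) (auto simp: x_eq ham phase_space_def)
      then show ?case
        using \<mu> by (simp add: Y_expansion_def x_eq ham)
    qed
    ultimately have "((\<lambda>h. det (?M (A + h \<cdot>\<^sub>m A')) / det (A + h \<cdot>\<^sub>m A')) has_field_derivative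
        0 + (\<Sum>p = 1..N div 2. (\<mu> powi (int N - 2 * int p) + \<mu> powi (2 * int p - int N)) * ?d p)) (at 0)"
      by (rule DERIV_cong_ev[THEN iffD1, OF refl _ refl, rotated])
    from DERIV_unique[OF this F0] show ?thesis by simp
  qed
  from Y_combination_eq_0[OF this p] dY[OF p]
  show "((\<lambda>h. Y_fun N p (line x ?w h)) has_field_derivative 0) (at 0)"
    by simp
qed

text \<open>The same separation of coefficients; here \<open>det (B + \<mu> C)\<close> and
  \<open>det B\<close> share the eigenvalue \<open>tr U + tr W\<close>.\<close>

lemma casimir_on_Z_fun:
  assumes p: "p \<in> {1..N}"
  shows "casimir_on N (phase_space N) (Z_fun N p)"
proof (rule casimir_onI[OF rational_on_Z_fun[OF p] phase_space_subset_carrier])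
  show "\<forall>\<^sub>F h in nhds 0. line x w h \<in> phase_space N" if "x \<in> phase_space N" "w \<in> triple_carrier N" for x w
    using that by (rule eventually_line_phase_space)
next
  fix v x assume v: "v \<in> coordinates N" and x: "x \<in> phase_space N"
  obtain A B C where x_eq: "x = (A, B, C)" by (cases x)
  obtain A' B' C' where ham: "hamiltonian_direction N v (A, B, C) = (A', B', C')"
    by (cases "hamiltonian_direction N v (A, B, C)")
  let ?w = "hamiltonian_direction N v x"
  let ?d = "\<lambda>p. poisson_bracket N (Z_fun N p) (entry v) x"
  have carrier: "B \<in> carrier_mat N N" "B' \<in> carrier_mat N N" "det B \<noteq> 0"
      "C \<in> carrier_mat N N" "C' \<in> carrier_mat N N"
    using x hamiltonian_direction_in_carrier[of N v "(A, B, C)"]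
    by (auto simp: x_eq phase_space_def ham triple_carrier_def)
  have ev: "\<forall>\<^sub>F h in nhds 0. line x ?w h \<in> phase_space N"
    using eventually_line_phase_space[OF x hamiltonian_direction_in_carrier] .
  have dZ: "((\<lambda>h. Z_fun N p (line x ?w h)) has_field_derivative ?d p) (at 0)" if "p \<in> {1..N}" for p
    by (rule poisson_bracket_entry[OF rational_on_Z_fun[OF that] x _ eventually_line_phase_space[OF x] v])
      (use x phase_space_subset_carrier in auto)
  obtain U W where U: "\<And>i j. i < N \<Longrightarrow> j < N \<Longrightarrow>
       B' $$ (i, j) = (\<Sum>a<N. U i a * B $$ (a, j)) + (\<Sum>a<N. B $$ (i, a) * W a j)"
    "\<And>i j. i < N \<Longrightarrow> j < N \<Longrightarrow>
       C' $$ (i, j) = (\<Sum>a<N. U i a * C $$ (a, j)) + (\<Sum>a<N. C $$ (i, a) * W a j)"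
    using hamiltonian_direction_pencil[OF v ham] by blast
  have "(\<Sum>p = 1..N. \<mu> ^ p * ?d p) = 0" for \<mu>
  proof -
    have lin: "(B + h \<cdot>\<^sub>m B') + \<mu> \<cdot>\<^sub>m (C + h \<cdot>\<^sub>m C') = (B + \<mu> \<cdot>\<^sub>m C) + h \<cdot>\<^sub>m (B' + \<mu> \<cdot>\<^sub>m C')" for h
      using carrier by (intro eq_matI) (auto simp: algebra_simps)
    have "((\<lambda>h. det ((B + \<mu> \<cdot>\<^sub>m C) + h \<cdot>\<^sub>m (B' + \<mu> \<cdot>\<^sub>m C'))) has_field_derivative
        ((\<Sum>i<N. U i i) + (\<Sum>i<N. W i i)) * det (B + \<mu> \<cdot>\<^sub>m C)) (at 0)"
    proof (rule det_line_derivative[where U = U and W = W])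
      fix i j assume ij: "i < N" "j < N"
      have "(B' + \<mu> \<cdot>\<^sub>m C') $$ (i, j) = B' $$ (i, j) + \<mu> * C' $$ (i, j)"
        using carrier ij by simp
      also have "\<dots> = (\<Sum>a<N. U i a * (B $$ (a, j) + \<mu> * C $$ (a, j)))
          + (\<Sum>a<N. (B $$ (i, a) + \<mu> * C $$ (i, a)) * W a j)"
        by (simp add: U ij algebra_simps sum.distrib sum_distrib_left)
      also have "\<dots> = (\<Sum>a<N. U i a * (B + \<mu> \<cdot>\<^sub>m C) $$ (a, j)) + (\<Sum>a<N. (B + \<mu> \<cdot>\<^sub>m C) $$ (i, a) * W a j)"
        using carrier ij by (intro arg_cong2[where f = "(+)"] sum.cong) auto
      finally show "(B' + \<mu> \<cdot>\<^sub>m C') $$ (i, j)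
          = (\<Sum>a<N. U i a * (B + \<mu> \<cdot>\<^sub>m C) $$ (a, j)) + (\<Sum>a<N. (B + \<mu> \<cdot>\<^sub>m C) $$ (i, a) * W a j)" .
    qed (use carrier in auto)
    moreover have "((\<lambda>h. det (B + h \<cdot>\<^sub>m B')) has_field_derivative
        ((\<Sum>i<N. U i i) + (\<Sum>i<N. W i i)) * det B) (at 0)"
      using carrier(1,2) U(1) by (rule det_line_derivative)
    moreover have "B + 0 \<cdot>\<^sub>m B' = B" "(B + \<mu> \<cdot>\<^sub>m C) + 0 \<cdot>\<^sub>m (B' + \<mu> \<cdot>\<^sub>m C') = B + \<mu> \<cdot>\<^sub>m C"
      using carrier by (auto intro!: eq_matI)
    ultimately have F0: "((\<lambda>h. det ((B + h \<cdot>\<^sub>m B') + \<mu> \<cdot>\<^sub>m (C + h \<cdot>\<^sub>m C')) / det (B + h \<cdot>\<^sub>m B'))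
        has_field_derivative 0) (at 0)"
      using logarithmic_derivative_divide[of "\<lambda>h. det ((B + \<mu> \<cdot>\<^sub>m C) + h \<cdot>\<^sub>m (B' + \<mu> \<cdot>\<^sub>m C'))" "(\<Sum>i<N. U i i) + (\<Sum>i<N. W i i)" 0
          "\<lambda>h. det (B + h \<cdot>\<^sub>m B')" "(\<Sum>i<N. U i i) + (\<Sum>i<N. W i i)"] carrier(3)
      by (simp add: lin)
    have "((\<lambda>h. 1 + (\<Sum>p = 1..N. \<mu> ^ p * Z_fun N p (line x ?w h))) has_field_derivative
        0 + (\<Sum>p = 1..N. \<mu> ^ p * ?d p)) (at 0)"
      by (intro DERIV_add DERIV_const DERIV_sum DERIV_cmult dZ)
    moreover have "\<forall>\<^sub>F h in nhds 0. 1 + (\<Sum>p = 1..N. \<mu> ^ p * Z_fun N p (line x ?w h))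
        = det ((B + h \<cdot>\<^sub>m B') + \<mu> \<cdot>\<^sub>m (C + h \<cdot>\<^sub>m C')) / det (B + h \<cdot>\<^sub>m B')"
      using ev
    proof eventually_elim
      case (elim h)
      then have "Z_expansion N (B + h \<cdot>\<^sub>m B') (C + h \<cdot>\<^sub>m C') (Z_coeffs N (B + h \<cdot>\<^sub>m B') (C + h \<cdot>\<^sub>m C'))"
        using carrier by (intro Z_coeffs_eqI(1)[OF Z_expansion_pencil_poly]) (auto simp: x_eq ham phase_space_def)
      then show ?case
        by (simp add: Z_expansion_def x_eq ham)
    qed
    ultimately have "((\<lambda>h. det ((B + h \<cdot>\<^sub>m B') + \<mu> \<cdot>\<^sub>m (C + h \<cdot>\<^sub>m C')) / det (B + h \<cdot>\<^sub>m B')) has_field_derivative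
        0 + (\<Sum>p = 1..N. \<mu> ^ p * ?d p)) (at 0)"
      by (rule DERIV_cong_ev[THEN iffD1, OF refl _ refl, rotated])
    from DERIV_unique[OF this F0] show ?thesis by simp
  qed
  from Z_combination_eq_0[OF this p] dZ[OF p]
  show "((\<lambda>h. Z_fun N p (line x ?w h)) has_field_derivative 0) (at 0)"
    by simp
qed

section \<open>Casimir property of $X_p$\<close>

lemma the_mat_inverse:
  fixes B :: "complex mat"
  assumes B: "B \<in> carrier_mat n n" "det B \<noteq> 0"
  shows "the (mat_inverse B) \<in> carrier_mat n n" "B * the (mat_inverse B) = 1\<^sub>m n" "the (mat_inverse B) * B = 1\<^sub>m n"
proof -
  have "mat_inverse B \<noteq> None"
    using mat_inverse(1)[OF B(1), of "()"] det_non_zero_imp_unit[OF B, of "()"] by blast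
  then obtain I where I: "mat_inverse B = Some I" by auto
  from mat_inverse(2)[OF B(1) I] show "the (mat_inverse B) \<in> carrier_mat n n"
    "B * the (mat_inverse B) = 1\<^sub>m n" "the (mat_inverse B) * B = 1\<^sub>m n"
    by (auto simp: I)
qed

text \<open>Cramer's rule makes the entries of the inverse visibly rational.\<close>

lemma the_mat_inverse_eq_adj_mat:
  fixes B :: "complex mat"
  assumes B: "B \<in> carrier_mat n n" "det B \<noteq> 0"
  shows "the (mat_inverse B) = inverse (det B) \<cdot>\<^sub>m adj_mat B"
proof -
  let ?I = "the (mat_inverse B)"
  note I = the_mat_inverse[OF B]
  have "adj_mat B = (adj_mat B * B) * ?I"
    using I adj_mat(1)[OF B(1)] B(1) by (simp add: assoc_mult_mat[of _ n n _ n _ n])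
  also have "\<dots> = det B \<cdot>\<^sub>m ?I"
    using I(1) by (simp add: adj_mat(3)[OF B(1)] mult_smult_assoc_mat[of _ n n _ n])
  finally show ?thesis
    using B(2) I(1) by (intro eq_matI) auto
qed

fun S_matrix :: "triple \<Rightarrow> complex mat" where
  "S_matrix (A, B, C) = transpose_mat A * the (mat_inverse B)"

lemma S_matrix_carrier: "x \<in> phase_space N \<Longrightarrow> S_matrix x \<in> carrier_mat N N"
  by (cases x) (auto simp: phase_space_def intro!: mult_carrier_mat the_mat_inverse)

lemma rational_on_S_matrix:
  assumes ij: "i < N" "j < N"
  shows "rational_on N (phase_space N) (\<lambda>x. S_matrix x $$ (i, j))"
proof -
  let ?A = "component Block_A" and ?B = "component Block_B"
  have cof: "rational_on N (phase_space N) (\<lambda>x. cofactor (?B x) j k)" if "k < N" for k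
  proof -
    have carr: "?B x \<in> carrier_mat N N" if "x \<in> phase_space N" for x
      using that carrier_component phase_space_subset_carrier by blast
    have "rational_on N (phase_space N) (\<lambda>x. det (mat_delete (?B x) j k))"
    proof (rule rational_on_det[where n = "N - 1"])
      fix a b assume ab: "a < N - 1" "b < N - 1"
      show "rational_on N (phase_space N) (\<lambda>x. mat_delete (?B x) j k $$ (a, b))"
      proof (rule rational_on_cong[OF rational_on_entries])
        fix x assume "x \<in> phase_space N"
        from carr[OF this] show "mat_delete (?B x) j k $$ (a, b)
            = ?B x $$ (if a < j then a else Suc a, if b < k then b else Suc b)"
          using ab by (simp add: mat_delete_def)
      qed (use ab in auto)
    qed (use carr mat_delete_carrier in blast)
    then show ?thesis
      unfolding cofactor_def by (intro rational_on_mult rational_on_const)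
  qed
  have det: "rational_on N (triple_carrier N) (\<lambda>x. det (?B x))"
    by (intro rational_on_det[where n = N] rational_on_entries carrier_component)
  note det = rational_on_subset[OF det phase_space_subset_carrier]
  have "rational_on N (phase_space N) (\<lambda>x. \<Sum>k<N. ?A x $$ (k, i) * (cofactor (?B x) j k / det (?B x)))"
    by (intro rational_on_sum rational_on_mult rational_on_divide rational_on_entries cof det)
      (use ij in \<open>auto simp: mem_phase_space_iff\<close>)
  then show ?thesis
  proof (rule rational_on_cong)
    fix x assume x: "x \<in> phase_space N"
    obtain A B C where x_eq: "x = (A, B, C)" by (cases x)
    have AB: "A \<in> carrier_mat N N" "B \<in> carrier_mat N N" "det B \<noteq> 0"
      using x by (auto simp: x_eq phase_space_def)
    show "S_matrix x $$ (i, j) = (\<Sum>k<N. ?A x $$ (k, i) * (cofactor (?B x) j k / det (?B x)))"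
      using AB ij by (auto simp: x_eq the_mat_inverse_eq_adj_mat adj_mat_def scalar_prod_def
          lessThan_atLeast0 divide_inverse mult_ac intro!: sum.cong)
  qed
qed

lemma rational_on_upper_left_minor:
  assumes "q \<le> N"
  shows "rational_on N (phase_space N) (\<lambda>x. upper_left_minor q (S_matrix x))"
  unfolding upper_left_minor_def
  by (rule rational_on_det[where n = q]) (use assms in \<open>auto intro!: rational_on_S_matrix simp del: S_matrix.simps\<close>)

lemma rational_on_X_fun:
  assumes p: "p \<le> N"
  shows "rational_on N (X_domain N p) (X_fun N p)"
proof -
  let ?c = "\<lambda>q x. upper_right_minor N q (component Block_C x)"
  have sub: "X_domain N p \<subseteq> phase_space N" by (auto simp: X_domain_def)
  have det: "rational_on N (X_domain N p) (\<lambda>x. det (component s x))" for s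
  proof -
    have "rational_on N (triple_carrier N) (\<lambda>x. det (component s x))"
      by (intro rational_on_det[where n = N] rational_on_entries carrier_component)
    then show ?thesis
      by (rule rational_on_subset) (use sub phase_space_subset_carrier in blast)
  qed
  have "rational_on N (X_domain N p) (\<lambda>x.
      (upper_left_minor p (S_matrix x) * upper_left_minor (N - p) (S_matrix x)) / (?c (N - p) x * ?c p x)
      * (det (component Block_B x) * det (component Block_C x) / det (component Block_A x)))"
    by (intro rational_on_mult rational_on_divide rational_on_subset[OF rational_on_upper_left_minor sub]
        rational_on_upper_right_minor det)
      (use p in \<open>auto simp: mem_X_domain_iff mem_phase_space_iff simp del: component.simps\<close>)
  then show ?thesis
    by (rule rational_on_cong) (auto simp: Let_def)
qed

text \<open>Differentiating \<open>S B = A^T\<close> avoids a derivative of the inverse: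
  \<open>S' B + S B' = A'^T\<close>. With \<open>B' = K B + B R\<close> and
  \<open>A'^T = L A^T + A^T R\<close> the terms in \<open>R\<close> cancel, and what remains is
  \<open>(S' - L S + S K) B = 0\<close> with \<open>B\<close> invertible.\<close>

lemma S_matrix_derivative:
  assumes x: "(A, B, C) \<in> phase_space N" and w: "(A', B', C') \<in> triple_carrier N"
    and B': "\<And>i j. i < N \<Longrightarrow> j < N \<Longrightarrow>
       B' $$ (i, j) = (\<Sum>a<N. K i a * B $$ (a, j)) + (\<Sum>a<N. B $$ (i, a) * R a j)"
    and A': "\<And>i j. i < N \<Longrightarrow> j < N \<Longrightarrow>
       A' $$ (j, i) = (\<Sum>a<N. L i a * A $$ (j, a)) + (\<Sum>a<N. A $$ (a, i) * R a j)"
    and ij: "i < N" "j < N"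
  shows "((\<lambda>h. S_matrix (line (A, B, C) (A', B', C') h) $$ (i, j)) has_field_derivative
     (\<Sum>a<N. L i a * S_matrix (A, B, C) $$ (a, j)) - (\<Sum>a<N. S_matrix (A, B, C) $$ (i, a) * K a j)) (at 0)"
proof -
  let ?x = "(A, B, C)" and ?w = "(A', B', C')"
  let ?S = "S_matrix ?x"
  have carr: "A \<in> carrier_mat N N" "B \<in> carrier_mat N N" "det B \<noteq> 0" "A' \<in> carrier_mat N N" "B' \<in> carrier_mat N N"
    using x w by (auto simp: phase_space_def triple_carrier_def)
  have x': "?x \<in> triple_carrier N" using x phase_space_subset_carrier by blast
  have SB: "(\<Sum>b<N. S_matrix y $$ (i, b) * component Block_B y $$ (b, j)) = component Block_A y $$ (j, i)"
    if y: "y \<in> phase_space N" and ij: "i < N" "j < N" for y i j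
  proof -
    obtain A B C where y_eq: "y = (A, B, C)" by (cases y)
    have AB: "A \<in> carrier_mat N N" "B \<in> carrier_mat N N" "det B \<noteq> 0"
      using y by (auto simp: y_eq phase_space_def)
    note I = the_mat_inverse[OF AB(2,3)]
    have "S_matrix y * B = transpose_mat A * (the (mat_inverse B) * B)"
      unfolding y_eq S_matrix.simps using AB I(1) by (intro assoc_mult_mat[of _ N N _ N _ N]) auto
    then have "S_matrix y * B = transpose_mat A" using AB I by simp
    then have "(S_matrix y * B) $$ (i, j) = A $$ (j, i)" using AB ij by simp
    then show ?thesis
      using AB ij S_matrix_carrier[OF y]
      by (simp add: y_eq scalar_prod_def lessThan_atLeast0 del: S_matrix.simps)
  qed
  \<comment> \<open>The derivative exists because the entries of \<open>S\<close> are rational on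
    \<open>phase_space\<close>; its value is identified only at the end.\<close>
  define S' where "S' i j = deriv (\<lambda>h. S_matrix (line ?x ?w h) $$ (i, j)) 0" for i j
  have S': "((\<lambda>h. S_matrix (line ?x ?w h) $$ (i, j)) has_field_derivative S' i j) (at 0)"
    if ij: "i < N" "j < N" for i j
  proof -
    obtain g where "\<And>w. w \<in> triple_carrier N \<Longrightarrow>
        ((\<lambda>h. S_matrix (line ?x w h) $$ (i, j)) has_field_derivative (\<Sum>v\<in>coordinates N. g v * entry v w)) (at 0)"
      using rational_on_gradient[OF rational_on_S_matrix[OF ij] x x' eventually_line_phase_space[OF x]] by blast
    from this[OF w] show ?thesis
      unfolding S'_def by (simp only: DERIV_imp_deriv)
  qed
  define T where "T i j = (\<Sum>a<N. L i a * ?S $$ (a, j)) - (\<Sum>a<N. ?S $$ (i, a) * K a j)" for i j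
  have S'B: "(\<Sum>b<N. S' i b * B $$ (b, j)) = (\<Sum>b<N. T i b * B $$ (b, j))" if ij: "i < N" "j < N" for i j
  proof -
    have "((\<lambda>h. \<Sum>b<N. S_matrix (line ?x ?w h) $$ (i, b) * (B $$ (b, j) + h * B' $$ (b, j))) has_field_derivative
        (\<Sum>b<N. S' i b * (B $$ (b, j) + 0 * B' $$ (b, j)) + (B' $$ (b, j)) * S_matrix (line ?x ?w 0) $$ (i, b))) (at 0)"
      using ij by (intro DERIV_sum DERIV_mult S') (auto intro!: derivative_eq_intros)
    moreover have "\<forall>\<^sub>F h in nhds 0. (\<Sum>b<N. S_matrix (line ?x ?w h) $$ (i, b) * (B $$ (b, j) + h * B' $$ (b, j)))
        = A $$ (j, i) + h * A' $$ (j, i)"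
      using eventually_line_phase_space[OF x w]
    proof eventually_elim
      case (elim h)
      have "(\<Sum>b<N. S_matrix (line ?x ?w h) $$ (i, b) * (B $$ (b, j) + h * B' $$ (b, j)))
          = (\<Sum>b<N. S_matrix (line ?x ?w h) $$ (i, b) * component Block_B (line ?x ?w h) $$ (b, j))"
        using carr ij by (intro sum.cong) auto
      also have "\<dots> = A $$ (j, i) + h * A' $$ (j, i)"
        unfolding SB[OF elim ij] using carr ij by simp
      finally show ?case .
    qed
    ultimately have "((\<lambda>h. A $$ (j, i) + h * A' $$ (j, i)) has_field_derivative
        (\<Sum>b<N. S' i b * (B $$ (b, j) + 0 * B' $$ (b, j)) + (B' $$ (b, j)) * S_matrix (line ?x ?w 0) $$ (i, b))) (at 0)"
      by (rule DERIV_cong_ev[THEN iffD1, OF refl _ refl, rotated])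
    moreover have "((\<lambda>h. A $$ (j, i) + h * A' $$ (j, i)) has_field_derivative A' $$ (j, i)) (at 0)"
      by (auto intro!: derivative_eq_intros)
    ultimately have "A' $$ (j, i) =
        (\<Sum>b<N. S' i b * (B $$ (b, j) + 0 * B' $$ (b, j)) + (B' $$ (b, j)) * S_matrix (line ?x ?w 0) $$ (i, b))"
      by (rule DERIV_unique[rotated])
    then have "A' $$ (j, i) = (\<Sum>b<N. S' i b * B $$ (b, j)) + (\<Sum>b<N. ?S $$ (i, b) * B' $$ (b, j))"
      unfolding line_0[OF x' w] by (simp add: sum.distrib mult.commute del: S_matrix.simps)
    moreover have "(\<Sum>b<N. ?S $$ (i, b) * B' $$ (b, j)) =
        (\<Sum>a<N. (\<Sum>b<N. ?S $$ (i, b) * K b a) * B $$ (a, j)) + (\<Sum>a<N. A $$ (a, i) * R a j)"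
    proof -
      have "(\<Sum>b<N. ?S $$ (i, b) * (\<Sum>a<N. B $$ (b, a) * R a j)) = (\<Sum>a<N. (\<Sum>b<N. ?S $$ (i, b) * B $$ (b, a)) * R a j)"
        by (simp add: sum_distrib_left sum_distrib_right mult.assoc) (rule sum.swap)
      also have "\<dots> = (\<Sum>a<N. A $$ (a, i) * R a j)"
        using SB[OF x ij(1)] by simp
      finally have 1: "(\<Sum>b<N. ?S $$ (i, b) * (\<Sum>a<N. B $$ (b, a) * R a j)) = (\<Sum>a<N. A $$ (a, i) * R a j)" .
      have 2: "(\<Sum>b<N. ?S $$ (i, b) * (\<Sum>a<N. K b a * B $$ (a, j))) = (\<Sum>a<N. (\<Sum>b<N. ?S $$ (i, b) * K b a) * B $$ (a, j))"
        by (simp add: sum_distrib_left sum_distrib_right mult.assoc) (rule sum.swap)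
      show ?thesis
        using ij by (simp add: B' distrib_left sum.distrib 1 2 del: S_matrix.simps)
    qed
    moreover have "(\<Sum>a<N. L i a * A $$ (j, a)) = (\<Sum>b<N. (\<Sum>a<N. L i a * ?S $$ (a, b)) * B $$ (b, j))"
    proof -
      have "(\<Sum>a<N. L i a * A $$ (j, a)) = (\<Sum>a<N. L i a * (\<Sum>b<N. ?S $$ (a, b) * B $$ (b, j)))"
        using SB[OF x _ ij(2)] by simp
      also have "\<dots> = (\<Sum>b<N. (\<Sum>a<N. L i a * ?S $$ (a, b)) * B $$ (b, j))"
        by (simp add: sum_distrib_left sum_distrib_right mult.assoc) (rule sum.swap)
      finally show ?thesis .
    qed
    ultimately show ?thesis
      by (simp add: A'[OF ij] T_def left_diff_distrib sum_subtractf del: S_matrix.simps)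
  qed
  have "S' i j = T i j"
  proof -
    define E where "E = mat N N (\<lambda>(i, j). S' i j - T i j)"
    have E: "E \<in> carrier_mat N N" by (simp add: E_def)
    have "E * B = 0\<^sub>m N N"
      using carr S'B by (intro eq_matI)
        (auto simp: E_def scalar_prod_def lessThan_atLeast0[symmetric] left_diff_distrib sum_subtractf)
    moreover have "E = (E * B) * the (mat_inverse B)"
      using E carr the_mat_inverse[OF carr(2,3)] by (simp add: assoc_mult_mat[of _ N N _ N _ N])
    ultimately have "E = 0\<^sub>m N N"
      using the_mat_inverse[OF carr(2,3)] by simp
    then have "E $$ (i, j) = 0" using ij by simp
    then show ?thesis using ij by (simp add: E_def)
  qed
  then show ?thesis
    using S'[OF ij] by (simp add: T_def del: S_matrix.simps line.simps)
qed

lemma sum_triangular_restrict: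
  fixes f :: "nat \<Rightarrow> complex"
  assumes "q \<le> N" "\<And>a. a < N \<Longrightarrow> q \<le> a \<Longrightarrow> f a = 0"
  shows "(\<Sum>a<N. f a) = (\<Sum>a<q. f a)"
  using assms by (intro sum.mono_neutral_right) auto

text \<open>A lower triangular \<open>L\<close> combines row \<open>i\<close> with rows above it, an
  upper triangular \<open>K\<close> combines column \<open>j\<close> with columns to its left. The
  corner block therefore obeys the same equation with truncated multipliers, and the eigenvalue is a
  difference of partial traces.\<close>

lemma upper_left_minor_derivative:
  assumes q: "q \<le> N"
    and S: "\<And>i j. i < N \<Longrightarrow> j < N \<Longrightarrow> ((\<lambda>h. M h $$ (i, j)) has_field_derivative
      (\<Sum>a<N. L i a * M 0 $$ (a, j)) - (\<Sum>a<N. M 0 $$ (i, a) * K a j)) (at 0)"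
    and L: "\<And>i j. i < j \<Longrightarrow> L i j = 0" and K: "\<And>i j. i < j \<Longrightarrow> K j i = 0"
  shows "((\<lambda>h. upper_left_minor q (M h)) has_field_derivative
    ((\<Sum>i<q. L i i) - (\<Sum>i<q. K i i)) * upper_left_minor q (M 0)) (at 0)"
proof -
  let ?m = "\<lambda>h. mat q q (\<lambda>(i, j). M h $$ (i, j))"
  have "((\<lambda>h. det (?m h)) has_field_derivative ((\<Sum>i<q. L i i) + (\<Sum>i<q. - K i i)) * det (?m 0)) (at 0)"
  proof (rule det_has_field_derivative_sided[where U = L and W = "\<lambda>i j. - K i j"])
    fix i j assume ij: "i < q" "j < q"
    have "(\<Sum>a<N. L i a * M 0 $$ (a, j)) = (\<Sum>a<q. L i a * M 0 $$ (a, j))"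
      using q ij by (intro sum_triangular_restrict) (auto simp: L)
    moreover have "(\<Sum>a<N. M 0 $$ (i, a) * K a j) = (\<Sum>a<q. M 0 $$ (i, a) * K a j)"
      using q ij by (intro sum_triangular_restrict) (auto simp: K)
    ultimately show "((\<lambda>h. ?m h $$ (i, j)) has_field_derivative
      (\<Sum>a<q. L i a * ?m 0 $$ (a, j)) + (\<Sum>a<q. ?m 0 $$ (i, a) * - K a j)) (at 0)"
      using S[of i j] ij q by (simp add: sum_negf)
  qed simp
  then show ?thesis
    by (simp add: upper_left_minor_def sum_negf)
qed

text \<open>Both multipliers are lower triangular: rows are combined with rows above, columns with
  columns to the right, so the first \<open>q\<close> rows and last \<open>q\<close> columns are
  closed.\<close>

lemma upper_right_minor_derivative:
  assumes q: "q \<le> N" and C: "C \<in> carrier_mat N N" "C' \<in> carrier_mat N N"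
    and C': "\<And>i j. i < N \<Longrightarrow> j < N \<Longrightarrow>
       C' $$ (i, j) = (\<Sum>a<N. K i a * C $$ (a, j)) + (\<Sum>a<N. C $$ (i, a) * R a j)"
    and K: "\<And>i j. i < j \<Longrightarrow> K i j = 0" and R: "\<And>i j. i < j \<Longrightarrow> R i j = 0"
  shows "((\<lambda>h. upper_right_minor N q (C + h \<cdot>\<^sub>m C')) has_field_derivative
    ((\<Sum>i<q. K i i) + (\<Sum>i<q. R (N - q + i) (N - q + i))) * upper_right_minor N q C) (at 0)"
proof -
  let ?m = "\<lambda>C. mat q q (\<lambda>(i, j). C $$ (i, N - q + j))"
  have "((\<lambda>h. det (?m C + h \<cdot>\<^sub>m ?m C')) has_field_derivative
      ((\<Sum>i<q. K i i) + (\<Sum>i<q. R (N - q + i) (N - q + i))) * det (?m C)) (at 0)"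
  proof (rule det_line_derivative[where U = K and W = "\<lambda>a j. R (N - q + a) (N - q + j)"])
    fix i j assume ij: "i < q" "j < q"
    let ?j = "N - q + j"
    have "(\<Sum>a<N. K i a * C $$ (a, ?j)) = (\<Sum>a<q. K i a * C $$ (a, ?j))"
      using q ij by (intro sum_triangular_restrict) (auto simp: K)
    moreover have "(\<Sum>a<N. C $$ (i, a) * R a ?j) = (\<Sum>a<q. C $$ (i, N - q + a) * R (N - q + a) ?j)"
    proof -
      have "(\<Sum>a<N. C $$ (i, a) * R a ?j) = (\<Sum>a\<in>{N - q..<N}. C $$ (i, a) * R a ?j)"
        by (rule sum.mono_neutral_right) (auto simp: R)
      also have "\<dots> = (\<Sum>a<q. C $$ (i, N - q + a) * R (N - q + a) ?j)"
        by (rule sum.reindex_bij_witness[of _ "\<lambda>a. N - q + a" "\<lambda>a. a - (N - q)"]) (use q in auto)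
      finally show ?thesis .
    qed
    ultimately show "?m C' $$ (i, j) = (\<Sum>a<q. K i a * ?m C $$ (a, j))
        + (\<Sum>a<q. ?m C $$ (i, a) * R (N - q + a) (N - q + j))"
      using C'[of i ?j] ij q by simp
  qed simp_all
  moreover have "?m (C + h \<cdot>\<^sub>m C') = ?m C + h \<cdot>\<^sub>m ?m C'" for h
    using C q by (intro eq_matI) auto
  ultimately show ?thesis
    by (simp add: upper_right_minor_def)
qed

lemma casimir_on_X_fun:
  assumes p: "p \<le> N"
  shows "casimir_on N (X_domain N p) (X_fun N p)"
proof (rule casimir_onI[OF rational_on_X_fun[OF p]])
  show "X_domain N p \<subseteq> triple_carrier N"
    using phase_space_subset_carrier by (auto simp: X_domain_def)
  show "\<forall>\<^sub>F h in nhds 0. line x w h \<in> X_domain N p" if "x \<in> X_domain N p" "w \<in> triple_carrier N" for x w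
    using that p by (rule eventually_line_X_domain)
next
  fix v x assume v: "v \<in> coordinates N" and x: "x \<in> X_domain N p"
  obtain A B C where x_eq: "x = (A, B, C)" by (cases x)
  obtain A' B' C' where ham: "hamiltonian_direction N v (A, B, C) = (A', B', C')"
    by (cases "hamiltonian_direction N v (A, B, C)")
  have xp: "(A, B, C) \<in> phase_space N" and w: "(A', B', C') \<in> triple_carrier N"
    using x hamiltonian_direction_in_carrier[of N v "(A, B, C)"] by (auto simp: x_eq mem_X_domain_iff ham)
  have carr: "A \<in> carrier_mat N N" "B \<in> carrier_mat N N" "C \<in> carrier_mat N N"
    "A' \<in> carrier_mat N N" "B' \<in> carrier_mat N N" "C' \<in> carrier_mat N N" "det A \<noteq> 0"
    using xp w by (auto simp: phase_space_def triple_carrier_def)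
  obtain L K R K' R' where
    B': "\<And>i j. i < N \<Longrightarrow> j < N \<Longrightarrow>
       B' $$ (i, j) = (\<Sum>a<N. K i a * B $$ (a, j)) + (\<Sum>a<N. B $$ (i, a) * R a j)" and
    A': "\<And>i j. i < N \<Longrightarrow> j < N \<Longrightarrow>
       A' $$ (j, i) = (\<Sum>a<N. L i a * A $$ (j, a)) + (\<Sum>a<N. A $$ (a, i) * R a j)" and
    C': "\<And>i j. i < N \<Longrightarrow> j < N \<Longrightarrow>
       C' $$ (i, j) = (\<Sum>a<N. K' i a * C $$ (a, j)) + (\<Sum>a<N. C $$ (i, a) * R' a j)" and
    L: "\<And>i j. i < j \<Longrightarrow> L i j = 0" and K: "\<And>i j. i < j \<Longrightarrow> K j i = 0" and
    K': "\<And>i j. i < j \<Longrightarrow> K' i j = 0" and R': "\<And>i j. i < j \<Longrightarrow> R' i j = 0" and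
    diag: "\<And>i. K' i i = - K i i" "\<And>i. R' i i = - L i i"
    by (rule hamiltonian_direction_triangular[OF v ham]) (rule that)
  let ?tr = "\<lambda>q F. \<Sum>i<q. F i i :: complex"
  let ?l = "line (A, B, C) (A', B', C')"
  have l0: "?l 0 = (A, B, C)"
    using line_0[OF _ w] xp phase_space_subset_carrier by blast
  have S: "((\<lambda>h. upper_left_minor q (S_matrix (?l h))) has_field_derivative
      (?tr q L - ?tr q K) * upper_left_minor q (S_matrix (?l 0))) (at 0)" if "q \<le> N" for q
    by (rule upper_left_minor_derivative[OF that _ L K])
      (use S_matrix_derivative[OF xp w B' A'] in \<open>simp_all add: l0 del: line.simps S_matrix.simps\<close>)
  have C0: "C + 0 \<cdot>\<^sub>m C' = C" and B0: "B + 0 \<cdot>\<^sub>m B' = B" and A0: "A + 0 \<cdot>\<^sub>m A' = A"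
    using carr by (auto intro!: eq_matI)
  have MC: "((\<lambda>h. upper_right_minor N q (C + h \<cdot>\<^sub>m C')) has_field_derivative
      (?tr q K' + (\<Sum>i<q. R' (N - q + i) (N - q + i))) * upper_right_minor N q (C + 0 \<cdot>\<^sub>m C')) (at 0)"
    if "q \<le> N" for q
    unfolding C0 by (rule upper_right_minor_derivative[OF that carr(3,6) C' K' R'])
  have dB: "((\<lambda>h. det (B + h \<cdot>\<^sub>m B')) has_field_derivative (?tr N K + ?tr N R) * det (B + 0 \<cdot>\<^sub>m B')) (at 0)"
    unfolding B0 by (rule det_line_derivative[OF carr(2,5) B'])
  have dC: "((\<lambda>h. det (C + h \<cdot>\<^sub>m C')) has_field_derivative (?tr N K' + ?tr N R') * det (C + 0 \<cdot>\<^sub>m C')) (at 0)"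
    unfolding C0 by (rule det_line_derivative[OF carr(3,6) C'])
  have dA: "((\<lambda>h. det (A + h \<cdot>\<^sub>m A')) has_field_derivative (?tr N R + ?tr N L) * det (A + 0 \<cdot>\<^sub>m A')) (at 0)"
    unfolding A0
  proof (rule det_line_derivative[OF carr(1,4), where U = "\<lambda>i a. R a i" and W = "\<lambda>a j. L j a"])
    show "A' $$ (i, j) = (\<Sum>a<N. R a i * A $$ (a, j)) + (\<Sum>a<N. A $$ (i, a) * L j a)" if "i < N" "j < N" for i j
      using A'[OF that(2,1)] by (simp add: mult.commute)
  qed
  have nz: "upper_right_minor N (N - p) (C + 0 \<cdot>\<^sub>m C') * upper_right_minor N p (C + 0 \<cdot>\<^sub>m C') \<noteq> 0"
    "det (A + 0 \<cdot>\<^sub>m A') \<noteq> 0"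
    using x carr by (auto simp: C0 A0 x_eq mem_X_domain_iff)
  note deriv = logarithmic_derivative_mult[OF
      logarithmic_derivative_divide[OF logarithmic_derivative_mult[OF S[OF p] S[OF diff_le_self]]
        logarithmic_derivative_mult[OF MC[OF diff_le_self] MC[OF p]] nz(1)]
      logarithmic_derivative_divide[OF logarithmic_derivative_mult[OF dB dC] dA nz(2)]]
  \<comment> \<open>The trailing trace is rewritten through leading traces of \<open>L\<close>, to
    be compared with those from \<open>S\<close>. Taking \<open>q = p\<close> and
    \<open>q = N - p\<close> together, all partial traces cancel in the quotient of minors and
    \<open>2 tr L\<close> remains; \<open>det B det C / det A\<close> contributes
    \<open>- 2 tr L\<close>.\<close>
  have corner: "(\<Sum>i<q. R' (N - q + i) (N - q + i)) = ?tr (N - q) L - ?tr N L" if "q \<le> N" for q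
  proof -
    have "?tr N L = ?tr (N - q) L + (\<Sum>i\<in>{N - q..<N}. L i i)"
      by (subst sum.union_disjoint[symmetric]) (auto intro!: sum.cong)
    also have "(\<Sum>i\<in>{N - q..<N}. L i i) = (\<Sum>i<q. L (N - q + i) (N - q + i))"
      by (rule sum.reindex_bij_witness[of _ "\<lambda>a. N - q + a" "\<lambda>a. a - (N - q)"]) (use that in auto)
    finally show ?thesis by (simp add: diag sum_negf)
  qed
  have "(?tr p L - ?tr p K) + (?tr (N - p) L - ?tr (N - p) K)
      - ((?tr (N - p) K' + (\<Sum>i<N - p. R' (N - (N - p) + i) (N - (N - p) + i)))
        + (?tr p K' + (\<Sum>i<p. R' (N - p + i) (N - p + i))))
      + ((?tr N K + ?tr N R) + (?tr N K' + ?tr N R') - (?tr N R + ?tr N L)) = 0"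
    unfolding corner[OF p] corner[OF diff_le_self] using p by (simp add: diag sum_negf)
  note deriv[of p, unfolded this mult_zero_left]
  moreover have "(\<lambda>h. X_fun N p (?l h)) = (\<lambda>h.
      upper_left_minor p (S_matrix (?l h)) * upper_left_minor (N - p) (S_matrix (?l h))
      / (upper_right_minor N (N - p) (C + h \<cdot>\<^sub>m C') * upper_right_minor N p (C + h \<cdot>\<^sub>m C'))
      * (det (B + h \<cdot>\<^sub>m B') * det (C + h \<cdot>\<^sub>m C') / det (A + h \<cdot>\<^sub>m A')))"
    by (simp add: Let_def)
  ultimately have "((\<lambda>h. X_fun N p (?l h)) has_field_derivative 0) (at 0)"
    by (simp only:)
  then show "((\<lambda>h. X_fun N p (line x (hamiltonian_direction N v x) h)) has_field_derivative 0) (at 0)"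
    by (simp only: x_eq ham)
qed

section \<open>Antidiagonal triples with prescribed values\<close>

lemma monic_poly_splits:
  fixes p :: "complex poly"
  assumes "degree p = n" "lead_coeff p = 1"
  obtains c where "\<And>t. poly p t = (\<Prod>i<n. t + c i)"
proof -
  obtain as where as: "Polynomial.smult (coeff p (degree p)) (\<Prod>a\<leftarrow>as. [:- a, 1:]) = p" "length as = degree p"
    using fundamental_theorem_algebra_factorized[of p] by blast
  have "poly p t = (\<Prod>i<n. t + - (as ! i))" for t
  proof -
    have "poly p t = poly (\<Prod>a\<leftarrow>as. [:- a, 1:]) t"
      using as(1) assms by (metis smult_1_left)
    also have "\<dots> = (\<Prod>i<length as. poly [:- (as ! i), 1:] t)"
      by (simp add: prod.list_conv_set_nth poly_prod lessThan_atLeast0)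
    finally show ?thesis using as(2) assms(1) by (simp add: add.commute)
  qed
  then show thesis by (rule that)
qed

text \<open>Pencils of antidiagonal matrices are antidiagonal, \<open>A^T B^-1\<close> is diagonal,
  and upper-right corner blocks are again antidiagonal, so every determinant in play is a product.
  Diagonal triples would not do: their upper-right minors of sizes 1 to \<open>N - 1\<close>
  vanish.\<close>

definition antidiag :: "nat \<Rightarrow> (nat \<Rightarrow> complex) \<Rightarrow> complex mat" where
  "antidiag n f = mat n n (\<lambda>(i, j). if i + j = n - 1 then f i else 0)"

lemma antidiag_carrier [simp]: "antidiag n f \<in> carrier_mat n n"
  by (simp add: antidiag_def)

text \<open>The sign is left as the determinant for all entries 1. Only its being nonzero matters
  later: it cancels in ratios or is absorbed into a constant.\<close>

lemma det_antidiag: "det (antidiag n f) = det (antidiag n (\<lambda>_. 1)) * (\<Prod>i<n. f i)"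
proof -
  let ?D = "mat n n (\<lambda>(i, j). if i = j then f i else 0)"
  have "antidiag n f = ?D * antidiag n (\<lambda>_. 1)"
    by (intro eq_matI) (auto simp: antidiag_def scalar_prod_def if_distrib[of "\<lambda>x. x * _"] cong: if_cong)
  moreover have "det ?D = (\<Prod>i<n. f i)"
    by (subst det_upper_triangular[where n = n])
      (auto simp: diag_mat_def prod.list_conv_set_nth lessThan_atLeast0 intro!: prod.cong)
  ultimately show ?thesis
    by (simp add: det_mult[where n = n])
qed

lemma det_antidiag_1_nonzero: "det (antidiag n (\<lambda>_. 1)) \<noteq> 0"
proof -
  let ?J = "antidiag n (\<lambda>_. 1)"
  have "?J * ?J = 1\<^sub>m n"
  proof (rule eq_matI)
    fix i j assume ij: "i < dim_row (1\<^sub>m n :: complex mat)" "j < dim_col (1\<^sub>m n :: complex mat)"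
    have "(?J * ?J) $$ (i, j) = (\<Sum>k<n. ?J $$ (i, k) * ?J $$ (k, j))"
      using ij by (simp add: antidiag_def scalar_prod_def lessThan_atLeast0)
    also have "\<dots> = (\<Sum>k<n. if k = n - 1 - i then (if i = j then 1 else 0) else 0)"
      using ij by (intro sum.cong) (auto simp: antidiag_def)
    also have "\<dots> = (if i = j then 1 else 0)"
      using ij by simp
    finally show "(?J * ?J) $$ (i, j) = 1\<^sub>m n $$ (i, j)" using ij by simp
  qed (auto simp: antidiag_def)
  then have "det ?J * det ?J = 1"
    by (metis antidiag_carrier det_mult det_one)
  then show ?thesis by auto
qed

text \<open>Chebyshev-like polynomials expressing \<open>(\<mu>^k + \<mu>^(-k)) / (\<mu> + 1/\<mu>)^(N mod 2)\<close>
  with \<open>k = 2 * j + N mod 2\<close> in terms of \<open>\<mu>\<^sup>2 + \<mu>^(-2)\<close>.\<close>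

fun palindrome_poly :: "nat \<Rightarrow> nat \<Rightarrow> complex poly" where
  "palindrome_poly e 0 = [:if e = 0 then 2 else 1:]"
| "palindrome_poly e (Suc 0) = [:if e = 0 then 0 else - 1, 1:]"
| "palindrome_poly e (Suc (Suc j)) = [:0, 1:] * palindrome_poly e (Suc j) - palindrome_poly e j"

text \<open>The recurrence is the identity \<open>w (\<mu>^k + \<mu>^-k) = (\<mu>^(k+2) +
  \<mu>^-(k+2)) + (\<mu>^(k-2) + \<mu>^-(k-2))\<close> for \<open>w = \<mu>^2 + \<mu>^-2\<close>.
  The odd start uses that \<open>\<mu>^3 + \<mu>^-3\<close> divided by
  \<open>\<mu> + \<mu>^-1\<close> is \<open>w - 1\<close>.\<close>

lemma poly_palindrome_poly:
  assumes "\<mu> \<noteq> 0" "e \<le> 1"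
  shows "(\<mu> + inverse \<mu>) ^ e * poly (palindrome_poly e j) (\<mu>\<^sup>2 + inverse \<mu> ^ 2)
    = \<mu> ^ (2 * j + e) + inverse \<mu> ^ (2 * j + e)"
proof (induction j rule: induct_nat_012)
  case 0
  have "e = 0 \<or> e = 1" using assms by auto
  then show ?case by auto
next
  case 1
  have "e = 0 \<or> e = 1" using assms by auto
  then show ?case
    using assms(1) by (auto simp: field_simps power2_eq_square power3_eq_cube numeral_3_eq_3)
next
  case (ge2 j)
  let ?w = "\<mu>\<^sup>2 + inverse \<mu> ^ 2" and ?u = "(\<mu> + inverse \<mu>) ^ e"
  have inv: "\<mu> * (inverse \<mu> * x) = x" for x
    using assms(1) by simp
  have "?u * poly (palindrome_poly e (Suc (Suc j))) ?w
      = ?w * (?u * poly (palindrome_poly e (Suc j)) ?w) - ?u * poly (palindrome_poly e j) ?w"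
    by (simp add: algebra_simps)
  also have "\<dots> = ?w * (\<mu> ^ (2 * Suc j + e) + inverse \<mu> ^ (2 * Suc j + e)) - (\<mu> ^ (2 * j + e) + inverse \<mu> ^ (2 * j + e))"
    by (simp only: ge2)
  also have "\<dots> = \<mu> ^ (2 * Suc (Suc j) + e) + inverse \<mu> ^ (2 * Suc (Suc j) + e)"
    by (simp add: algebra_simps power2_eq_square power_add inv)
  finally show ?case .
qed

text \<open>The exception \<open>j = e = 0\<close> is the constant 2. As a leading term it would
  occur only for \<open>N = 0\<close>.\<close>

lemma degree_palindrome_poly:
  "degree (palindrome_poly e j) \<le> j \<and> (j \<ge> 1 \<or> e \<noteq> 0 \<longrightarrow> coeff (palindrome_poly e j) j = 1)"
proof (induction j rule: induct_nat_012)
  case (ge2 j)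
  have "degree (palindrome_poly e (Suc (Suc j))) \<le> Suc (Suc j)"
    using ge2 by (auto intro!: degree_diff_le degree_mult_le[THEN order.trans])
  moreover have "coeff (palindrome_poly e j) (Suc (Suc j)) = 0"
    using ge2(1) by (intro coeff_eq_0) auto
  ultimately show ?case
    using ge2 by (simp add: coeff_pCons)
qed auto

lemma prod_reflected_pairs:
  fixes f :: "nat \<Rightarrow> 'a :: comm_monoid_mult"
  assumes "m = N div 2"
  shows "(\<Prod>i<N. f i) = (\<Prod>i<m. f i * f (N - 1 - i)) * f m ^ (N mod 2)"
proof -
  have "(\<Prod>i<N. f i) = (\<Prod>i\<in>{..<m} \<union> {m..<N - m} \<union> {N - m..<N}. f i)"
    by (rule prod.cong) (use assms in auto)
  also have "\<dots> = (\<Prod>i\<in>{..<m} \<union> {m..<N - m}. f i) * (\<Prod>i\<in>{N - m..<N}. f i)"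
    by (rule prod.union_disjoint) (use assms in auto)
  also have "(\<Prod>i\<in>{..<m} \<union> {m..<N - m}. f i) = (\<Prod>i<m. f i) * (\<Prod>i\<in>{m..<N - m}. f i)"
    by (rule prod.union_disjoint) (use assms in auto)
  also have "(\<Prod>i\<in>{N - m..<N}. f i) = (\<Prod>i<m. f (N - 1 - i))"
    by (rule prod.reindex_bij_witness[of _ "\<lambda>i. N - 1 - i" "\<lambda>i. N - 1 - i"]) (use assms in auto)
  also have "(\<Prod>i\<in>{m..<N - m}. f i) = f m ^ (N mod 2)"
  proof (cases "even N")
    case False
    then have "{m..<N - m} = {m}" using assms by (auto elim!: oddE)
    with False show ?thesis by (simp add: odd_iff_mod_2_eq_one)
  qed (use assms in \<open>auto elim!: evenE\<close>)
  finally show ?thesis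
    by (simp add: prod.distrib mult_ac)
qed

text \<open>Divided by \<open>(\<mu> + \<mu>^-1)^e\<close>, the desired expansion is a monic
  polynomial \<open>G\<close> of degree \<open>m\<close> in \<open>w = \<mu>^2 + \<mu>^-2\<close>.
  Each factor \<open>w + \<tau>\<close> is realised by a reflected pair of antidiagonal entries
  \<open>r\<close> and 1 with \<open>r + 1/r = \<tau>\<close>, as
  \<open>(\<mu> r + \<mu>^-1) (\<mu> + \<mu>^-1 r) / r = w + r + 1/r\<close>. For odd
  \<open>N\<close> the middle entry 1 supplies the factor \<open>\<mu> + \<mu>^-1\<close>.\<close>

lemma exists_Y_values:
  fixes y :: "nat \<Rightarrow> complex"
  assumes N: "N \<ge> 1"
  obtains a where "\<And>i. a i \<noteq> 0" "Y_expansion N (antidiag N a) y"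
proof -
  define m e where "m = N div 2" and "e = N mod 2"
  have Nme: "N = 2 * m + e" "e \<le> 1" by (auto simp: m_def e_def)
  let ?T = "palindrome_poly e"
  define G where "G = ?T m + (\<Sum>p = 1..m. Polynomial.smult (y p) (?T (m - p)))"
  have "degree (\<Sum>p = 1..m. Polynomial.smult (y p) (?T (m - p))) \<le> m - 1"
  proof (rule degree_sum_le)
    fix p assume "p \<in> {1..m}"
    have "degree (Polynomial.smult (y p) (?T (m - p))) \<le> m - p"
      using degree_smult_le degree_palindrome_poly order.trans by blast
    also have "\<dots> \<le> m - 1" using \<open>p \<in> {1..m}\<close> by auto
    finally show "degree (Polynomial.smult (y p) (?T (m - p))) \<le> m - 1" .
  qed simp
  then have low: "degree (\<Sum>p = 1..m. Polynomial.smult (y p) (?T (m - p))) \<le> m"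
    "coeff (\<Sum>p = 1..m. Polynomial.smult (y p) (?T (m - p))) m = 0"
    by (simp, cases "m = 0") (auto intro!: coeff_eq_0)
  have top: "degree (?T m) \<le> m" "coeff (?T m) m = 1"
    using degree_palindrome_poly[of e m] N Nme by auto
  have "degree G \<le> m" "coeff G m = 1"
    using low top by (auto simp: G_def intro!: degree_add_le)
  then have G: "degree G = m" "lead_coeff G = 1"
    using le_degree[of G m] by auto
  obtain \<tau> where \<tau>: "\<And>t. poly G t = (\<Prod>i<m. t + \<tau> i)"
    using monic_poly_splits[OF G] by blast
  have "\<exists>r. r \<noteq> 0 \<and> r + inverse r = \<tau> i" for i
  proof -
    \<comment> \<open>The two roots of \<open>r^2 - \<tau> r + 1\<close> have product 1, so each is
      nonzero and the inverse of the other.\<close>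
    let ?s = "csqrt ((\<tau> i)\<^sup>2 - 4)"
    have "((\<tau> i + ?s) / 2) * ((\<tau> i - ?s) / 2) = ((\<tau> i)\<^sup>2 - ?s\<^sup>2) / 4"
      by (simp add: power2_eq_square algebra_simps)
    then have 1: "((\<tau> i + ?s) / 2) * ((\<tau> i - ?s) / 2) = 1" by simp
    then have "inverse ((\<tau> i + ?s) / 2) = (\<tau> i - ?s) / 2" by (rule inverse_unique)
    with 1 show ?thesis
      by (intro exI[of _ "(\<tau> i + ?s) / 2"]) (auto simp: field_simps)
  qed
  then obtain r where r: "\<And>i. r i \<noteq> 0" "\<And>i. r i + inverse (r i) = \<tau> i" by metis
  define a where "a i = (if i < m then r i else 1)" for i
  have a: "a i \<noteq> 0" for i by (simp add: a_def r)
  have "Y_expansion N (antidiag N a) y"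
    unfolding Y_expansion_def
  proof (intro allI impI)
    fix \<mu> :: complex assume \<mu>: "\<mu> \<noteq> 0"
    let ?w = "\<mu>\<^sup>2 + inverse \<mu> ^ 2" and ?u = "(\<mu> + inverse \<mu>) ^ e"
    have E: "?u * poly (?T j) ?w = \<mu> powi (int (2 * j + e)) + \<mu> powi (- int (2 * j + e))" for j
      using poly_palindrome_poly[OF \<mu> Nme(2), of j]
      unfolding power_int_minus power_int_of_nat power_inverse[symmetric] .
    have det_ratio: "det (antidiag N f) / det (antidiag N a) = (\<Prod>i<N. f i) / (\<Prod>i<N. a i)" for f
      using det_antidiag_1_nonzero[of N] by (simp add: det_antidiag[of N f] det_antidiag[of N a])
    have "\<mu> \<cdot>\<^sub>m antidiag N a + inverse \<mu> \<cdot>\<^sub>m transpose_mat (antidiag N a)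
        = antidiag N (\<lambda>i. \<mu> * a i + inverse \<mu> * a (N - 1 - i))"
    proof (rule eq_matI)
      fix i j assume "i < dim_row (antidiag N (\<lambda>i. \<mu> * a i + inverse \<mu> * a (N - 1 - i)))"
        "j < dim_col (antidiag N (\<lambda>i. \<mu> * a i + inverse \<mu> * a (N - 1 - i)))"
      moreover have "j = N - 1 - i" if "i + j = N - 1" using that by simp
      ultimately show "(\<mu> \<cdot>\<^sub>m antidiag N a + inverse \<mu> \<cdot>\<^sub>m transpose_mat (antidiag N a)) $$ (i, j)
          = antidiag N (\<lambda>i. \<mu> * a i + inverse \<mu> * a (N - 1 - i)) $$ (i, j)"
        by (cases "i + j = N - 1") (simp_all add: antidiag_def add.commute)
    qed (simp_all add: antidiag_def)
    then have "det (\<mu> \<cdot>\<^sub>m antidiag N a + inverse \<mu> \<cdot>\<^sub>m transpose_mat (antidiag N a)) / det (antidiag N a)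
        = (\<Prod>i<N. \<mu> * a i + inverse \<mu> * a (N - 1 - i)) / (\<Prod>i<N. a i)"
      by (simp only: det_ratio)
    also have "\<dots> = (\<Prod>i<N. (\<mu> * a i + inverse \<mu> * a (N - 1 - i)) / a i)"
      by (simp add: prod_dividef)
    also have "\<dots> = (\<Prod>i<m. ?w + \<tau> i) * ?u"
    proof -
      have "(\<mu> * a i + inverse \<mu> * a (N - 1 - i)) / a i
          * ((\<mu> * a (N - 1 - i) + inverse \<mu> * a (N - 1 - (N - 1 - i))) / a (N - 1 - i)) = ?w + \<tau> i" if "i < m" for i
      proof -
        have "a i = r i" "a (N - 1 - i) = 1" "N - 1 - (N - 1 - i) = i"
          using that Nme by (auto simp: a_def)
        then show ?thesis
          using r(1)[of i] \<mu> by (simp add: r(2)[symmetric]) (simp add: field_simps power2_eq_square)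
      qed
      moreover have "((\<mu> * a m + inverse \<mu> * a (N - 1 - m)) / a m) ^ (N mod 2) = ?u"
        using Nme by (cases "e = 0") (auto simp: a_def e_def)
      ultimately show ?thesis
        unfolding prod_reflected_pairs[OF m_def] by (intro arg_cong2[where f = "(*)"] prod.cong) simp_all
    qed
    also have "\<dots> = ?u * poly G ?w" by (simp add: \<tau>)
    also have "\<dots> = ?u * poly (?T m) ?w + (\<Sum>p = 1..m. (?u * poly (?T (m - p)) ?w) * y p)"
      by (simp add: G_def poly_sum distrib_left sum_distrib_left mult_ac)
    also have "\<dots> = (\<mu> powi (int N) + \<mu> powi (- int N))
        + (\<Sum>p = 1..N div 2. (\<mu> powi (int N - 2 * int p) + \<mu> powi (2 * int p - int N)) * y p)"
      unfolding E m_def[symmetric]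
    proof (intro arg_cong2[where f = "(+)"] sum.cong refl)
      fix p assume p: "p \<in> {1..m}"
      have "int (2 * (m - p) + e) = int N - 2 * int p" using p Nme by auto
      then show "(\<mu> powi int (2 * (m - p) + e) + \<mu> powi - int (2 * (m - p) + e)) * y p
          = (\<mu> powi (int N - 2 * int p) + \<mu> powi (2 * int p - int N)) * y p" by simp
    qed (use Nme in simp_all)
    finally show "det (\<mu> \<cdot>\<^sub>m antidiag N a + inverse \<mu> \<cdot>\<^sub>m transpose_mat (antidiag N a)) / det (antidiag N a)
        = (\<mu> powi (int N) + \<mu> powi (- int N))
        + (\<Sum>p = 1..N div 2. (\<mu> powi (int N - 2 * int p) + \<mu> powi (2 * int p - int N)) * y p)" .
  qed
  with a show thesis by (rule that)
qed

text \<open>The entries of \<open>C\<close> are taken as multiples \<open>c i\<close> of those of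
  \<open>B\<close>, so the ratio of determinants is the product of the \<open>1 + \<mu> c i\<close>
  for any \<open>b\<close>; this leaves \<open>b\<close> free for prescribing the
  \<open>X\<^sub>p\<close>. The \<open>c i\<close> come from factoring the reversed polynomial, and
  their product \<open>z N\<close> keeps them nonzero.\<close>

lemma exists_Z_values:
  fixes z :: "nat \<Rightarrow> complex"
  assumes N: "N \<ge> 1" and z: "z N \<noteq> 0"
  obtains c where "\<And>i. c i \<noteq> 0"
    "\<And>b. (\<And>i. b i \<noteq> 0) \<Longrightarrow> Z_expansion N (antidiag N b) (antidiag N (\<lambda>i. b i * c i)) z"
proof -
  define p where "p = monom 1 N + (\<Sum>k = 1..N. monom (z k) (N - k))"
  have low: "degree (\<Sum>k = 1..N. monom (z k) (N - k)) < N"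
    by (rule degree_sum_less) (use N in \<open>auto intro!: le_less_trans[OF degree_monom_le]\<close>)
  then have p: "degree p = N" "lead_coeff p = 1"
    unfolding p_def by (auto simp: degree_add_eq_left degree_monom_eq coeff_eq_0)
  obtain c where c: "\<And>t. poly p t = (\<Prod>i<N. t + c i)"
    using monic_poly_splits[OF p] by blast
  have prod: "(\<Prod>i<N. 1 + \<mu> * c i) = 1 + (\<Sum>k = 1..N. \<mu> ^ k * z k)" for \<mu>
  proof (cases "\<mu> = 0")
    case True
    then show ?thesis by (auto simp: power_0_left)
  next
    case False
    have "(\<Prod>i<N. 1 + \<mu> * c i) = (\<Prod>i<N. \<mu> * (inverse \<mu> + c i))"
      using False by (intro prod.cong) (auto simp: algebra_simps)
    also have "\<dots> = \<mu> ^ N * poly p (inverse \<mu>)"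
      by (simp add: c prod.distrib)
    also have "\<dots> = 1 + (\<Sum>k = 1..N. \<mu> ^ k * z k)"
    proof -
      have "(\<Sum>k = 1..N. \<mu> ^ N * (z k * inverse \<mu> ^ (N - k))) = (\<Sum>k = 1..N. \<mu> ^ k * z k)"
        using False by (intro sum.cong) (auto simp: power_diff power_inverse)
      then show ?thesis
        using False by (simp add: p_def poly_sum poly_monom distrib_left sum_distrib_left power_inverse)
    qed
    finally show ?thesis .
  qed
  have "(\<Prod>i<N. c i) = poly p 0" by (simp add: c)
  also have "\<dots> = (\<Sum>k = 1..N. z k * 0 ^ (N - k))"
    using N by (simp add: p_def poly_sum poly_monom)
  also have "\<dots> = (\<Sum>k = 1..N. if k = N then z N else 0)"
    by (rule sum.cong) (auto simp: power_0_left)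
  also have "\<dots> = z N" using N by simp
  finally have c0: "c i \<noteq> 0" if "i < N" for i
    using z that by (metis finite_lessThan lessThan_iff prod_zero)
  define c' where "c' i = (if i < N then c i else 1)" for i
  show thesis
  proof (rule that[of c'])
    show "c' i \<noteq> 0" for i by (simp add: c'_def c0)
    fix b :: "nat \<Rightarrow> complex" assume b: "\<And>i. b i \<noteq> 0"
    show "Z_expansion N (antidiag N b) (antidiag N (\<lambda>i. b i * c' i)) z"
      unfolding Z_expansion_def
    proof
      fix \<mu>
      have "antidiag N b + \<mu> \<cdot>\<^sub>m antidiag N (\<lambda>i. b i * c' i) = antidiag N (\<lambda>i. b i * (1 + \<mu> * c' i))"
        by (intro eq_matI) (auto simp: antidiag_def algebra_simps)
      then have "det (antidiag N b + \<mu> \<cdot>\<^sub>m antidiag N (\<lambda>i. b i * c' i)) / det (antidiag N b)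
          = (\<Prod>i<N. 1 + \<mu> * c' i)"
        using b det_antidiag_1_nonzero[of N]
        by (simp add: det_antidiag[of N b] det_antidiag[of N "\<lambda>i. b i * (1 + \<mu> * c' i)"] prod.distrib)
      also have "\<dots> = (\<Prod>i<N. 1 + \<mu> * c i)"
        by (intro prod.cong) (auto simp: c'_def)
      finally show "det (antidiag N b + \<mu> \<cdot>\<^sub>m antidiag N (\<lambda>i. b i * c' i)) / det (antidiag N b)
          = 1 + (\<Sum>k = 1..N. \<mu> ^ k * z k)"
        by (simp add: prod)
    qed
  qed
qed

lemma upper_right_minor_antidiag:
  assumes "q \<le> N"
  shows "upper_right_minor N q (antidiag N f) = det (antidiag q (\<lambda>_. 1)) * (\<Prod>i<q. f i)"
proof -
  have "mat q q (\<lambda>(i, j). antidiag N f $$ (i, N - q + j)) = antidiag q f"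
    using assms by (intro eq_matI) (auto simp: antidiag_def)
  then show ?thesis
    by (simp add: upper_right_minor_def det_antidiag[of q f])
qed

lemma upper_left_minor_diag:
  assumes "q \<le> N"
  shows "upper_left_minor q (mat N N (\<lambda>(i, j). if i = j then f i else 0)) = (\<Prod>i<q. f i)"
proof -
  have "mat q q (\<lambda>(i, j). mat N N (\<lambda>(i, j). if i = j then f i else 0) $$ (i, j))
      = mat q q (\<lambda>(i, j). if i = j then f i else 0)"
    using assms by (intro eq_matI) auto
  then show ?thesis
    unfolding upper_left_minor_def
    by (simp, subst det_upper_triangular[where n = q])
      (auto simp: diag_mat_def prod.list_conv_set_nth lessThan_atLeast0 intro!: prod.cong)
qed

lemma S_matrix_antidiag:
  assumes b: "\<And>i. b i \<noteq> 0"
  shows "S_matrix (antidiag N a, antidiag N b, C) = mat N N (\<lambda>(i, j). if i = j then a (N - 1 - i) / b i else 0)"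
proof -
  let ?A = "antidiag N a" and ?B = "antidiag N b"
  let ?S = "mat N N (\<lambda>(i, j). if i = j then a (N - 1 - i) / b i else 0)"
  have det: "det ?B \<noteq> 0"
    using b det_antidiag_1_nonzero[of N] by (simp add: det_antidiag[of N b])
  note I = the_mat_inverse[OF antidiag_carrier det]
  have "transpose_mat ?A = ?S * ?B"
  proof (rule eq_matI)
    fix i j assume "i < dim_row (?S * ?B)" "j < dim_col (?S * ?B)"
    then have ij: "i < N" "j < N" by (simp_all add: antidiag_def)
    have "(?S * ?B) $$ (i, j) = (\<Sum>k<N. ?S $$ (i, k) * ?B $$ (k, j))"
      using ij by (simp add: antidiag_def scalar_prod_def lessThan_atLeast0)
    also have "\<dots> = (\<Sum>k<N. if k = i then a (N - 1 - i) / b i * ?B $$ (i, j) else 0)"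
      using ij by (intro sum.cong) auto
    also have "\<dots> = a (N - 1 - i) / b i * ?B $$ (i, j)"
      using ij by simp
    also have "\<dots> = transpose_mat ?A $$ (i, j)"
    proof (cases "i + j = N - 1")
      case True
      then have "N - 1 - i = j" by simp
      with True ij b show ?thesis by (simp add: antidiag_def add.commute)
    qed (use ij in \<open>simp add: antidiag_def add.commute\<close>)
    finally show "transpose_mat ?A $$ (i, j) = (?S * ?B) $$ (i, j)" ..
  qed (simp_all add: antidiag_def)
  then have "S_matrix (?A, ?B, C) = ?S * (?B * the (mat_inverse ?B))"
    using I(1) by (simp add: assoc_mult_mat[of _ N N _ N _ N])
  then show ?thesis
    by (simp add: I(2) right_mult_one_mat[of _ N N])
qed

text \<open>Writing \<open>P q\<close> for the product of the first \<open>q\<close> entries of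
  \<open>b\<close>, the determinants contribute \<open>(P N)^2\<close> and the minors of
  \<open>S\<close> and of \<open>C\<close> each contribute \<open>1 / (P p P (N - p))\<close>. Since
  \<open>b\<close> is 1 from \<open>N div 2\<close> on, \<open>P (N - p) = P N\<close>, and only
  \<open>1 / (P p)^2\<close> is left.\<close>

lemma X_fun_antidiag:
  assumes p: "p \<in> {1..N div 2}"
    and nz: "\<And>i. a i \<noteq> 0" "\<And>i. b i \<noteq> 0" "\<And>i. c i \<noteq> 0"
    and b1: "\<And>i. i \<ge> N div 2 \<Longrightarrow> b i = 1"
  shows "X_fun N p (antidiag N a, antidiag N b, antidiag N (\<lambda>i. b i * c i)) =
    (\<Prod>i<p. a (N - 1 - i)) * (\<Prod>i<N - p. a (N - 1 - i)) * (\<Prod>i<N. c i) * det (antidiag N (\<lambda>_. 1))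
    / ((\<Prod>i<p. c i) * (\<Prod>i<N - p. c i) * (\<Prod>i<N. a i)
        * (det (antidiag (N - p) (\<lambda>_. 1)) * det (antidiag p (\<lambda>_. 1)))) / (\<Prod>i<p. b i)\<^sup>2"
proof -
  have pN: "p \<le> N" "N - p \<le> N" "p \<le> N div 2" "N div 2 \<le> N - p" using p by auto
  have tail: "(\<Prod>i<q. b i) = (\<Prod>i<N. b i)" if "N div 2 \<le> q" "q \<le> N" for q
    using that by (intro prod.mono_neutral_left) (auto simp: b1)
  have X: "X_fun N p x = upper_left_minor p (S_matrix x) * upper_left_minor (N - p) (S_matrix x)
      / (upper_right_minor N (N - p) (component Block_C x) * upper_right_minor N p (component Block_C x))
      * (det (component Block_B x) * det (component Block_C x) / det (component Block_A x))" for x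
    by (cases x) (simp add: Let_def)
  have "(\<Prod>i<N. b i) \<noteq> 0" "(\<Prod>i<p. b i) \<noteq> 0" "(\<Prod>i<N. a i) \<noteq> 0" "(\<Prod>i<p. c i) \<noteq> 0" "(\<Prod>i<N - p. c i) \<noteq> 0"
    using nz by simp_all
  moreover have "det (antidiag n (\<lambda>_. 1)) \<noteq> 0" for n by (rule det_antidiag_1_nonzero)
  ultimately show ?thesis
    unfolding X S_matrix_antidiag[OF nz(2)] component.simps upper_left_minor_diag[OF pN(1)]
      upper_left_minor_diag[OF pN(2)] upper_right_minor_antidiag[OF pN(1)] upper_right_minor_antidiag[OF pN(2)]
      det_antidiag[of N a] det_antidiag[of N b] det_antidiag[of N "\<lambda>i. b i * c i"]
      prod.distrib prod_dividef tail[OF pN(4,2)]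
    by (simp add: field_simps power2_eq_square)
qed

lemma casimir_values_surjective:
  fixes y \<xi> z :: "nat \<Rightarrow> complex"
  assumes N: "N \<ge> 1" and \<xi>: "\<And>p. \<xi> p \<noteq> 0" and z: "z N \<noteq> 0"
  obtains x where "x \<in> common_domain N"
    "\<And>p. p \<in> {1..N div 2} \<Longrightarrow> Y_fun N p x = y p"
    "\<And>p. p \<in> {1..N div 2} \<Longrightarrow> X_fun N p x = \<xi> p"
    "\<And>p. p \<in> {1..N} \<Longrightarrow> Z_fun N p x = z p"
proof -
  obtain a where a: "\<And>i. a i \<noteq> 0" "Y_expansion N (antidiag N a) y"
    using exists_Y_values[OF N] by blast
  obtain c where c: "\<And>i. c i \<noteq> 0"
    "\<And>b. (\<And>i. b i \<noteq> 0) \<Longrightarrow> Z_expansion N (antidiag N b) (antidiag N (\<lambda>i. b i * c i)) z"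
    using exists_Z_values[of N z] N z by blast
  \<comment> \<open>The value of \<open>X\<^sub>p\<close> when all \<open>b i\<close> are 1.\<close>
  define \<kappa> where "\<kappa> p = (\<Prod>i<p. a (N - 1 - i)) * (\<Prod>i<N - p. a (N - 1 - i)) * (\<Prod>i<N. c i) * det (antidiag N (\<lambda>_. 1))
    / ((\<Prod>i<p. c i) * (\<Prod>i<N - p. c i) * (\<Prod>i<N. a i)
        * (det (antidiag (N - p) (\<lambda>_. 1)) * det (antidiag p (\<lambda>_. 1))))" for p
  have \<kappa>: "\<kappa> p \<noteq> 0" for p
    using a(1) c(1) det_antidiag_1_nonzero by (simp add: \<kappa>_def)
  \<comment> \<open>\<open>s p\<close> is the required partial product of \<open>b\<close>, a square
    root because that product enters squared; \<open>s 0 = 1\<close> is the empty product. The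
    \<open>b i\<close> are then successive quotients, which telescope.\<close>
  define s where "s p = (if p = 0 then 1 else csqrt (\<kappa> p / \<xi> p))" for p
  have s: "s p \<noteq> 0" for p using \<kappa>[of p] \<xi>[of p] by (simp add: s_def)
  define b where "b i = (if i < N div 2 then s (Suc i) / s i else 1)" for i
  have b: "b i \<noteq> 0" for i by (simp add: b_def s)
  have b_prod: "(\<Prod>i<p. b i) = s p" if "p \<le> N div 2" for p
    using that
  proof (induction p)
    case 0
    then show ?case by (simp add: s_def)
  next
    case (Suc p)
    then show ?case using s[of p] by (simp add: b_def)
  qed
  let ?A = "antidiag N a" and ?B = "antidiag N b" and ?C = "antidiag N (\<lambda>i. b i * c i)"
  have det: "det (antidiag N f) \<noteq> 0" if "\<And>i. f i \<noteq> 0" for f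
    using that det_antidiag_1_nonzero[of N] by (simp add: det_antidiag[of N f])
  have phase: "(?A, ?B, ?C) \<in> phase_space N"
    using det[of a] det[of b] det[of "\<lambda>i. b i * c i"] a(1) b c(1) by (simp add: phase_space_def)
  have minor: "upper_right_minor N q ?C \<noteq> 0" if "q \<le> N" for q
    using b c(1) det_antidiag_1_nonzero[of q] by (simp add: upper_right_minor_antidiag[OF that])
  show thesis
  proof (rule that[of "(?A, ?B, ?C)"])
    show "(?A, ?B, ?C) \<in> common_domain N"
      using phase minor by (auto simp: common_domain_def X_domain_def)
    show "Y_fun N p (?A, ?B, ?C) = y p" if "p \<in> {1..N div 2}" for p
      using Y_coeffs_eqI(2)[OF a(2) that] by simp
    show "Z_fun N p (?A, ?B, ?C) = z p" if "p \<in> {1..N}" for p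
      using Z_coeffs_eqI(2)[OF c(2)[OF b] that] by simp
    show "X_fun N p (?A, ?B, ?C) = \<xi> p" if p: "p \<in> {1..N div 2}" for p
    proof -
      have "X_fun N p (?A, ?B, ?C) = \<kappa> p / (\<Prod>i<p. b i)\<^sup>2"
        unfolding \<kappa>_def by (rule X_fun_antidiag[OF p a(1) b c(1)]) (simp add: b_def)
      also have "(\<Prod>i<p. b i)\<^sup>2 = \<kappa> p / \<xi> p"
        using p by (subst b_prod) (auto simp: s_def)
      finally show ?thesis
        using \<kappa>[of p] \<xi>[of p] by simp
    qed
  qed
qed

section \<open>Algebraic independence\<close>

text \<open>Uniqueness of base \<open>K\<close> digits: reduction modulo \<open>K\<close> yields the
  lowest one, and the others follow by induction.\<close>

lemma digits_inject:
  fixes K :: nat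
  assumes "\<And>i. i < n \<Longrightarrow> f i < K" "\<And>i. i < n \<Longrightarrow> g i < K"
    and "(\<Sum>i<n. f i * K ^ i) = (\<Sum>i<n. g i * K ^ i)"
  shows "\<forall>i<n. f i = g i"
  using assms
proof (induction n arbitrary: f g)
  case (Suc n)
  have split: "(\<Sum>i<Suc n. f i * K ^ i) = f 0 + K * (\<Sum>i<n. f (Suc i) * K ^ i)" for f
    by (simp add: sum.lessThan_Suc_shift sum_distrib_left mult_ac del: sum.lessThan_Suc)
  have lt: "f 0 < K" "g 0 < K" using Suc.prems(1,2) by auto
  have eq: "f 0 + K * (\<Sum>i<n. f (Suc i) * K ^ i) = g 0 + K * (\<Sum>i<n. g (Suc i) * K ^ i)"
    using Suc.prems(3) by (simp only: split)
  then have "f 0 = g 0"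
    using lt by (metis mod_less mod_mult_self2)
  with eq lt have "(\<Sum>i<n. f (Suc i) * K ^ i) = (\<Sum>i<n. g (Suc i) * K ^ i)"
    by simp
  then have "\<forall>i<n. f (Suc i) = g (Suc i)"
    using Suc.prems(1,2) by (intro Suc.IH) auto
  with \<open>f 0 = g 0\<close> show ?case
    by (auto simp: less_Suc_eq_0_disj)
qed simp

text \<open>Kronecker substitution: setting the \<open>i\<close>th variable to \<open>t ^ (K ^ i)\<close>, with \<open>K\<close> larger than all
  exponents, maps distinct monomials to distinct powers of \<open>t\<close>.\<close>

lemma polynomial_eq_0_on_torus:
  fixes P :: "nat polynomial"
  assumes vars: "poly_vars P \<subseteq> {..<n}"
    and zero: "\<And>a. (\<And>i. a i \<noteq> 0) \<Longrightarrow> poly_eval P a = 0"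
  shows "P = 0"
proof (rule ccontr)
  assume "P \<noteq> 0"
  then obtain m where m: "m \<in> Poly_Mapping.keys P"
    using keys_eq_empty[of P] by (metis all_not_in_conv)
  have sub: "Poly_Mapping.keys m \<subseteq> {..<n}" if "m \<in> Poly_Mapping.keys P" for m
    using vars that by (auto simp: poly_vars_def)
  let ?E = "\<Union>m\<in>Poly_Mapping.keys P. Poly_Mapping.lookup m ` {..<n}"
  \<comment> \<open>One more than the largest exponent, so that exponents are digits in base
    \<open>K\<close>. The inserted 0 keeps the maximum defined when \<open>n = 0\<close>.\<close>
  define K where "K = Suc (Max (insert 0 ?E))"
  have K: "Poly_Mapping.lookup m i < K" if "m \<in> Poly_Mapping.keys P" "i < n" for m i
    unfolding K_def using that by (intro le_imp_less_Suc Max_ge) auto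
  define w where "w m = (\<Sum>i<n. Poly_Mapping.lookup m i * K ^ i)" for m :: "nat \<Rightarrow>\<^sub>0 nat"
  have w_inj: "m' = m" if "m' \<in> Poly_Mapping.keys P" "w m' = w m" for m'
  proof (rule poly_mapping_eqI)
    fix i
    show "Poly_Mapping.lookup m' i = Poly_Mapping.lookup m i"
    proof (cases "i < n")
      case True
      then show ?thesis
        using digits_inject[of n "Poly_Mapping.lookup m'" K "Poly_Mapping.lookup m"] K m that
        by (auto simp: w_def)
    next
      case False
      then have "i \<notin> Poly_Mapping.keys m" "i \<notin> Poly_Mapping.keys m'"
        using sub[OF m] sub[OF that(1)] by auto
      then show ?thesis by (simp add: in_keys_iff)
    qed
  qed
  define q where "q = (\<Sum>m\<in>Poly_Mapping.keys P. monom (Poly_Mapping.lookup P m) (w m))"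
  have "q = 0"
  proof (rule poly_eq_0_nonzero)
    fix t :: complex assume t: "t \<noteq> 0"
    have "poly q t = poly_eval P (\<lambda>i. t ^ (K ^ i))"
      unfolding poly_eval_def q_def poly_sum poly_monom
    proof (rule sum.cong[OF refl])
      fix m assume "m \<in> Poly_Mapping.keys P"
      then have "monomial_value (\<lambda>i. t ^ (K ^ i)) m = (\<Prod>i<n. (t ^ (K ^ i)) ^ Poly_Mapping.lookup m i)"
        using sub by (intro monomial_value_superset) auto
      also have "\<dots> = t ^ w m"
        by (simp add: w_def power_sum power_mult[symmetric] mult.commute)
      finally show "Poly_Mapping.lookup P m * t ^ w m
          = Poly_Mapping.lookup P m * monomial_value (\<lambda>i. t ^ (K ^ i)) m" by simp
    qed
    also have "\<dots> = 0" using t by (intro zero) simp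
    finally show "poly q t = 0" .
  qed
  then have "0 = coeff q (w m)" by simp
  also have "\<dots> = (\<Sum>m'\<in>Poly_Mapping.keys P. if m' = m then Poly_Mapping.lookup P m' else 0)"
    unfolding q_def coeff_sum by (intro sum.cong) (auto dest: w_inj)
  also have "\<dots> = Poly_Mapping.lookup P m"
    using m by simp
  finally show False using m by (simp add: in_keys_iff)
qed

lemma length_casimir_list: "length (casimir_list N) = 2 * (N div 2) + N"
  by (simp add: casimir_list_def)

lemma casimir_list_nth:
  assumes "i < length (casimir_list N)"
  defines "m \<equiv> N div 2"
  shows "casimir_list N ! i = (if i < m then Y_fun N (i + 1)
    else if i < 2 * m then X_fun N (i - m + 1) else Z_fun N (i - 2 * m + 1))"
proof -
  have list: "casimir_list N = map (Y_fun N) [1..<Suc m] @ map (X_fun N) [1..<Suc m] @ map (Z_fun N) [1..<Suc N]"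
    by (simp add: casimir_list_def m_def)
  have len: "i < 2 * m + N"
    using assms length_casimir_list by simp
  consider "i < m" | "m \<le> i" "i < 2 * m" | "2 * m \<le> i" "i - 2 * m < N" "i - m - m = i - 2 * m"
    using len by linarith
  then show ?thesis
    unfolding list by cases (auto simp: nth_append simp del: upt_Suc diff_diff_left)
qed

lemma casimirs_algebraically_independent:
  assumes N: "N \<ge> 1"
  shows "algebraically_independent_on (common_domain N) (casimir_list N)"
  unfolding algebraically_independent_on_def
proof (intro allI impI, elim conjE)
  fix P :: "nat polynomial"
  assume vars: "poly_vars P \<subseteq> {..<length (casimir_list N)}"
    and zero: "\<forall>x\<in>common_domain N. poly_eval P (\<lambda>i. (casimir_list N ! i) x) = 0"
  let ?m = "N div 2"
  show "P = 0"
  proof (rule polynomial_eq_0_on_torus[OF vars])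
    \<comment> \<open>An arbitrary torus point is split into consecutive segments of lengths
      \<open>?m\<close>, \<open>?m\<close> and \<open>N\<close>; its coordinates in the last two are
      nonzero, as surjectivity requires of the \<open>X\<^sub>p\<close> and of
      \<open>Z\<^sub>N\<close>.\<close>
    fix a :: "nat \<Rightarrow> complex" assume a: "\<And>i. a i \<noteq> 0"
    obtain x where x: "x \<in> common_domain N"
      "\<And>p. p \<in> {1..?m} \<Longrightarrow> Y_fun N p x = a (p - 1)"
      "\<And>p. p \<in> {1..?m} \<Longrightarrow> X_fun N p x = a (?m + p - 1)"
      "\<And>p. p \<in> {1..N} \<Longrightarrow> Z_fun N p x = a (2 * ?m + p - 1)"
      using casimir_values_surjective[OF N, of "\<lambda>p. a (?m + p - 1)" "\<lambda>p. a (2 * ?m + p - 1)" "\<lambda>p. a (p - 1)"] a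
      by metis
    have "(casimir_list N ! i) x = a i" if "i < length (casimir_list N)" for i
      using that by (auto simp: casimir_list_nth length_casimir_list x)
    then have "poly_eval P a = poly_eval P (\<lambda>i. (casimir_list N ! i) x)"
      by (intro poly_eval_entries_cong[OF vars]) auto
    with zero x(1) show "poly_eval P a = 0" by simp
  qed
qed

theorem theorem6p5:
  fixes N :: nat
  assumes "N \<ge> 1"
  shows "(\<forall>(A, B, C) \<in> phase_space N.
            Y_expansion N A (Y_coeffs N A) \<and> Z_expansion N B C (Z_coeffs N B C))
       \<and> (\<forall>p\<in>{1..N div 2}. casimir_on N (phase_space N) (Y_fun N p))
       \<and> (\<forall>p\<in>{1..N div 2}. casimir_on N (X_domain N p) (X_fun N p))
       \<and> (\<forall>p\<in>{1..N}. casimir_on N (phase_space N) (Z_fun N p))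
       \<and> length (casimir_list N) = 2 * (N div 2) + N
       \<and> algebraically_independent_on (common_domain N) (casimir_list N)"
proof (intro conjI ballI)
  fix x assume "x \<in> phase_space N"
  then show "case x of (A, B, C) \<Rightarrow>
      Y_expansion N A (Y_coeffs N A) \<and> Z_expansion N B C (Z_coeffs N B C)"
    using assms
    by (auto simp: phase_space_def intro!: Y_coeffs_eqI(1)[OF Y_expansion_formula]
        Z_coeffs_eqI(1)[OF Z_expansion_pencil_poly])
next
  show "casimir_on N (X_domain N p) (X_fun N p)" if "p \<in> {1..N div 2}" for p
    using that by (intro casimir_on_X_fun) auto
qed (use assms in \<open>auto intro: casimir_on_Y_fun casimir_on_Z_fun length_casimir_list
    casimirs_algebraically_independent\<close>)

end
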